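(* Let $2\leq p<\infty$, let $g\in\mathcal{D}(\mathbb{C})$, and let $X$ be an infinite-dimensional $p$-uniformly PL-convex complex Banach space. If the Volterra operator $T_g:\mathscr{H}_p^{\text{weak}}(X)\to\mathscr{H}_p^+(X)$ is bounded, then $g$ is constant.
   Context: For a complex Banach space $X$, $\mathcal{D}(X)$ denotes the space of Dirichlet series $\sum_{n\geq1}x_nn^{-s}$ with coefficients $x_n\in X$ that converge at some point $s_0\in\mathbb{C}$. $\mathbb{T}^\infty$ is the countably infinite product of unit circles $\mathbb{T}\subset\mathbb{C}$, with normalized Haar measure $m_\infty$ (the product of normalized Lebesgue measures $m$ on $\mathbb{T}$). $\mathbb{Z}^{(\infty)}$ is the set of eventually null integer sequences and $\mathbb{N}_0^{(\infty)}$ the subset of those with all entries $\geq 0$; $z^\nu=\prod_j z_j^{\nu_j}$. For $F$ in the Bochner space $L_1(\mathbb{T}^\infty,X)$, $\widehat F(\nu)=\int_{\mathbb{T}^\infty}F(z)z^{-\nu}\,dm_\infty(z)$. For $1\le p<\infty$, $H_p(\mathbb{T}^\infty,X)$ is the closed subspace of $L_p(\mathbb{T}^\infty,X)$ of those $F$ with $\widehat F(\nu)=0$ for all $\nu\in\mathbb{Z}^{(\infty)}\setminus\mathbb{N}_0^{(\infty)}$. Let $\mathfrak{p}_1<\mathfrak{p}_2<\cdots$ be the primes; for $n\in\mathbb{N}$, $\nu(n)\in\mathbb{N}_0^{(\infty)}$ is the unique multi-index with $n=\prod_j\mathfrak{p}_j^{\nu(n)_j}$. The Bohr transform of $F\in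 H_1(\mathbb{T}^\infty,X)$ is the Dirichlet series $\mathfrak{B}(F)(s)=\sum_{n\ge1}\widehat F(\nu(n))n^{-s}$. The Hardy space $\mathscr{H}_p(X)$ is $\mathfrak{B}(H_p(\mathbb{T}^\infty,X))$ with norm $\|f\|_{\mathscr{H}_p(X)}=\|\mathfrak{B}^{-1}(f)\|_{H_p(\mathbb{T}^\infty,X)}$. For $u\in\mathbb{C}$, $f_u(\cdot)=f(\cdot+u)$. $\mathscr{H}_p^+(X)$ is the space of $f\in\mathcal{D}(X)$ such that $f_\sigma\in\mathscr{H}_p(X)$ for every $\sigma>0$ and $\|f\|_{\mathscr{H}_p^+(X)}=\sup_{\sigma>0}\|f_\sigma\|_{\mathscr{H}_p(X)}<\infty$. $\mathscr{H}_p^{\text{weak}}(X)$ is the space of $f\in\mathcal{D}(X)$ such that $x^*\circ f\in\mathscr{H}_p(\mathbb{C})$ for every $x^*\in X^*$ and $\|f\|_{\mathscr{H}_p^{\text{weak}}(X)}=\sup_{x^*\in B_{X^*}}\|x^*\circ f\|_{\mathscr{H}_p(\mathbb{C})}<\infty$, where $B_{X^*}$ is the closed unit ball of $X^*$. For $g\in\mathcal{D}(\mathbb{C})$, the Volterra operator $T_g$ is defined for $f\in\mathcal{D}(X)$ by $T_gf(s)=-\int_s^{+\infty}f(u)g'(u)\,du$ for $\Re s$ large enough (integration along the horizontal half-line starting at $s$); $T_gf$ is a Dirichlet series in $\mathcal{D}(X)$. For $2\le p<\infty$, $X$ is $p$-uniformly PL-convex if there exists $C>0$ such that $\int_{\mathbb{T}}\|x+\xi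 y\|_X^p\,dm(\xi)\ge\|x\|_X^p+C\|y\|_X^p$ for all $x,y\in X$. *)

theory Defs
  imports "HOL-Probability.Infinite_Product_Measure" "HOL-Computational_Algebra.Primes"
begin

section \<open>Complex Banach spaces\<close>

text \<open>The real scalar multiplication inherited from \<^class>\<open>banach\<close> is tied to the complex one.\<close>

class complex_banach = banach +
  fixes scaleC :: "complex \<Rightarrow> 'a \<Rightarrow> 'a"  (infixr "*\<^sub>C" 75)
  assumes scaleC_add_right: "c *\<^sub>C (x + y) = c *\<^sub>C x + c *\<^sub>C y"
    and scaleC_add_left: "(c + d) *\<^sub>C x = c *\<^sub>C x + d *\<^sub>C x"
    and scaleC_scaleC: "c *\<^sub>C (d *\<^sub>C x) = (c * d) *\<^sub>C x"
    and scaleC_of_real: "complex_of_real r *\<^sub>C x = r *\<^sub>R x"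
    and norm_scaleC: "norm (c *\<^sub>C x) = cmod c * norm x"

instantiation complex :: complex_banach
begin

definition scaleC_complex :: "complex \<Rightarrow> complex \<Rightarrow> complex"
  where "scaleC_complex c x = c * x"

instance
  by standard (simp_all add: scaleC_complex_def algebra_simps norm_mult scaleR_conv_of_real)

end

lemma vector_space_scaleC: "vector_space (scaleC :: complex \<Rightarrow> 'a \<Rightarrow> 'a::complex_banach)"
proof
  show "1 *\<^sub>C x = x" for x :: 'a
    using scaleC_of_real[of 1 x] by simp
qed (simp_all add: scaleC_add_right scaleC_add_left scaleC_scaleC)

definition infinite_dimensional :: "'a::complex_banach itself \<Rightarrow> bool"
  where "infinite_dimensional _ \<longleftrightarrow>
    \<not> (\<exists>B. finite_dimensional_vector_space (scaleC :: complex \<Rightarrow> 'a \<Rightarrow> 'a) B)"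

definition complex_dual :: "('a::complex_banach \<Rightarrow> complex) set"
  where "complex_dual = {\<phi>. bounded_linear \<phi> \<and> (\<forall>c x. \<phi> (c *\<^sub>C x) = c * \<phi> x)}"

definition dual_unit_ball :: "('a::complex_banach \<Rightarrow> complex) set"
  where "dual_unit_ball = {\<phi> \<in> complex_dual. onorm \<phi> \<le> 1}"


section \<open>The circle and the infinite torus\<close>

definition circle_measure :: "complex measure"
  where "circle_measure =
    distr (uniform_measure lborel {0..2 * pi}) (restrict_space borel (sphere 0 1)) cis"

lemma space_circle_measure: "space circle_measure = sphere 0 1"
  by (simp add: circle_measure_def space_restrict_space)

lemma prob_space_circle_measure: "prob_space circle_measure"
proof -
  have "prob_space (uniform_measure lborel {0..2 * pi})"
    by (rule prob_space_uniform_measure) auto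
  moreover have "cis \<in> uniform_measure lborel {0..2 * pi} \<rightarrow>\<^sub>M restrict_space borel (sphere 0 1)"
  proof (rule measurable_restrict_space2)
    have "cis \<in> borel_measurable borel"
      by (intro borel_measurable_continuous_onI continuous_intros)
    then show "cis \<in> borel_measurable (uniform_measure lborel {0..2 * pi})"
      by (simp cong: measurable_cong_sets)
  qed simp
  ultimately show ?thesis
    unfolding circle_measure_def by (rule prob_space.prob_space_distr)
qed

definition torus_measure :: "(nat \<Rightarrow> complex) measure"
  where "torus_measure = (\<Pi>\<^sub>M j\<in>UNIV. circle_measure)"

definition ev_null :: "(nat \<Rightarrow> int) set"
  where "ev_null = {\<nu>. finite {j. \<nu> j \<noteq> 0}}"

definition ev_null_nonneg :: "(nat \<Rightarrow> int) set"
  where "ev_null_nonneg = {\<nu> \<in> ev_null. \<forall>j. 0 \<le> \<nu> j}"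

definition monomial :: "(nat \<Rightarrow> complex) \<Rightarrow> (nat \<Rightarrow> int) \<Rightarrow> complex"
  where "monomial z \<nu> = (\<Prod>j | \<nu> j \<noteq> 0. z j powi \<nu> j)"


section \<open>Bochner integral in arbitrary Banach spaces\<close>

text \<open>\<^const>\<open>has_bochner_integral\<close> is restricted to second countable spaces, whereas \<open>X\<close> need
  not be separable.  The definitions below follow it, with Borel measurability replaced by strong
  measurability.  Pointwise limits are required everywhere on the space rather than almost
  everywhere: this selects representatives whose norm is Borel measurable, and every class of
  almost everywhere equal functions that are almost everywhere limits of simple functions has such
  a representative.\<close>

definition strongly_measurable :: "'m measure \<Rightarrow> ('m \<Rightarrow> 'a::real_normed_vector) \<Rightarrow> bool"
  where "strongly_measurable M F \<longleftrightarrow>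
    (\<exists>S. (\<forall>i::nat. simple_function M (S i)) \<and> (\<forall>z\<in>space M. (\<lambda>i. S i z) \<longlonglongrightarrow> F z))"

definition has_strong_integral :: "'m measure \<Rightarrow> ('m \<Rightarrow> 'a::real_normed_vector) \<Rightarrow> 'a \<Rightarrow> bool"
  where "has_strong_integral M F x \<longleftrightarrow> strongly_measurable M F \<and>
    (\<exists>S. (\<forall>i::nat. Bochner_Integration.simple_bochner_integrable M (S i)) \<and>
         (\<lambda>i. \<integral>\<^sup>+z. norm (F z - S i z) \<partial>M) \<longlonglongrightarrow> 0 \<and>
         (\<lambda>i. Bochner_Integration.simple_bochner_integral M (S i)) \<longlonglongrightarrow> x)"

definition strong_integral :: "'m measure \<Rightarrow> ('m \<Rightarrow> 'a::real_normed_vector) \<Rightarrow> 'a"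
  where "strong_integral M F =
    (if \<exists>x. has_strong_integral M F x then THE x. has_strong_integral M F x else 0)"

definition Lp_space :: "real \<Rightarrow> 'm measure \<Rightarrow> ('m \<Rightarrow> 'a::real_normed_vector) set"
  where "Lp_space p M = {F. strongly_measurable M F \<and> integrable M (\<lambda>z. norm (F z) powr p)}"

definition Lp_norm :: "real \<Rightarrow> 'm measure \<Rightarrow> ('m \<Rightarrow> 'a::real_normed_vector) \<Rightarrow> real"
  where "Lp_norm p M F = (LINT z|M. norm (F z) powr p) powr (1 / p)"


section \<open>Dirichlet series\<close>

text \<open>A Dirichlet series is given by its coefficients \<open>a n\<close>, \<open>n \<ge> 1\<close>; the entry \<open>a 0\<close> is normalised
  to \<open>0\<close>, so that a series is determined by its sum function on some half-plane.\<close>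

definition dterm :: "(nat \<Rightarrow> 'a::complex_banach) \<Rightarrow> complex \<Rightarrow> nat \<Rightarrow> 'a"
  where "dterm a s n = (of_nat n powr (- s)) *\<^sub>C a n"

definition conv_set :: "(nat \<Rightarrow> 'a::complex_banach) \<Rightarrow> complex set"
  where "conv_set a = {s. summable (dterm a s)}"

definition dirichlet_sum :: "(nat \<Rightarrow> 'a::complex_banach) \<Rightarrow> complex \<Rightarrow> 'a"
  where "dirichlet_sum a s = (\<Sum>n. dterm a s n)"

definition Dirichlet :: "(nat \<Rightarrow> 'a::complex_banach) set"
  where "Dirichlet = {a. a 0 = 0 \<and> conv_set a \<noteq> {}}"

text \<open>The coefficients of \<open>f(\<cdot> + u)\<close> are \<open>n\<^sup>-\<^sup>u a n\<close>, i.e. the terms of \<open>f\<close> at \<open>u\<close>.\<close>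

definition translate :: "complex \<Rightarrow> (nat \<Rightarrow> 'a::complex_banach) \<Rightarrow> nat \<Rightarrow> 'a"
  where "translate u a = dterm a u"


section \<open>Hardy spaces\<close>

definition fourier_coeff :: "((nat \<Rightarrow> complex) \<Rightarrow> 'a::complex_banach) \<Rightarrow> (nat \<Rightarrow> int) \<Rightarrow> 'a"
  where "fourier_coeff F \<nu> =
    strong_integral torus_measure (\<lambda>z. monomial z (\<lambda>j. - \<nu> j) *\<^sub>C F z)"

definition Hp_torus :: "real \<Rightarrow> ((nat \<Rightarrow> complex) \<Rightarrow> 'a::complex_banach) set"
  where "Hp_torus p =
    {F \<in> Lp_space p torus_measure. \<forall>\<nu> \<in> ev_null - ev_null_nonneg. fourier_coeff F \<nu> = 0}"

text \<open>\<open>enumerate {p. prime p}\<close> lists the primes increasingly, starting at index \<open>0\<close>.\<close>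

definition prime_exponents :: "nat \<Rightarrow> nat \<Rightarrow> int"
  where "prime_exponents n j = int (multiplicity (enumerate {p::nat. prime p} j) n)"

definition bohr :: "((nat \<Rightarrow> complex) \<Rightarrow> 'a::complex_banach) \<Rightarrow> nat \<Rightarrow> 'a"
  where "bohr F n = (if n = 0 then 0 else fourier_coeff F (prime_exponents n))"

definition hardy :: "real \<Rightarrow> (nat \<Rightarrow> 'a::complex_banach) set"
  where "hardy p = bohr ` Hp_torus p"

text \<open>\<^const>\<open>bohr\<close> is injective up to almost everywhere equality, so that the norm does not depend on
  the preimage chosen by \<^const>\<open>inv_into\<close>.\<close>

definition hardy_norm :: "real \<Rightarrow> (nat \<Rightarrow> 'a::complex_banach) \<Rightarrow> real"
  where "hardy_norm p f = Lp_norm p torus_measure (inv_into (Hp_torus p) bohr f)"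

definition hardy_plus :: "real \<Rightarrow> (nat \<Rightarrow> 'a::complex_banach) set"
  where "hardy_plus p = {f \<in> Dirichlet.
    (\<forall>\<sigma>>0. translate (complex_of_real \<sigma>) f \<in> hardy p) \<and>
    bdd_above ((\<lambda>\<sigma>. hardy_norm p (translate (complex_of_real \<sigma>) f)) ` {0<..})}"

definition hardy_plus_norm :: "real \<Rightarrow> (nat \<Rightarrow> 'a::complex_banach) \<Rightarrow> real"
  where "hardy_plus_norm p f = (SUP \<sigma>\<in>{0<..}. hardy_norm p (translate (complex_of_real \<sigma>) f))"

definition hardy_weak :: "real \<Rightarrow> (nat \<Rightarrow> 'a::complex_banach) set"
  where "hardy_weak p = {f \<in> Dirichlet.
    (\<forall>\<phi>\<in>complex_dual. \<phi> \<circ> f \<in> hardy p) \<and>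
    bdd_above ((\<lambda>\<phi>. hardy_norm p (\<phi> \<circ> f)) ` dual_unit_ball)}"

definition hardy_weak_norm :: "real \<Rightarrow> (nat \<Rightarrow> 'a::complex_banach) \<Rightarrow> real"
  where "hardy_weak_norm p f = (SUP \<phi>\<in>dual_unit_ball. hardy_norm p (\<phi> \<circ> f))"


section \<open>The Volterra operator and PL-convexity\<close>

text \<open>The horizontal half-line starting at \<open>s\<close> is parametrised by \<open>t \<mapsto> s + t\<close>, \<open>t \<ge> 0\<close>.\<close>

definition volterra :: "(nat \<Rightarrow> complex) \<Rightarrow> (nat \<Rightarrow> 'a::complex_banach) \<Rightarrow> nat \<Rightarrow> 'a"
  where "volterra g f = (THE h. h \<in> Dirichlet \<and>
    (\<exists>\<sigma>::real. \<forall>s. Re s > \<sigma> \<longrightarrow>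
      ((\<lambda>t. deriv (dirichlet_sum g) (s + complex_of_real t) *\<^sub>C dirichlet_sum f (s + complex_of_real t))
         has_integral - dirichlet_sum h s) {0..}))"

definition uniformly_PL_convex :: "real \<Rightarrow> 'a::complex_banach itself \<Rightarrow> bool"
  where "uniformly_PL_convex p _ \<longleftrightarrow> (\<exists>C>0. \<forall>x y::'a.
    (LINT \<xi>|circle_measure. norm (x + \<xi> *\<^sub>C y) powr p) \<ge> norm x powr p + C * norm y powr p)"

end

theory Submission
  imports Defs "HOL-Analysis.Weierstrass_Theorems" "HOL-Probability.Hoeffding"
    "HOL-Computational_Algebra.Squarefree" "Jordan_Normal_Form.Determinant"
begin

text \<open>
Suppose that \<open>g n \<noteq> 0\<close> for some \<open>n \<ge> 2\<close>. The Volterra operator is tested on Dirichlet polynomials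
\<open>f(s) = (\<Sum>q\<in>Q. x q * q powr -s)\<close>, where \<open>Q\<close> is a finite set of primes \<open>q > n\<close>.

The weak norm of \<open>f\<close> can be kept bounded although \<open>Q\<close> grows. On the torus, \<open>\<phi> \<circ> f\<close> is the sum
\<open>\<Sum>q\<in>Q. \<phi> (x q) * z\<^sub>q\<close> of independent uniformly distributed unimodular variables, and Khinchin's
inequality (\<open>Khinchin_upper\<close>) bounds its \<open>p\<close>-norm by a bound for the sum of \<open>\<bar>\<phi> (x q)\<bar>\<^sup>2\<close>.
The Dvoretzky-Rogers lemma (\<open>Dvoretzky_Rogers\<close>) provides, in every infinite-dimensional space
and for every size of \<open>Q\<close>, vectors \<open>x q\<close> of norm at least \<open>1/4\<close> for which these sums of squares
are at most \<open>2\<close> for all functionals in the unit ball.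

The image \<open>T\<^sub>g f\<close> is obtained by term by term integration (\<open>volterra_polynomial\<close>). As all primes
in \<open>Q\<close> exceed \<open>n\<close>, the number \<open>n * q\<close> arises in only one way as a product of a prime in \<open>Q\<close> and an integer, so that the
coefficient of \<open>T\<^sub>g f\<close> at \<open>n * q\<close> is \<open>g n * (ln n / ln (n * q))\<close> times \<open>x q\<close>.
PL-convexity turns these coefficients into a lower bound for the norm (\<open>Hp_torus_lower_bound\<close>):
convolution with a Riesz product, which is a probability density, contracts the norm and
reduces a function in the Hardy space to a polynomial of degree at most one in each of the chosen
variables; for such a polynomial the inequality that defines PL-convexity is applied to one
variable after the other. Boundedness of \<open>T\<^sub>g\<close> therefore gives a bound for
\<open>\<Sum>q\<in>Q. 1 / (ln (n * q)) powr p\<close> that is uniform in \<open>Q\<close>. There is no such bound, since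
\<open>(ln (n * q)) powr p\<close> is at most a multiple of \<open>q\<close> and the sum of the inverses of the primes
diverges (\<open>prime_log_sums_unbounded\<close>).

Two points come from the way the objects are defined. The norm of a Hardy space is
evaluated at an arbitrary preimage under the Bohr transform. The lower bound holds for every
preimage, but the upper bound needs that Fourier coefficients determine an integrable
function on the torus almost everywhere (\<open>fourier_null_AE_zero\<close>). The operator is defined by a description, so a series
with the required integral representation has to be shown to exist and to be unique
(\<open>Dirichlet_unique\<close>).
\<close>


section \<open>The strong integral\<close>

abbreviation step_integrable :: "'m measure \<Rightarrow> ('m \<Rightarrow> 'a::real_normed_vector) \<Rightarrow> bool"
  where "step_integrable \<equiv> Bochner_Integration.simple_bochner_integrable"

abbreviation step_integral :: "'m measure \<Rightarrow> ('m \<Rightarrow> 'a::real_normed_vector) \<Rightarrow> 'a"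
  where "step_integral \<equiv> Bochner_Integration.simple_bochner_integral"

text \<open>Bilinearity over the reals makes limits, linear maps and series commute with the complex multiplication.\<close>

lemma bounded_bilinear_scaleC: "bounded_bilinear (scaleC :: complex \<Rightarrow> 'a \<Rightarrow> 'a::complex_banach)"
proof
  show "(r *\<^sub>R c) *\<^sub>C x = r *\<^sub>R (c *\<^sub>C x)" for r c and x :: 'a
    by (simp add: scaleR_conv_of_real scaleC_scaleC[symmetric] scaleC_of_real)
  show "c *\<^sub>C (r *\<^sub>R x) = r *\<^sub>R (c *\<^sub>C x)" for r c and x :: 'a
    by (metis mult.commute scaleC_of_real scaleC_scaleC)
  show "\<exists>K. \<forall>c (x::'a). norm (c *\<^sub>C x) \<le> norm c * norm x * K"
    by (intro exI[of _ 1]) (simp add: norm_scaleC)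
qed (simp_all add: scaleC_add_left scaleC_add_right)

lemmas bounded_linear_scaleC_right = bounded_bilinear.bounded_linear_right[OF bounded_bilinear_scaleC]
lemmas bounded_linear_scaleC_left = bounded_bilinear.bounded_linear_left[OF bounded_bilinear_scaleC]
lemmas linear_scaleC_right = bounded_linear.linear[OF bounded_linear_scaleC_right]
lemmas linear_scaleC_left = bounded_linear.linear[OF bounded_linear_scaleC_left]
lemmas tendsto_scaleC = bounded_bilinear.tendsto[OF bounded_bilinear_scaleC]

lemma scaleC_one [simp]: "1 *\<^sub>C (x::'a::complex_banach) = x"
  using scaleC_of_real[of 1 x] by simp

lemma strongly_measurable_const: "strongly_measurable M (\<lambda>z. c)"
  unfolding strongly_measurable_def by (intro exI[of _ "\<lambda>i z. c"]) auto

lemma strongly_measurable_add: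
  assumes "strongly_measurable M F" "strongly_measurable M G"
  shows "strongly_measurable M (\<lambda>z. F z + G z)"
proof -
  obtain S where "\<And>i::nat. simple_function M (S i)" "\<forall>z\<in>space M. (\<lambda>i. S i z) \<longlonglongrightarrow> F z"
    using assms(1) unfolding strongly_measurable_def by metis
  moreover obtain T where "\<And>i::nat. simple_function M (T i)" "\<forall>z\<in>space M. (\<lambda>i. T i z) \<longlonglongrightarrow> G z"
    using assms(2) unfolding strongly_measurable_def by metis
  ultimately show ?thesis unfolding strongly_measurable_def
    by (intro exI[of _ "\<lambda>i z. S i z + T i z"])
       (auto intro!: tendsto_add simple_function_compose2[where h="(+)"])
qed

lemma strongly_measurable_complex_iff:
  fixes u :: "'m \<Rightarrow> complex"
  shows "strongly_measurable M u \<longleftrightarrow> u \<in> borel_measurable M"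
proof
  assume "strongly_measurable M u"
  then obtain S where S: "\<And>i::nat. simple_function M (S i)"
    "\<And>z. z \<in> space M \<Longrightarrow> (\<lambda>i. S i z) \<longlonglongrightarrow> u z"
    unfolding strongly_measurable_def by metis
  then show "u \<in> borel_measurable M"
    by (rule borel_measurable_LIMSEQ_metric[OF borel_measurable_simple_function])
next
  assume "u \<in> borel_measurable M"
  from borel_measurable_implies_sequence_metric[OF this, of 0]
  obtain S where "\<forall>i. simple_function M (S i)" "\<forall>z\<in>space M. (\<lambda>i. S i z) \<longlonglongrightarrow> u z"
    by blast
  then show "strongly_measurable M u" unfolding strongly_measurable_def by blast
qed

text \<open>In a nonseparable space sums and products of Borel functions need not be Borel. Closure under the
vector operations is read off from the approximating simple functions instead; only norms are
returned to the Borel setting.\<close>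

lemma strongly_measurable_scaleC:
  fixes F :: "'m \<Rightarrow> 'a::complex_banach"
  assumes "u \<in> borel_measurable M" "strongly_measurable M F"
  shows "strongly_measurable M (\<lambda>z. u z *\<^sub>C F z)"
proof -
  obtain S where "\<And>i::nat. simple_function M (S i)" "\<forall>z\<in>space M. (\<lambda>i. S i z) \<longlonglongrightarrow> u z"
    using assms(1) unfolding strongly_measurable_complex_iff[symmetric] strongly_measurable_def by metis
  moreover obtain T where "\<And>i::nat. simple_function M (T i)" "\<forall>z\<in>space M. (\<lambda>i. T i z) \<longlonglongrightarrow> F z"
    using assms(2) unfolding strongly_measurable_def by metis
  ultimately show ?thesis unfolding strongly_measurable_def
    by (intro exI[of _ "\<lambda>i z. S i z *\<^sub>C T i z"])
       (auto intro!: tendsto_scaleC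
          simple_function_compose2[where h="scaleC"])
qed

lemma strongly_measurable_norm:
  assumes "strongly_measurable M F"
  shows "(\<lambda>z. norm (F z)) \<in> borel_measurable M"
proof -
  obtain S where S: "\<And>i::nat. simple_function M (S i)"
    "\<And>z. z \<in> space M \<Longrightarrow> (\<lambda>i. S i z) \<longlonglongrightarrow> F z"
    using assms unfolding strongly_measurable_def by metis
  have "\<And>i. (\<lambda>z. norm (S i z)) \<in> borel_measurable M"
    by (intro borel_measurable_simple_function simple_function_compose1[OF S(1)])
  then show ?thesis
    by (rule borel_measurable_LIMSEQ_real[rotated]) (auto intro: tendsto_norm S)
qed

lemma strongly_measurable_simple: "simple_function M S \<Longrightarrow> strongly_measurable M S"
  unfolding strongly_measurable_def by (intro exI[of _ "\<lambda>i. S"]) auto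

lemma strongly_measurable_diff:
  assumes "strongly_measurable M F" "strongly_measurable M G"
  shows "strongly_measurable M (\<lambda>z. F z - (G z :: 'a::complex_banach))"
proof -
  have "strongly_measurable M (\<lambda>z. F z + (-1) *\<^sub>C G z)"
    by (intro strongly_measurable_add strongly_measurable_scaleC assms) auto
  moreover have "(-1) *\<^sub>C x = - x" for x :: 'a by (metis linear_neg[OF linear_scaleC_left] scaleC_one)
  ultimately show ?thesis by simp
qed

lemma strongly_measurable_cong:
  "(\<And>z. z \<in> space M \<Longrightarrow> F z = G z) \<Longrightarrow> strongly_measurable M F \<longleftrightarrow> strongly_measurable M G"
  unfolding strongly_measurable_def by simp

lemma has_strong_integral_cong:
  "(\<And>z. z \<in> space M \<Longrightarrow> F z = G z) \<Longrightarrow> has_strong_integral M F x \<longleftrightarrow> has_strong_integral M G x"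
  unfolding has_strong_integral_def
  by (simp cong: strongly_measurable_cong nn_integral_cong_simp)

lemma norm_simple_bochner_integral_le:
  fixes s :: "'m \<Rightarrow> 'a::complex_banach"
  assumes s: "step_integrable M s"
  shows "ennreal (norm (step_integral M s)) \<le> (\<integral>\<^sup>+z. norm (s z) \<partial>M)"
proof -
  have "norm (step_integral M s) \<le>
      step_integral M (\<lambda>x. norm (s x))"
    by (rule simple_bochner_integral_norm_bound[OF s])
  also have "ennreal \<dots> = (\<integral>\<^sup>+z. norm (s z) \<partial>M)"
    using simple_bochner_integrable_compose2[of "\<lambda>x y. norm x" M s s] s
    by (intro simple_bochner_integral_eq_nn_integral) auto
  finally show ?thesis by (simp add: ennreal_leI)
qed

lemma simple_bochner_integral_dist_le:
  fixes F :: "'m \<Rightarrow> 'a::complex_banach"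
  assumes F: "strongly_measurable M F"
    and s: "step_integrable M s"
    and t: "step_integrable M t"
  shows "ennreal (norm (step_integral M s - step_integral M t))
    \<le> (\<integral>\<^sup>+z. norm (F z - s z) \<partial>M) + (\<integral>\<^sup>+z. norm (F z - t z) \<partial>M)"
proof -
  have sm: "strongly_measurable M s" "strongly_measurable M t"
    using s t by (auto intro: strongly_measurable_simple elim: simple_bochner_integrable.cases)
  note [measurable] = strongly_measurable_norm[OF strongly_measurable_diff[OF F sm(1)]]
     strongly_measurable_norm[OF strongly_measurable_diff[OF F sm(2)]]
  have "ennreal (norm (step_integral M s - step_integral M t))
     \<le> (\<integral>\<^sup>+z. norm (s z - t z) \<partial>M)"
    using norm_simple_bochner_integral_le[of M "\<lambda>z. s z - t z"] s t
     simple_bochner_integrable_compose2[of "(-)" M s t]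
    by (subst simple_bochner_integral_diff[symmetric]) auto
  also have "\<dots> \<le> (\<integral>\<^sup>+z. ennreal (norm (F z - s z)) + ennreal (norm (F z - t z)) \<partial>M)"
  proof (rule nn_integral_mono)
    fix z
    have "norm (s z - t z) \<le> norm (F z - s z) + norm (F z - t z)"
      by (metis norm_diff_triangle_le norm_minus_commute order_refl)
    then show "ennreal (norm (s z - t z)) \<le> ennreal (norm (F z - s z)) + ennreal (norm (F z - t z))"
      by (metis ennreal_leI ennreal_plus norm_ge_zero)
  qed
  also have "\<dots> = (\<integral>\<^sup>+z. norm (F z - s z) \<partial>M) + (\<integral>\<^sup>+z. norm (F z - t z) \<partial>M)"
    by (rule nn_integral_add) auto
  finally show ?thesis .
qed

lemma tendsto_zero_of_ennreal_le:
  fixes f g :: "nat \<Rightarrow> ennreal"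
  assumes "\<And>i. f i \<le> g i" "g \<longlonglongrightarrow> 0"
  shows "f \<longlonglongrightarrow> 0"
  using tendsto_const assms(2) by (rule tendsto_sandwich[rotated 2]) (use assms(1) in auto)

lemma tendsto_zero_of_ennreal_norm_le:
  assumes "\<And>i. ennreal (norm (f i)) \<le> g i" "g \<longlonglongrightarrow> 0"
  shows "f \<longlonglongrightarrow> 0"
proof -
  have "(\<lambda>i. ennreal (norm (f i))) \<longlonglongrightarrow> ennreal 0"
    by (rule tendsto_sandwich[OF _ _ tendsto_const]) (use assms in auto)
  then have "(\<lambda>i. norm (f i)) \<longlonglongrightarrow> 0"
    by (subst (asm) tendsto_ennreal_iff) auto
  then show ?thesis by (rule tendsto_norm_zero_cancel)
qed

lemma has_strong_integralE:
  assumes "has_strong_integral M F x"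
  obtains S where "\<And>i::nat. step_integrable M (S i)"
    "(\<lambda>i. \<integral>\<^sup>+z. norm (F z - S i z) \<partial>M) \<longlonglongrightarrow> 0"
    "(\<lambda>i. step_integral M (S i)) \<longlonglongrightarrow> x"
  using assms unfolding has_strong_integral_def by blast

lemma has_strong_integral_unique:
  fixes x :: "'a::complex_banach"
  assumes "has_strong_integral M F x" "has_strong_integral M F y"
  shows "x = y"
proof -
  let ?I = "step_integral M"
  obtain S T where S: "\<And>i::nat. step_integrable M (S i)"
      "(\<lambda>i. \<integral>\<^sup>+z. norm (F z - S i z) \<partial>M) \<longlonglongrightarrow> 0" "(\<lambda>i. ?I (S i)) \<longlonglongrightarrow> x"
    using has_strong_integralE[OF assms(1)] by blast
  obtain T where T: "\<And>i::nat. step_integrable M (T i)"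
      "(\<lambda>i. \<integral>\<^sup>+z. norm (F z - T i z) \<partial>M) \<longlonglongrightarrow> 0" "(\<lambda>i. ?I (T i)) \<longlonglongrightarrow> y"
    using has_strong_integralE[OF assms(2)] by blast
  have F: "strongly_measurable M F"
    using assms unfolding has_strong_integral_def by blast+
  have "(\<lambda>i. ?I (S i) - ?I (T i)) \<longlonglongrightarrow> 0"
    by (rule tendsto_zero_of_ennreal_norm_le[OF simple_bochner_integral_dist_le[OF F S(1) T(1)]])
       (use tendsto_add[OF S(2) T(2)] in simp)
  with tendsto_diff[OF S(3) T(3)] have "x - y = 0"
    using LIMSEQ_unique by blast
  then show ?thesis by simp
qed

lemma strong_integral_eq:
  "has_strong_integral M F (x::'a::complex_banach) \<Longrightarrow> strong_integral M F = x"
  unfolding strong_integral_def using has_strong_integral_unique[of M F] by (metis the_equality)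

lemma has_strong_integral_norm_le:
  fixes x :: "'a::complex_banach"
  assumes "has_strong_integral M F x"
  shows "ennreal (norm x) \<le> (\<integral>\<^sup>+z. norm (F z) \<partial>M)"
proof -
  let ?I = "step_integral M"
  obtain S where S: "\<And>i::nat. step_integrable M (S i)"
      "(\<lambda>i. \<integral>\<^sup>+z. norm (F z - S i z) \<partial>M) \<longlonglongrightarrow> 0" "(\<lambda>i. ?I (S i)) \<longlonglongrightarrow> x"
    and F: "strongly_measurable M F"
    using assms unfolding has_strong_integral_def by metis
  have zero: "step_integrable M (\<lambda>z. 0::'a)"
    by (auto intro: simple_bochner_integrable.intros)
  have "?I (\<lambda>z. 0) = (0::'a)" unfolding simple_bochner_integral_def by (rule sum.neutral) auto
  then have "ennreal (norm (?I (S i))) \<le> (\<integral>\<^sup>+z. norm (F z - S i z) \<partial>M) + (\<integral>\<^sup>+z. norm (F z) \<partial>M)" for i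
    using simple_bochner_integral_dist_le[OF F S(1)[of i] zero] by simp
  moreover have "(\<lambda>i. (\<integral>\<^sup>+z. norm (F z - S i z) \<partial>M) + (\<integral>\<^sup>+z. norm (F z) \<partial>M)) \<longlonglongrightarrow> 0 + (\<integral>\<^sup>+z. norm (F z) \<partial>M)"
    by (intro tendsto_add S tendsto_const)
  moreover have "(\<lambda>i. ennreal (norm (?I (S i)))) \<longlonglongrightarrow> ennreal (norm x)"
    by (intro tendsto_ennrealI tendsto_norm S)
  ultimately show ?thesis using LIMSEQ_le[of "\<lambda>i. ennreal (norm (?I (S i)))"] by fastforce
qed

lemma has_strong_integral_add:
  fixes x y :: "'a::complex_banach"
  assumes "has_strong_integral M F x" "has_strong_integral M G y"
  shows "has_strong_integral M (\<lambda>z. F z + G z) (x + y)"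
proof -
  let ?I = "step_integral M"
  obtain S T where S: "\<And>i::nat. step_integrable M (S i)"
      "(\<lambda>i. \<integral>\<^sup>+z. norm (F z - S i z) \<partial>M) \<longlonglongrightarrow> 0" "(\<lambda>i. ?I (S i)) \<longlonglongrightarrow> x"
    using has_strong_integralE[OF assms(1)] by blast
  obtain T where T: "\<And>i::nat. step_integrable M (T i)"
      "(\<lambda>i. \<integral>\<^sup>+z. norm (G z - T i z) \<partial>M) \<longlonglongrightarrow> 0" "(\<lambda>i. ?I (T i)) \<longlonglongrightarrow> y"
    using has_strong_integralE[OF assms(2)] by blast
  have F: "strongly_measurable M F" "strongly_measurable M G"
    using assms unfolding has_strong_integral_def by blast+
  have sm: "strongly_measurable M (S i)" "strongly_measurable M (T i)" for i
    using S(1)[of i] T(1)[of i] by (auto intro: strongly_measurable_simple elim: simple_bochner_integrable.cases)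
  note [measurable] = strongly_measurable_norm[OF strongly_measurable_diff[OF F(1) sm(1)]]
     strongly_measurable_norm[OF strongly_measurable_diff[OF F(2) sm(2)]]
  have "(\<integral>\<^sup>+z. norm (F z + G z - (S i z + T i z)) \<partial>M)
      \<le> (\<integral>\<^sup>+z. norm (F z - S i z) \<partial>M) + (\<integral>\<^sup>+z. norm (G z - T i z) \<partial>M)" for i
  proof -
    have "(\<integral>\<^sup>+z. norm (F z + G z - (S i z + T i z)) \<partial>M)
      \<le> (\<integral>\<^sup>+z. ennreal (norm (F z - S i z)) + ennreal (norm (G z - T i z)) \<partial>M)"
    proof (rule nn_integral_mono)
      fix z
      have "norm (F z + G z - (S i z + T i z)) \<le> norm (F z - S i z) + norm (G z - T i z)"
        by (rule norm_diff_triangle_ineq)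
      then show "ennreal (norm (F z + G z - (S i z + T i z))) \<le> ennreal (norm (F z - S i z)) + ennreal (norm (G z - T i z))"
        by (metis ennreal_leI ennreal_plus norm_ge_zero)
    qed
    then show ?thesis by (subst (asm) nn_integral_add) auto
  qed
  moreover have "(\<lambda>i. (\<integral>\<^sup>+z. norm (F z - S i z) \<partial>M) + (\<integral>\<^sup>+z. norm (G z - T i z) \<partial>M)) \<longlonglongrightarrow> 0"
    using tendsto_add[OF S(2) T(2)] by simp
  ultimately have "(\<lambda>i. \<integral>\<^sup>+z. norm (F z + G z - (S i z + T i z)) \<partial>M) \<longlonglongrightarrow> 0"
    by (rule tendsto_zero_of_ennreal_le)
  moreover have "(\<lambda>i. ?I (\<lambda>z. S i z + T i z)) \<longlonglongrightarrow> x + y"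
    using tendsto_add[OF S(3) T(3)] by (simp add: simple_bochner_integral_add S T)
  moreover have "step_integrable M (\<lambda>z. S i z + T i z)" for i
    using simple_bochner_integrable_compose2[of "(+)" M "S i" "T i"] S T by auto
  ultimately show ?thesis
    unfolding has_strong_integral_def using strongly_measurable_add[OF F]
    by (intro conjI exI[of _ "\<lambda>i z. S i z + T i z"]) auto
qed

lemma has_strong_integral_scaleC:
  fixes x :: "'a::complex_banach"
  assumes "has_strong_integral M F x"
  shows "has_strong_integral M (\<lambda>z. c *\<^sub>C F z) (c *\<^sub>C x)"
proof -
  let ?I = "step_integral M"
  obtain S where S: "\<And>i::nat. step_integrable M (S i)"
      "(\<lambda>i. \<integral>\<^sup>+z. norm (F z - S i z) \<partial>M) \<longlonglongrightarrow> 0" "(\<lambda>i. ?I (S i)) \<longlonglongrightarrow> x"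
    and F: "strongly_measurable M F"
    using assms unfolding has_strong_integral_def by metis
  have sm: "strongly_measurable M (S i)" for i
    using S(1)[of i] by (auto intro: strongly_measurable_simple elim: simple_bochner_integrable.cases)
  note [measurable] = strongly_measurable_norm[OF strongly_measurable_diff[OF F(1) sm(1)]]
  have eq: "(\<integral>\<^sup>+z. norm (c *\<^sub>C F z - c *\<^sub>C S i z) \<partial>M) = ennreal (cmod c) * (\<integral>\<^sup>+z. norm (F z - S i z) \<partial>M)" for i
    by (simp add: linear_diff[OF linear_scaleC_right, symmetric] norm_scaleC ennreal_mult nn_integral_cmult)
  have "(\<lambda>i. ennreal (cmod c) * (\<integral>\<^sup>+z. norm (F z - S i z) \<partial>M)) \<longlonglongrightarrow> ennreal (cmod c) * 0"
    by (rule ennreal_tendsto_cmult[OF _ S(2)]) simp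
  then have "(\<lambda>i. \<integral>\<^sup>+z. norm (c *\<^sub>C F z - c *\<^sub>C S i z) \<partial>M) \<longlonglongrightarrow> 0"
    by (simp add: eq)
  moreover have "(\<lambda>i. ?I (\<lambda>z. c *\<^sub>C S i z)) \<longlonglongrightarrow> c *\<^sub>C x"
    using bounded_linear.tendsto[OF bounded_linear_scaleC_right S(3), of c]
    by (simp add: simple_bochner_integral_linear[OF linear_scaleC_right S(1)])
  moreover have "step_integrable M (\<lambda>z. c *\<^sub>C S i z)" for i
    using simple_bochner_integrable_compose2[of "\<lambda>x y. c *\<^sub>C x" M "S i" "S i"] S
    by (auto simp: linear_0[OF linear_scaleC_right])
  moreover have "strongly_measurable M (\<lambda>z. c *\<^sub>C F z)"
    using strongly_measurable_scaleC[of "\<lambda>_. c"] F by auto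
  ultimately show ?thesis
    unfolding has_strong_integral_def
    by (intro conjI exI[of _ "\<lambda>i z. c *\<^sub>C S i z"]) auto
qed

text \<open>Truncating the approximants where their norm exceeds twice the norm of \<open>F\<close> yields a majorant
\<open>3 * norm (F z)\<close> and does not disturb the limit; dominated convergence then makes the
integrals of the approximants a Cauchy sequence.\<close>

lemma has_strong_integral_exists:
  fixes F :: "'m \<Rightarrow> 'a::complex_banach"
  assumes F: "strongly_measurable M F" and int: "integrable M (\<lambda>z. norm (F z))"
  shows "\<exists>x. has_strong_integral M F x"
proof -
  let ?I = "step_integral M"
  obtain S where S: "\<And>i::nat. simple_function M (S i)"
    "\<And>z. z \<in> space M \<Longrightarrow> (\<lambda>i. S i z) \<longlonglongrightarrow> F z"
    using F unfolding strongly_measurable_def by metis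
  define T where "T i z = indicator {z\<in>space M. norm (S i z) \<le> 2 * norm (F z)} z *\<^sub>R S i z" for i z
  note Fm [measurable] = strongly_measurable_norm[OF F]
  have Sm [measurable]: "(\<lambda>z. norm (S i z)) \<in> borel_measurable M" for i
    by (intro borel_measurable_simple_function simple_function_compose1[OF S(1)])
  have simT: "simple_function M (T i)" for i
    unfolding T_def
    by (rule simple_function_compose2[where h=scaleR]) (auto intro!: simple_function_indicator S)
  have normT: "norm (T i z) \<le> 2 * norm (F z)" for i z
    by (auto simp: T_def indicator_def)
  have T: "(\<lambda>i. T i z) \<longlonglongrightarrow> F z" if z: "z \<in> space M" for z
  proof (cases "F z = 0")
    case True
    then have "T i z = 0" for i using normT[of i z] by simp
    with True show ?thesis by simp
  next
    case False
    have "eventually (\<lambda>i. norm (S i z) < 2 * norm (F z)) sequentially"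
      using tendsto_norm[OF S(2)[OF z]] False by (intro order_tendstoD) auto
    then have "eventually (\<lambda>i. S i z = T i z) sequentially"
      by eventually_elim (use z in \<open>auto simp: T_def\<close>)
    then show ?thesis using S(2)[OF z] by (rule Lim_transform_eventually[rotated])
  qed
  have fin: "(\<integral>\<^sup>+z. norm (F z) \<partial>M) < \<infinity>" using int by (simp add: integrable_iff_bounded)
  then have fin3: "(\<integral>\<^sup>+z. 3 * ennreal (norm (F z)) \<partial>M) < \<infinity>"
    by (subst nn_integral_cmult) (auto simp: ennreal_mult_less_top)
  have fin2: "(\<integral>\<^sup>+z. 2 * ennreal (norm (F z)) \<partial>M) < \<infinity>"
    using fin by (subst nn_integral_cmult) (auto simp: ennreal_mult_less_top)
  have Tint: "step_integrable M (T i)" for i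
  proof (rule simple_bochner_integrableI_bounded[OF simT])
    have "(\<integral>\<^sup>+z. norm (T i z) \<partial>M) \<le> (\<integral>\<^sup>+z. 2 * ennreal (norm (F z)) \<partial>M)"
      using normT[of i] by (intro nn_integral_mono) (auto simp: ennreal_mult'[symmetric] ennreal_leI simp flip: ennreal_numeral)
    then show "(\<integral>\<^sup>+z. norm (T i z) \<partial>M) < \<infinity>" using fin2 by (rule le_less_trans)
  qed
  have lim: "(\<lambda>i. \<integral>\<^sup>+z. norm (F z - T i z) \<partial>M) \<longlonglongrightarrow> (\<integral>\<^sup>+z. 0 \<partial>M)"
  proof (rule nn_integral_dominated_convergence[where w="\<lambda>z. 3 * ennreal (norm (F z))"])
    show "(\<lambda>z. ennreal (norm (F z - T i z))) \<in> borel_measurable M" for i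
      using strongly_measurable_norm[OF strongly_measurable_diff[OF F strongly_measurable_simple[OF simT]]] by auto
    show "AE z in M. ennreal (norm (F z - T i z)) \<le> 3 * ennreal (norm (F z))" for i
    proof (rule AE_I2)
      fix z
      have "norm (F z - T i z) \<le> 3 * norm (F z)"
        using norm_triangle_ineq4[of "F z" "T i z"] normT[of i z] by linarith
      then have "ennreal (norm (F z - T i z)) \<le> ennreal (3 * norm (F z))" by (rule ennreal_leI)
      then show "ennreal (norm (F z - T i z)) \<le> 3 * ennreal (norm (F z))"
        by (simp add: ennreal_mult)
    qed
    show "AE z in M. (\<lambda>i. ennreal (norm (F z - T i z))) \<longlonglongrightarrow> 0"
    proof (rule AE_I2)
      fix z assume "z \<in> space M"
      from tendsto_ennrealI[OF tendsto_norm[OF tendsto_diff[OF tendsto_const T[OF this], of "F z"]]]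
      show "(\<lambda>i. ennreal (norm (F z - T i z))) \<longlonglongrightarrow> 0" by simp
    qed
  qed (use fin3 in auto)
  then have lim0: "(\<lambda>i. \<integral>\<^sup>+z. norm (F z - T i z) \<partial>M) \<longlonglongrightarrow> 0" by simp
  have "Cauchy (\<lambda>i. ?I (T i))"
  proof (rule metric_CauchyI)
    fix e :: real assume e: "e > 0"
    have "eventually (\<lambda>i. (\<integral>\<^sup>+z. norm (F z - T i z) \<partial>M) < ennreal (e / 2)) sequentially"
      using lim0 e by (intro order_tendstoD) auto
    then obtain N where N: "\<And>i. i \<ge> N \<Longrightarrow> (\<integral>\<^sup>+z. norm (F z - T i z) \<partial>M) < ennreal (e / 2)"
      unfolding eventually_sequentially by auto
    have "dist (?I (T m)) (?I (T n)) < e" if "m \<ge> N" "n \<ge> N" for m n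
    proof -
      have "ennreal (norm (?I (T m) - ?I (T n))) \<le> (\<integral>\<^sup>+z. norm (F z - T m z) \<partial>M) + (\<integral>\<^sup>+z. norm (F z - T n z) \<partial>M)"
        by (rule simple_bochner_integral_dist_le[OF F Tint Tint])
      also have "\<dots> < ennreal (e / 2) + ennreal (e / 2)"
        using N that by (intro add_strict_mono) auto
      also have "\<dots> = ennreal e" using e by (simp flip: ennreal_plus)
      finally show ?thesis using e by (simp add: dist_norm ennreal_less_iff)
    qed
    then show "\<exists>N. \<forall>m\<ge>N. \<forall>n\<ge>N. dist (?I (T m)) (?I (T n)) < e" by blast
  qed
  then obtain x where "(\<lambda>i. ?I (T i)) \<longlonglongrightarrow> x" using Cauchy_convergent convergent_def by blast
  then show ?thesis unfolding has_strong_integral_def using F Tint lim0 by blast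
qed

lemma strong_integral_complex:
  fixes u :: "'m \<Rightarrow> complex"
  assumes "integrable M u"
  shows "strong_integral M u = (LINT z|M. u z)"
proof -
  have u: "u \<in> borel_measurable M" using assms by simp
  obtain x where x: "has_strong_integral M u x"
    using has_strong_integral_exists[of M u] assms by (auto simp: strongly_measurable_complex_iff)
  then have b: "has_bochner_integral M u x"
    unfolding has_strong_integral_def using u by (blast intro: has_bochner_integral.intros)
  show ?thesis using strong_integral_eq[OF x] has_bochner_integral_integral_eq[OF b] by simp
qed

section \<open>Integration on the circle and the torus\<close>

interpretation circle: prob_space circle_measure
  by (rule prob_space_circle_measure)

interpretation torus: product_prob_space "\<lambda>_::nat. circle_measure" UNIV
  by (intro product_prob_space.intro product_sigma_finite.intro product_prob_space_axioms.intro
      prob_space_imp_sigma_finite prob_space_circle_measure)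

lemma prob_space_torus_measure: "prob_space torus_measure"
  unfolding torus_measure_def by (rule prob_space_PiM) (rule prob_space_circle_measure)

interpretation torus_prob: prob_space torus_measure
  by (rule prob_space_torus_measure)

lemma sets_circle_measure [measurable_cong]: "sets circle_measure = sets (restrict_space borel (sphere 0 1))"
  by (simp add: circle_measure_def)

lemma measurable_id_circle [measurable]: "(\<lambda>z. z) \<in> borel_measurable circle_measure"
  by (subst measurable_cong_sets[OF sets_circle_measure refl]) (rule measurable_restrict_space1, simp)

lemma measurable_torus_component' [measurable]: "(\<lambda>z. z j) \<in> torus_measure \<rightarrow>\<^sub>M circle_measure"
  unfolding torus_measure_def by simp

lemma measurable_torus_component [measurable]: "(\<lambda>z. z j) \<in> borel_measurable torus_measure"
  using measurable_compose[OF measurable_torus_component' measurable_id_circle] by simp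

lemma space_torus_measure: "space torus_measure = {z. \<forall>j. cmod (z j) = 1}"
  by (auto simp: torus_measure_def space_PiM space_circle_measure PiE_def Pi_def extensional_def)

lemma cmod_torus: "z \<in> space torus_measure \<Longrightarrow> cmod (z j) = 1"
  by (simp add: space_torus_measure)

lemma torus_nonzero: "z \<in> space torus_measure \<Longrightarrow> z j \<noteq> 0"
  using cmod_torus[of z j] by auto

lemma inverse_torus: "z \<in> space torus_measure \<Longrightarrow> inverse (z j) = cnj (z j)"
  using complex_div_cnj[of 1 "z j"] by (simp add: cmod_torus inverse_eq_divide)

lemma measurable_cis_circle: "cis \<in> uniform_measure lborel {0..2 * pi} \<rightarrow>\<^sub>M restrict_space borel (sphere 0 1)"
proof (rule measurable_restrict_space2)
  have "cis \<in> borel_measurable borel"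
    by (intro borel_measurable_continuous_onI continuous_intros)
  then show "cis \<in> borel_measurable (uniform_measure lborel {0..2 * pi})"
    by (simp cong: measurable_cong_sets)
qed simp

lemma integral_circle_measure:
  fixes f :: "complex \<Rightarrow> 'b::{banach, second_countable_topology}"
  assumes [measurable]: "f \<in> borel_measurable borel"
  shows "(LINT z|circle_measure. f z) =
    (LINT t|lborel. indicator {0..2 * pi} t *\<^sub>R f (cis t)) /\<^sub>R (2 * pi)"
proof -
  have cis [measurable]: "cis \<in> borel_measurable borel"
    by (intro borel_measurable_continuous_onI continuous_intros)
  have f: "f \<in> borel_measurable (restrict_space borel (sphere 0 1))"
    by (rule measurable_restrict_space1) simp
  have e: "indicator {0..2 * pi} t / emeasure lborel {0..2 * pi} = ennreal (indicator {0..2*pi} t / (2 * pi))" for t :: real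
    by (cases "t \<in> {0..2 * pi}") (simp_all add: divide_ennreal ennreal_1[symmetric] del: ennreal_1)
  have u: "uniform_measure lborel {0..2 * pi} = density lborel (\<lambda>t. ennreal (indicator {0..2*pi} t / (2 * pi)))"
    unfolding uniform_measure_def e ..
  have "(LINT z|circle_measure. f z) = (LINT t|uniform_measure lborel {0..2 * pi}. f (cis t))"
    unfolding circle_measure_def by (rule integral_distr[OF measurable_cis_circle f])
  also have "\<dots> = (LINT t|lborel. (indicator {0..2*pi} t / (2 * pi)) *\<^sub>R f (cis t))"
    unfolding u by (rule integral_density) auto
  also have "\<dots> = (LINT t|lborel. (1 / (2 * pi)) *\<^sub>R (indicator {0..2 * pi} t *\<^sub>R f (cis t)))"
    by simp
  also have "\<dots> = (1 / (2 * pi)) *\<^sub>R (LINT t|lborel. indicator {0..2 * pi} t *\<^sub>R f (cis t))"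
    by (rule integral_scaleR_right) 
  finally show ?thesis by (simp only: inverse_eq_divide)
qed

lemma borel_measurable_powi [measurable]: 
  "f \<in> borel_measurable M \<Longrightarrow> (\<lambda>z. (f z :: complex) powi k) \<in> borel_measurable M"
  by (cases "k \<ge> 0") (auto simp: power_int_def)

lemma integral_circle_powi: "(LINT z|circle_measure. z powi k) = (if k = 0 then 1 else 0 :: complex)"
proof (cases "k = 0")
  case True
  then show ?thesis by (simp add: circle.prob_space)
next
  case False
  define F where "F t = cis (of_int k * t) / (\<i> * of_int k)" for t :: real
  have "(F has_vector_derivative cis (of_int k * t)) (at t within {0..2 * pi})" for t
    unfolding F_def has_vector_derivative_def
    apply (rule has_derivative_eq_rhs)
     apply (rule derivative_intros has_derivative_cis)+
    using False by (auto simp: fun_eq_iff scaleR_conv_of_real complex_eq_iff)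
  then have "(LINT t|lborel. indicator {0..2 * pi} t *\<^sub>R cis (of_int k * t)) = F (2 * pi) - F 0"
    by (intro integral_FTC_Icc) (auto intro!: continuous_intros)
  also have "cis (of_int k * (2 * pi)) = 1"
    using cis_multiple_2pi[of "of_int k"] by (simp add: mult.commute mult.left_commute)
  then have "F (2 * pi) - F 0 = 0" by (simp add: F_def)
  finally show ?thesis using False by (subst integral_circle_measure) (auto simp: cis_power_int)
qed

lemma integrable_circle_bounded:
  fixes f :: "complex \<Rightarrow> 'b::{banach, second_countable_topology}"
  assumes "f \<in> borel_measurable circle_measure" "\<And>z. cmod z = 1 \<Longrightarrow> norm (f z) \<le> B"
  shows "integrable circle_measure f"
  using assms by (intro circle.integrable_const_bound[of _ B] AE_I2) (auto simp: space_circle_measure)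

text \<open>Only finitely many coordinates occur, so the integral is carried over to the finite product by
restriction, where Fubini's theorem factors it.\<close>

lemma integral_torus_prod:
  fixes u :: "nat \<Rightarrow> complex \<Rightarrow> 'b::{real_normed_field, banach, second_countable_topology}"
  assumes J: "finite J" and u: "\<And>j. j \<in> J \<Longrightarrow> integrable circle_measure (u j)"
  shows "(LINT z|torus_measure. (\<Prod>j\<in>J. u j (z j))) = (\<Prod>j\<in>J. (LINT \<xi>|circle_measure. u j \<xi>))"
    and "integrable torus_measure (\<lambda>z. \<Prod>j\<in>J. u j (z j))"
proof -
  have r: "(\<lambda>z. restrict z J) \<in> torus_measure \<rightarrow>\<^sub>M PiM J (\<lambda>_. circle_measure)"
    unfolding torus_measure_def by (rule measurable_restrict_subset) simp
  have d: "distr torus_measure (PiM J (\<lambda>_. circle_measure)) (\<lambda>z. restrict z J) = PiM J (\<lambda>_. circle_measure)"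
    using torus.distr_PiM_restrict_finite[OF J] by (simp add: torus_measure_def)
  have um: "\<And>j. j \<in> J \<Longrightarrow> u j \<in> borel_measurable circle_measure" using u by auto
  have m: "(\<lambda>z. \<Prod>j\<in>J. u j (z j)) \<in> borel_measurable (PiM J (\<lambda>_. circle_measure))"
    by (rule borel_measurable_prod) (rule measurable_compose[OF measurable_component_singleton], simp, rule um)
  have e: "(\<Prod>j\<in>J. u j (restrict z J j)) = (\<Prod>j\<in>J. u j (z j))" for z
    by (rule prod.cong) auto
  have "(LINT z|torus_measure. (\<Prod>j\<in>J. u j (z j))) = (LINT z|distr torus_measure (PiM J (\<lambda>_. circle_measure)) (\<lambda>z. restrict z J). (\<Prod>j\<in>J. u j (z j)))"
    by (subst integral_distr[OF r m]) (simp only: e)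
  also have "\<dots> = (\<Prod>j\<in>J. (LINT \<xi>|circle_measure. u j \<xi>))"
    unfolding d by (rule torus.product_integral_prod[OF J u])
  finally show "(LINT z|torus_measure. (\<Prod>j\<in>J. u j (z j))) = (\<Prod>j\<in>J. (LINT \<xi>|circle_measure. u j \<xi>))" .
  have "integrable (distr torus_measure (PiM J (\<lambda>_. circle_measure)) (\<lambda>z. restrict z J)) (\<lambda>z. \<Prod>j\<in>J. u j (z j))"
    unfolding d by (rule torus.product_integrable_prod[OF J u])
  from integrable_distr[OF r this] show "integrable torus_measure (\<lambda>z. \<Prod>j\<in>J. u j (z j))"
    by (simp only: e)
qed

definition unit_index :: "nat \<Rightarrow> nat \<Rightarrow> int"
  where "unit_index j i = (if i = j then 1 else 0)"

lemma unit_index_ev_null [simp]: "unit_index j \<in> ev_null"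
  unfolding ev_null_def unit_index_def by auto

lemma ev_null_add [simp]: "\<mu> \<in> ev_null \<Longrightarrow> \<nu> \<in> ev_null \<Longrightarrow> (\<lambda>j. \<mu> j + \<nu> j) \<in> ev_null"
  unfolding ev_null_def by (auto intro: finite_subset[of _ "{j. \<mu> j \<noteq> 0} \<union> {j. \<nu> j \<noteq> 0}"])

lemma ev_null_uminus [simp]: "\<nu> \<in> ev_null \<Longrightarrow> (\<lambda>j. - \<nu> j) \<in> ev_null"
  unfolding ev_null_def by simp

lemma ev_null_diff [simp]: "\<mu> \<in> ev_null \<Longrightarrow> \<nu> \<in> ev_null \<Longrightarrow> (\<lambda>j. \<mu> j - \<nu> j) \<in> ev_null"
  using ev_null_add[OF _ ev_null_uminus] by simp

lemma ev_null_zero [simp]: "(\<lambda>j. 0) \<in> ev_null"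
  unfolding ev_null_def by simp

lemma monomial_eq_prod:
  assumes "finite A" "{j. \<nu> j \<noteq> 0} \<subseteq> A"
  shows "monomial z \<nu> = (\<Prod>j\<in>A. z j powi \<nu> j)"
  unfolding monomial_def using assms by (intro prod.mono_neutral_left) auto

lemma monomial_add:
  assumes "\<mu> \<in> ev_null" "\<nu> \<in> ev_null" "\<And>j. z j \<noteq> 0"
  shows "monomial z (\<lambda>j. \<mu> j + \<nu> j) = monomial z \<mu> * monomial z \<nu>"
proof -
  let ?A = "{j. \<mu> j \<noteq> 0} \<union> {j. \<nu> j \<noteq> 0}"
  have A: "finite ?A" using assms by (simp add: ev_null_def)
  have "monomial z (\<lambda>j. \<mu> j + \<nu> j) = (\<Prod>j\<in>?A. z j powi (\<mu> j + \<nu> j))"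
    by (rule monomial_eq_prod[OF A]) auto
  also have "\<dots> = (\<Prod>j\<in>?A. z j powi \<mu> j) * (\<Prod>j\<in>?A. z j powi \<nu> j)"
    by (simp add: power_int_add assms prod.distrib)
  also have "\<dots> = monomial z \<mu> * monomial z \<nu>"
    by (subst (1 2) monomial_eq_prod[OF A]) auto
  finally show ?thesis .
qed

lemma monomial_zero [simp]: "monomial z (\<lambda>j. 0) = 1"
  by (simp add: monomial_def)

lemma monomial_unit [simp]: "monomial z (unit_index j) = z j"
  by (subst monomial_eq_prod[of "{j}"]) (auto simp: unit_index_def)

lemma monomial_uminus: "monomial z (\<lambda>j. - \<nu> j) = inverse (monomial z \<nu>)"
  unfolding monomial_def by (simp add: power_int_minus prod_inversef[symmetric])

lemma monomial_measurable [measurable]: "(\<lambda>z. monomial z \<nu>) \<in> borel_measurable torus_measure"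
  unfolding monomial_def by measurable

lemma norm_monomial: "z \<in> space torus_measure \<Longrightarrow> cmod (monomial z \<nu>) = 1"
  unfolding monomial_def by (simp add: prod_norm[symmetric] norm_power_int cmod_torus)

lemma integral_monomial:
  assumes "\<nu> \<in> ev_null"
  shows "(LINT z|torus_measure. monomial z \<nu>) = (if \<nu> = (\<lambda>j. 0) then 1 else 0)"
proof -
  have fin: "finite {j. \<nu> j \<noteq> 0}" using assms by (simp add: ev_null_def)
  have int: "integrable circle_measure (\<lambda>z. z powi \<nu> j)" for j
    by (rule integrable_circle_bounded[of _ 1]) (auto simp: norm_power_int)
  have "(LINT z|torus_measure. monomial z \<nu>) = (\<Prod>j | \<nu> j \<noteq> 0. (LINT z|circle_measure. z powi \<nu> j))"
    unfolding monomial_def by (rule integral_torus_prod(1)[OF fin int])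
  also have "\<dots> = (\<Prod>j | \<nu> j \<noteq> 0. 0)" by (intro prod.cong) (auto simp: integral_circle_powi)
  also have "\<dots> = (if \<nu> = (\<lambda>j. 0) then 1 else 0)"
    using fin by (auto simp: fun_eq_iff prod_constant card_eq_0_iff power_0_left)
  finally show ?thesis .
qed

lemma integrable_torus_bounded:
  fixes f :: "_ \<Rightarrow> 'b::{banach, second_countable_topology}"
  assumes "f \<in> borel_measurable torus_measure" "\<And>z. z \<in> space torus_measure \<Longrightarrow> norm (f z) \<le> B"
  shows "integrable torus_measure f"
  using assms by (intro torus_prob.integrable_const_bound[of _ B] AE_I2) auto

lemma integrable_torus_mult_bounded:
  fixes H u :: "_ \<Rightarrow> complex"
  assumes "integrable torus_measure H" "u \<in> borel_measurable torus_measure" "\<And>z. z \<in> space torus_measure \<Longrightarrow> cmod (u z) \<le> B"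
  shows "integrable torus_measure (\<lambda>z. H z * u z)"
proof (rule Bochner_Integration.integrable_bound[of _ "\<lambda>z. B *\<^sub>R H z"])
  show "AE z in torus_measure. norm (H z * u z) \<le> norm (B *\<^sub>R H z)"
  proof (rule AE_I2)
    fix z assume z: "z \<in> space torus_measure"
    have "cmod (H z) * cmod (u z) \<le> cmod (H z) * \<bar>B\<bar>"
      using assms(3)[OF z] by (intro mult_left_mono) auto
    then show "norm (H z * u z) \<le> norm (B *\<^sub>R H z)" by (simp add: norm_mult mult.commute)
  qed
qed (use assms in auto)

section \<open>Uniqueness of Fourier coefficients\<close>

text \<open>The uniqueness theorem is reached by enlarging the class of functions by which one may multiply
without destroying the vanishing of all Fourier coefficients. This class is closed under products
by its very form and under bounded pointwise limits by dominated convergence. It contains the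
monomials, and from there it grows to the indicators of all measurable sets.\<close>

definition fourier_null :: "((nat \<Rightarrow> complex) \<Rightarrow> complex) \<Rightarrow> bool"
  where "fourier_null H \<longleftrightarrow> integrable torus_measure H \<and>
    (\<forall>\<nu>\<in>ev_null. (LINT z|torus_measure. H z * monomial z \<nu>) = 0)"

definition null_multiplier :: "((nat \<Rightarrow> complex) \<Rightarrow> complex) \<Rightarrow> bool"
  where "null_multiplier u \<longleftrightarrow> u \<in> borel_measurable torus_measure \<and>
    (\<forall>H. fourier_null H \<longrightarrow> fourier_null (\<lambda>z. H z * u z))"

lemma null_multiplier_cong:
  assumes "null_multiplier u" "\<And>z. z \<in> space torus_measure \<Longrightarrow> u z = v z"
  shows "null_multiplier v"
proof -
  have "v \<in> borel_measurable torus_measure"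
    using assms measurable_cong[of torus_measure u v borel] by (auto simp: null_multiplier_def)
  moreover have "fourier_null (\<lambda>z. H z * v z)" if "fourier_null H" for H
  proof -
    have 1: "fourier_null (\<lambda>z. H z * u z)" using assms that by (simp add: null_multiplier_def)
    have "integrable torus_measure (\<lambda>z. H z * v z) = integrable torus_measure (\<lambda>z. H z * u z)"
      by (intro Bochner_Integration.integrable_cong) (auto simp: assms)
    moreover have "(LINT z|torus_measure. H z * v z * monomial z \<nu>) = (LINT z|torus_measure. H z * u z * monomial z \<nu>)" for \<nu>
      by (intro Bochner_Integration.integral_cong) (auto simp: assms)
    ultimately show ?thesis using 1 by (simp add: fourier_null_def)
  qed
  ultimately show ?thesis by (simp add: null_multiplier_def)
qed

lemma fourier_null_mult_const: "fourier_null H \<Longrightarrow> fourier_null (\<lambda>z. H z * c)"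
  using integral_mult_right_zero[of torus_measure c]
  by (auto simp: fourier_null_def mult.assoc mult.left_commute[of _ c])

lemma fourier_null_add: 
  assumes "fourier_null H" "fourier_null K"
  shows "fourier_null (\<lambda>z. H z + K z)"
proof -
  have "integrable torus_measure (\<lambda>z. H z * monomial z \<nu>)" "integrable torus_measure (\<lambda>z. K z * monomial z \<nu>)" for \<nu>
    using assms by (auto simp: fourier_null_def norm_monomial intro!: integrable_torus_mult_bounded[of _ _ 1])
  then show ?thesis using assms by (auto simp: fourier_null_def ring_distribs)
qed

lemma null_multiplier_const: "null_multiplier (\<lambda>z. c)"
  by (simp add: null_multiplier_def fourier_null_mult_const)

lemma null_multiplier_mult:
  assumes "null_multiplier u" "null_multiplier v" shows "null_multiplier (\<lambda>z. u z * v z)"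
  using assms by (auto simp: null_multiplier_def mult.assoc[symmetric])

lemma null_multiplier_add:
  assumes "null_multiplier u" "null_multiplier v" shows "null_multiplier (\<lambda>z. u z + v z)"
  using assms unfolding null_multiplier_def
  by (simp add: ring_distribs borel_measurable_add fourier_null_add)

lemma null_multiplier_monomial:
  assumes "\<mu> \<in> ev_null" shows "null_multiplier (\<lambda>z. monomial z \<mu>)"
proof -
  have "fourier_null (\<lambda>z. H z * monomial z \<mu>)" if H: "fourier_null H" for H
  proof -
    have "(LINT z|torus_measure. H z * monomial z \<mu> * monomial z \<nu>) = 0" if \<nu>: "\<nu> \<in> ev_null" for \<nu>
    proof -
      have "(LINT z|torus_measure. H z * monomial z \<mu> * monomial z \<nu>) = (LINT z|torus_measure. H z * monomial z (\<lambda>j. \<mu> j + \<nu> j))"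
        by (intro Bochner_Integration.integral_cong) (auto simp: monomial_add[OF assms \<nu>] torus_nonzero)
      then show ?thesis using H assms \<nu> by (simp add: fourier_null_def)
    qed
    moreover have "integrable torus_measure (\<lambda>z. H z * monomial z \<mu>)"
      using H by (auto simp: fourier_null_def norm_monomial intro!: integrable_torus_mult_bounded[of _ _ 1])
    ultimately show ?thesis by (simp add: fourier_null_def)
  qed
  then show ?thesis by (simp add: null_multiplier_def)
qed

lemma null_multiplier_limit:
  assumes u: "\<And>n::nat. null_multiplier (u n)"
    and B: "\<And>n z. z \<in> space torus_measure \<Longrightarrow> cmod (u n z) \<le> B"
    and lim: "\<And>z. z \<in> space torus_measure \<Longrightarrow> (\<lambda>n. u n z) \<longlonglongrightarrow> v z"
  shows "null_multiplier v"
proof -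
  have um [measurable]: "u n \<in> borel_measurable torus_measure" for n using u by (simp add: null_multiplier_def)
  have vm [measurable]: "v \<in> borel_measurable torus_measure"
    by (rule borel_measurable_LIMSEQ_metric[OF um lim])
  have Bv: "cmod (v z) \<le> B" if "z \<in> space torus_measure" for z
    by (rule LIMSEQ_le_const2[OF tendsto_norm[OF lim[OF that]]]) (use B[OF that] in blast)
  have "fourier_null (\<lambda>z. H z * v z)" if H: "fourier_null H" for H
  proof -
    have int: "integrable torus_measure H" using H by (simp add: fourier_null_def)
    have [measurable]: "H \<in> borel_measurable torus_measure" using int by simp
    have "(LINT z|torus_measure. H z * v z * monomial z \<nu>) = 0" if \<nu>: "\<nu> \<in> ev_null" for \<nu>
    proof -
      have "(\<lambda>n. LINT z|torus_measure. H z * u n z * monomial z \<nu>) \<longlonglongrightarrow> (LINT z|torus_measure. H z * v z * monomial z \<nu>)"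
      proof (rule integral_dominated_convergence[where w="\<lambda>z. cmod (H z) * \<bar>B\<bar>"])
        show "AE z in torus_measure. (\<lambda>n. H z * u n z * monomial z \<nu>) \<longlonglongrightarrow> H z * v z * monomial z \<nu>"
          by (intro AE_I2 tendsto_mult tendsto_const lim)
        show "AE z in torus_measure. norm (H z * u n z * monomial z \<nu>) \<le> cmod (H z) * \<bar>B\<bar>" for n
        proof (rule AE_I2)
          fix z assume z: "z \<in> space torus_measure"
          show "norm (H z * u n z * monomial z \<nu>) \<le> cmod (H z) * \<bar>B\<bar>"
            using B[OF z, of n] by (auto simp: norm_mult norm_monomial[OF z] intro!: mult_left_mono)
        qed
        show "integrable torus_measure (\<lambda>z. cmod (H z) * \<bar>B\<bar>)" using int by auto
      qed auto
      moreover have "(LINT z|torus_measure. H z * u n z * monomial z \<nu>) = 0" for n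
        using u[of n] H \<nu> by (simp add: null_multiplier_def fourier_null_def)
      ultimately show ?thesis by (simp add: LIMSEQ_const_iff)
    qed
    moreover have "integrable torus_measure (\<lambda>z. H z * v z)"
      by (rule integrable_torus_mult_bounded[OF int vm Bv])
    ultimately show ?thesis by (simp add: fourier_null_def)
  qed
  then show ?thesis by (simp add: null_multiplier_def)
qed

lemma null_multiplier_Re: "null_multiplier (\<lambda>z. of_real (Re (z j)))"
proof -
  have "null_multiplier (\<lambda>z. monomial z (unit_index j) * (1/2) + monomial z (\<lambda>i. - unit_index j i) * (1/2))"
    by (intro null_multiplier_add null_multiplier_mult null_multiplier_monomial null_multiplier_const) auto
  then show ?thesis
  proof (rule null_multiplier_cong)
    fix z assume "z \<in> space torus_measure"
    then have "inverse (z j) = cnj (z j)" by (rule inverse_torus)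
    then show "monomial z (unit_index j) * (1/2) + monomial z (\<lambda>i. - unit_index j i) * (1/2) = of_real (Re (z j))"
      by (simp add: monomial_uminus complex_eq_iff)
  qed
qed

lemma null_multiplier_Im: "null_multiplier (\<lambda>z. of_real (Im (z j)))"
proof -
  have "null_multiplier (\<lambda>z. monomial z (unit_index j) * (-\<i>/2) + monomial z (\<lambda>i. - unit_index j i) * (\<i>/2))"
    by (intro null_multiplier_add null_multiplier_mult null_multiplier_monomial null_multiplier_const) auto
  then show ?thesis
  proof (rule null_multiplier_cong)
    fix z assume "z \<in> space torus_measure"
    then have "inverse (z j) = cnj (z j)" by (rule inverse_torus)
    then show "monomial z (unit_index j) * (-\<i>/2) + monomial z (\<lambda>i. - unit_index j i) * (\<i>/2) = of_real (Im (z j))"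
      by (simp add: monomial_uminus complex_eq_iff)
  qed
qed

text \<open>On the circle the real and imaginary part are combinations of \<open>z\<close> and its inverse, so
polynomials in them are trigonometric polynomials. This lets the Stone-Weierstrass theorem for
real polynomials serve as a theorem on trigonometric approximation.\<close>

lemma null_multiplier_polynomial:
  assumes "real_polynomial_function (g :: complex \<Rightarrow> real)"
  shows "null_multiplier (\<lambda>z. of_real (g (z j)))"
  using assms
proof induction
  case (linear f)
  then interpret bounded_linear f .
  have "f w = Re w * f 1 + Im w * f \<i>" for w
  proof -
    have "w = Re w *\<^sub>R 1 + Im w *\<^sub>R \<i>" by (simp add: complex_eq_iff)
    then have "f w = f (Re w *\<^sub>R 1 + Im w *\<^sub>R \<i>)" by simp
    then show ?thesis by (simp only: add scaleR real_scaleR_def)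
  qed
  then have f: "of_real (Re (z j)) * of_real (f 1) + of_real (Im (z j)) * of_real (f \<i>) = complex_of_real (f (z j))"
    for z :: "nat \<Rightarrow> complex"
    by (metis of_real_add of_real_mult)
  have "null_multiplier (\<lambda>z. of_real (Re (z j)) * of_real (f 1) + of_real (Im (z j)) * of_real (f \<i>))"
    by (intro null_multiplier_add null_multiplier_mult null_multiplier_Re null_multiplier_Im null_multiplier_const)
  then show ?case by (rule null_multiplier_cong) (rule f)
qed (auto intro: null_multiplier_const null_multiplier_add null_multiplier_mult)

lemma null_multiplier_continuous:
  assumes cont: "continuous_on (sphere 0 1) (f :: complex \<Rightarrow> real)"
  shows "null_multiplier (\<lambda>z. of_real (f (z j)))"
proof -
  have "\<exists>g. real_polynomial_function g \<and> (\<forall>x\<in>sphere 0 1. \<bar>f x - g x\<bar> < 1 / real (Suc n))" for n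
    using Stone_Weierstrass_real_polynomial_function[of "sphere 0 1" f "1 / real (Suc n)"] cont
    by (metis compact_sphere of_nat_0_less_iff zero_less_Suc zero_less_divide_1_iff)
  then obtain g where g: "\<And>n. real_polynomial_function (g n)"
      "\<And>n x. x \<in> sphere 0 1 \<Longrightarrow> \<bar>f x - g n x\<bar> < 1 / real (Suc n)"
    by metis
  obtain B where B: "\<And>x. x \<in> sphere 0 1 \<Longrightarrow> \<bar>f x\<bar> \<le> B"
    using compact_imp_bounded[OF compact_continuous_image[OF cont compact_sphere]]
    by (fastforce simp: bounded_iff)
  show ?thesis
  proof (rule null_multiplier_limit[of "\<lambda>n z. of_real (g n (z j))" "B + 1"])
    show "null_multiplier (\<lambda>z. of_real (g n (z j)))" for n by (rule null_multiplier_polynomial[OF g(1)])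
    fix z :: "nat \<Rightarrow> complex" assume "z \<in> space torus_measure"
    then have z: "z j \<in> sphere 0 1" by (simp add: cmod_torus)
    show "cmod (of_real (g n (z j))) \<le> B + 1" for n
    proof -
      have "1 / real (Suc n) \<le> 1" by simp
      then have "\<bar>g n (z j)\<bar> \<le> B + 1" using g(2)[OF z, of n] B[OF z] by linarith
      then show ?thesis by simp
    qed
    have "(\<lambda>n. f (z j) - g n (z j)) \<longlonglongrightarrow> 0"
    proof (rule Lim_null_comparison)
      show "eventually (\<lambda>n. norm (f (z j) - g n (z j)) \<le> 1 / real (Suc n)) sequentially"
        using g(2)[OF z] by (auto intro: less_imp_le always_eventually)
      show "(\<lambda>n. 1 / real (Suc n)) \<longlonglongrightarrow> 0" by (rule LIMSEQ_Suc[OF lim_1_over_n])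
    qed
    then have "(\<lambda>n. f (z j) - (f (z j) - g n (z j))) \<longlonglongrightarrow> f (z j) - 0" by (intro tendsto_diff tendsto_const)
    then show "(\<lambda>n. of_real (g n (z j))) \<longlonglongrightarrow> (of_real (f (z j)) :: complex)"
      by (intro tendsto_of_real) simp
  qed
qed

text \<open>The indicator of a closed set is the bounded pointwise limit of the continuous functions
\<open>max 0 (1 - n * infdist z A)\<close>.\<close>

lemma null_multiplier_indicator_closed:
  assumes "closed A"
  shows "null_multiplier (\<lambda>z. indicator A (z j))"
proof (cases "A = {}")
  case True
  then show ?thesis using null_multiplier_const[of 0] by simp
next
  case False
  show ?thesis
  proof (rule null_multiplier_limit[of "\<lambda>n z. of_real (max 0 (1 - real n * infdist (z j) A))" 1])
    show "null_multiplier (\<lambda>z. of_real (max 0 (1 - real n * infdist (z j) A)))" for n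
      by (rule null_multiplier_continuous) (intro continuous_intros)
    fix z :: "nat \<Rightarrow> complex"
    show "cmod (of_real (max 0 (1 - real n * infdist (z j) A))) \<le> 1" for n
    proof -
      have "0 \<le> real n * infdist (z j) A" by (simp add: infdist_nonneg)
      then have "\<bar>max 0 (1 - real n * infdist (z j) A)\<bar> \<le> 1" by linarith
      then show ?thesis by (simp only: norm_of_real)
    qed
    show "(\<lambda>n. of_real (max 0 (1 - real n * infdist (z j) A))) \<longlonglongrightarrow> (indicator A (z j) :: complex)"
    proof (cases "z j \<in> A")
      case True
      then show ?thesis by simp
    next
      case F: False
      then have d: "infdist (z j) A > 0"
        using in_closed_iff_infdist_zero[OF assms False, of "z j"] F infdist_nonneg[of "z j" A] by linarith
      obtain N :: nat where N: "1 < real N * infdist (z j) A"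
        using reals_Archimedean3[OF d] by blast
      have "max 0 (1 - real n * infdist (z j) A) = 0" if "n \<ge> N" for n
      proof -
        have "real N * infdist (z j) A \<le> real n * infdist (z j) A"
          using that d by (intro mult_right_mono) auto
        then show ?thesis using N by simp
      qed
      then have "eventually (\<lambda>n. complex_of_real (max 0 (1 - real n * infdist (z j) A)) = 0) sequentially"
        unfolding eventually_sequentially by (intro exI[of _ N]) simp
      moreover have "(indicator A (z j) :: complex) = 0" using F by simp
      ultimately show ?thesis by (simp only: tendsto_eventually)
    qed
  qed
qed

text \<open>Products of multipliers correspond to intersections of sets, and limits to countable unions; so
the sets whose indicators are multipliers already form a sigma-algebra. The map \<open>h\<close>
covers both a single coordinate and the identity of the torus.\<close>

lemma null_multiplier_sigma_sets:
  assumes "A \<in> sigma_sets \<Omega> G"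
    and G: "\<And>a. a \<in> G \<Longrightarrow> null_multiplier (\<lambda>z. indicator a (h z))"
    and h: "\<And>z. z \<in> space torus_measure \<Longrightarrow> h z \<in> \<Omega>"
  shows "null_multiplier (\<lambda>z. indicator A (h z))"
  using assms(1)
proof induction
  case (Basic a)
  then show ?case by (rule G)
next
  case Empty
  then show ?case using null_multiplier_const[of 0] by simp
next
  case (Compl a)
  have "null_multiplier (\<lambda>z. 1 + (-1) * indicator a (h z))"
    by (intro null_multiplier_add null_multiplier_mult null_multiplier_const Compl)
  then show ?case by (rule null_multiplier_cong) (use h in \<open>auto split: split_indicator\<close>)
next
  case (Union a)
  have fin: "null_multiplier (\<lambda>z. \<Prod>i<n. (1 + (-1) * indicator (a i) (h z)))" for n :: nat
  proof (induction n)
    case 0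
    then show ?case using null_multiplier_const[of 1] by simp
  next
    case (Suc n)
    have "null_multiplier (\<lambda>z. (\<Prod>i<n. (1 + (-1) * indicator (a i) (h z))) * (1 + (-1) * indicator (a n) (h z)))"
      by (intro null_multiplier_mult[OF Suc] null_multiplier_add null_multiplier_mult null_multiplier_const Union)
    then show ?case by (simp only: prod.lessThan_Suc)
  qed
  have val: "(\<Prod>i<n. (1 + (-1) * indicator (a i) w)) = (if \<exists>i<n. w \<in> a i then 0 else 1 :: complex)" for w n
    by (induction n) (auto simp: less_Suc_eq)
  show ?case
  proof (rule null_multiplier_limit[of "\<lambda>n z. 1 + (-1) * (\<Prod>i<n. (1 + (-1) * indicator (a i) (h z)))" 1])
    show "null_multiplier (\<lambda>z. 1 + (-1) * (\<Prod>i<n. (1 + (-1) * indicator (a i) (h z))))" for n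
      by (intro null_multiplier_add null_multiplier_mult null_multiplier_const fin)
    fix z
    show "cmod (1 + (-1) * (\<Prod>i<n. (1 + (-1) * indicator (a i) (h z)))) \<le> 1" for n
      unfolding val by simp
    show "(\<lambda>n. 1 + (-1) * (\<Prod>i<n. (1 + (-1) * indicator (a i) (h z)))) \<longlonglongrightarrow> (indicator (\<Union>i. a i) (h z) :: complex)"
    proof (cases "\<exists>i. h z \<in> a i")
      case True
      then obtain i where i: "h z \<in> a i" by blast
      have "eventually (\<lambda>n. 1 + (-1) * (\<Prod>i<n. (1 + (-1) * indicator (a i) (h z))) = (1::complex)) sequentially"
        unfolding val eventually_sequentially by (rule exI[of _ "Suc i"]) (use i in auto)
      then show ?thesis using True by (subst indicator_simps) (auto intro: tendsto_eventually)
    next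
      case False
      then show ?thesis unfolding val by simp
    qed
  qed
qed

lemma null_multiplier_indicator:
  assumes A: "A \<in> sets torus_measure"
  shows "null_multiplier (indicator A)"
proof -
  let ?G = "{{f \<in> \<Pi>\<^sub>E i\<in>(UNIV::nat set). space circle_measure. f i \<in> B} | i B. i \<in> UNIV \<and> B \<in> sets circle_measure}"
  have "A \<in> sigma_sets (\<Pi>\<^sub>E i\<in>UNIV. space circle_measure) ?G"
    using A by (simp add: torus_measure_def sets_PiM_single)
  then have "null_multiplier (\<lambda>z::nat \<Rightarrow> complex. indicator A (id z))"
  proof (rule null_multiplier_sigma_sets)
    fix a assume "a \<in> ?G"
    then obtain j :: nat and B where a: "a = {f \<in> \<Pi>\<^sub>E i\<in>UNIV. space circle_measure. f j \<in> B}" and B: "B \<in> sets circle_measure"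
      by auto
    have "B \<in> sets (restrict_space borel (sphere 0 1))" using B sets_circle_measure by blast
    then obtain B' where B': "B' \<in> sets (borel :: complex measure)" "B = sphere 0 1 \<inter> B'"
      by (auto simp: sets_restrict_space)
    \<comment> \<open>first enlarge from closed to Borel subsets of one coordinate, then from these cylinders to the whole sigma-algebra\<close>
    have "B' \<in> sigma_sets UNIV {S. closed S}" using B'(1) unfolding borel_eq_closed by simp
    then have "null_multiplier (\<lambda>z. indicator B' (z j))"
      by (rule null_multiplier_sigma_sets) (auto intro: null_multiplier_indicator_closed)
    then show "null_multiplier (\<lambda>z. indicator a (id z))"
      by (rule null_multiplier_cong)
         (auto simp: a B' space_torus_measure space_circle_measure PiE_def split: split_indicator)
  qed (auto simp: torus_measure_def space_PiM)
  then show ?thesis by simp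
qed

text \<open>The coefficient with index zero of \<open>H\<close> times an indicator is the integral of \<open>H\<close>
over the corresponding set; these integrals determine \<open>H\<close> almost everywhere.\<close>

lemma fourier_null_AE_zero:
  assumes "fourier_null H"
  shows "AE z in torus_measure. H z = 0"
proof (rule torus_prob.density_zero)
  show "integrable torus_measure H" using assms by (simp add: fourier_null_def)
  fix A assume "A \<in> sets torus_measure"
  then have "fourier_null (\<lambda>z. H z * indicator A z)"
    using null_multiplier_indicator assms by (simp add: null_multiplier_def)
  then have "(LINT z|torus_measure. H z * indicator A z * monomial z (\<lambda>j. 0)) = 0"
    unfolding fourier_null_def using ev_null_zero by blast
  moreover have "indicator A z *\<^sub>R H z = H z * indicator A z" for z by (auto split: split_indicator)
  ultimately show "set_lebesgue_integral torus_measure A H = 0"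
    by (simp add: set_lebesgue_integral_def)
qed

section \<open>Prime exponents\<close>

abbreviation nth_prime :: "nat \<Rightarrow> nat"
  where "nth_prime j \<equiv> enumerate {p::nat. prime p} j"

lemma prime_nth_prime: "prime (nth_prime j)"
  using enumerate_in_set[OF primes_infinite, of j] by simp

lemma inj_nth_prime: "inj nth_prime"
proof (rule linorder_injI)
  fix i j :: nat assume "i < j"
  then show "nth_prime i \<noteq> nth_prime j" using enumerate_mono[OF _ primes_infinite, of i j] by simp
qed

lemma nth_prime_surj: "prime p \<Longrightarrow> \<exists>j. nth_prime j = p"
  using enumerate_Ex[OF primes_infinite, of p] by simp

lemma prime_exponents_mult:
  assumes "n > 0" "m > 0"
  shows "prime_exponents (n * m) = (\<lambda>j. prime_exponents n j + prime_exponents m j)"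
  using assms prime_nth_prime
  by (auto simp: prime_exponents_def fun_eq_iff prime_elem_multiplicity_mult_distrib prime_imp_prime_elem)

lemma prime_exponents_nth_prime: "prime_exponents (nth_prime j) = unit_index j"
proof
  fix i
  show "prime_exponents (nth_prime j) i = unit_index j i"
  proof (cases "i = j")
    case True
    then show ?thesis using prime_nth_prime[of j]
      by (simp add: prime_exponents_def unit_index_def multiplicity_self prime_gt_0_nat not_prime_unit)
  next
    case False
    then have "nth_prime i \<noteq> nth_prime j" using inj_nth_prime by (auto dest: injD)
    then have "\<not> nth_prime i dvd nth_prime j" using prime_nth_prime primes_dvd_imp_eq by blast
    then show ?thesis using False by (simp add: prime_exponents_def unit_index_def not_dvd_imp_multiplicity_0)
  qed
qed

lemma prime_exponents_ev_null_nonneg: 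
  assumes "n > 0" shows "prime_exponents n \<in> ev_null_nonneg"
proof -
  have "{j. prime_exponents n j \<noteq> 0} \<subseteq> nth_prime -` {..n}"
  proof
    fix j assume "j \<in> {j. prime_exponents n j \<noteq> 0}"
    then have "nth_prime j dvd n" using not_dvd_imp_multiplicity_0[of "nth_prime j" n] by (auto simp: prime_exponents_def)
    then show "j \<in> nth_prime -` {..n}" using assms by (auto dest: dvd_imp_le)
  qed
  then have "finite {j. prime_exponents n j \<noteq> 0}"
    by (rule finite_subset) (rule finite_vimageI[OF finite_atMost inj_nth_prime])
  then show ?thesis by (simp add: ev_null_nonneg_def ev_null_def prime_exponents_def)
qed

lemma prime_exponents_ev_null: "n > 0 \<Longrightarrow> prime_exponents n \<in> ev_null"
  using prime_exponents_ev_null_nonneg by (simp add: ev_null_nonneg_def)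

lemma prime_exponents_inj:
  assumes "n > 0" "m > 0" "prime_exponents n = prime_exponents m"
  shows "n = m"
proof (rule multiplicity_eq_nat[OF assms(1,2)])
  fix p :: nat assume "prime p"
  then obtain j where "nth_prime j = p" using nth_prime_surj by blast
  then show "multiplicity p n = multiplicity p m"
    using fun_cong[OF assms(3), of j] by (simp add: prime_exponents_def)
qed

text \<open>Unique factorisation identifies the positive integers with the nonnegative eventually null
sequences; hence a Dirichlet series contains all Fourier coefficients that are not forced to vanish.\<close>

lemma prime_exponents_surj:
  assumes "\<nu> \<in> ev_null_nonneg"
  shows "\<exists>n>0. prime_exponents n = \<nu>"
proof -
  let ?S = "{j. \<nu> j \<noteq> 0}"
  have fin: "finite ?S" and nn: "\<And>j. \<nu> j \<ge> 0" using assms by (auto simp: ev_null_nonneg_def ev_null_def)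
  define f where "f p = nat (\<nu> (inv_into UNIV nth_prime p))" for p
  let ?n = "\<Prod>p\<in>nth_prime ` ?S. p ^ f p"
  have "prime_exponents ?n j = \<nu> j" for j
  proof -
    have "multiplicity (nth_prime j) ?n = (if nth_prime j \<in> nth_prime ` ?S then f (nth_prime j) else 0)"
      by (rule multiplicity_prod_prime_powers) (use fin prime_nth_prime in auto)
    also have "\<dots> = nat (\<nu> j)" using inj_nth_prime by (auto simp: f_def inj_image_mem_iff)
    finally show ?thesis using nn[of j] by (simp add: prime_exponents_def)
  qed
  moreover have "?n > 0" by (intro prod_pos) (auto simp: prime_gt_0_nat prime_nth_prime)
  ultimately show ?thesis by blast
qed

section \<open>The Bohr transform of linear polynomials\<close>

lemma fourier_coeff_complex:
  fixes F :: "(nat \<Rightarrow> complex) \<Rightarrow> complex"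
  assumes "integrable torus_measure F"
  shows "fourier_coeff F \<nu> = (LINT z|torus_measure. F z * monomial z (\<lambda>j. - \<nu> j))"
    and "integrable torus_measure (\<lambda>z. F z * monomial z (\<lambda>j. - \<nu> j))"
proof -
  show i: "integrable torus_measure (\<lambda>z. F z * monomial z (\<lambda>j. - \<nu> j))"
    by (rule integrable_torus_mult_bounded[OF assms monomial_measurable, of _ 1]) (simp add: norm_monomial)
  then show "fourier_coeff F \<nu> = (LINT z|torus_measure. F z * monomial z (\<lambda>j. - \<nu> j))"
    unfolding fourier_coeff_def scaleC_complex_def
    by (subst strong_integral_complex) (simp_all add: mult.commute)
qed

text \<open>The torus has finite measure and \<open>t \<le> 1 + t powr p\<close>.\<close>

lemma Hp_torus_integrable_norm:
  fixes F :: "(nat \<Rightarrow> complex) \<Rightarrow> 'a::complex_banach"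
  assumes "F \<in> Hp_torus p" "1 \<le> p"
  shows "integrable torus_measure (\<lambda>z. norm (F z))"
proof (rule Bochner_Integration.integrable_bound[of _ "\<lambda>z. 1 + norm (F z) powr p"])
  have F: "strongly_measurable torus_measure F" "integrable torus_measure (\<lambda>z. norm (F z) powr p)"
    using assms by (auto simp: Hp_torus_def Lp_space_def)
  then show "(\<lambda>z. norm (F z)) \<in> borel_measurable torus_measure"
    "integrable torus_measure (\<lambda>z. 1 + norm (F z) powr p)"
    by (auto intro: strongly_measurable_norm)
  show "AE z in torus_measure. norm (norm (F z)) \<le> norm (1 + norm (F z) powr p)"
  proof (rule AE_I2)
    fix z
    have "norm (F z) \<le> 1 + norm (F z) powr p"
    proof (cases "norm (F z) \<le> 1")
      case False
      then have "norm (F z) powr 1 \<le> norm (F z) powr p" using assms(2) by (intro powr_mono) auto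
      then show ?thesis using False by simp
    qed (simp add: add_increasing2)
    then show "norm (norm (F z)) \<le> norm (1 + norm (F z) powr p)" by simp
  qed
qed

lemma Hp_torus_complex_integrable:
  fixes F :: "(nat \<Rightarrow> complex) \<Rightarrow> complex"
  assumes "F \<in> Hp_torus p" "1 \<le> p"
  shows "integrable torus_measure F"
proof -
  have "F \<in> borel_measurable torus_measure"
    using assms(1) by (simp add: Hp_torus_def Lp_space_def strongly_measurable_complex_iff)
  then show ?thesis using Hp_torus_integrable_norm[OF assms] by (rule integrable_norm_cancel[rotated])
qed

text \<open>The Dirichlet coefficients are the Fourier coefficients at nonnegative indices, and the others
vanish on both sides.\<close>

lemma bohr_eq_imp_AE_eq:
  fixes F G :: "(nat \<Rightarrow> complex) \<Rightarrow> complex"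
  assumes F: "F \<in> Hp_torus p" and G: "G \<in> Hp_torus p" and p: "1 \<le> p" and eq: "bohr F = bohr G"
  shows "AE z in torus_measure. F z = G z"
proof -
  have int: "integrable torus_measure F" "integrable torus_measure G"
    using Hp_torus_complex_integrable F G p by auto
  have coeff: "fourier_coeff F \<nu> = fourier_coeff G \<nu>" if \<nu>: "\<nu> \<in> ev_null" for \<nu>
  proof (cases "\<nu> \<in> ev_null_nonneg")
    case True
    then obtain n where "n > 0" "prime_exponents n = \<nu>" using prime_exponents_surj by blast
    then show ?thesis using fun_cong[OF eq, of n] by (simp add: bohr_def)
  next
    case False
    then show ?thesis using F G \<nu> by (simp add: Hp_torus_def)
  qed
  have "fourier_null (\<lambda>z. F z - G z)"
    unfolding fourier_null_def
  proof (intro conjI ballI)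
    show "integrable torus_measure (\<lambda>z. F z - G z)" using int by auto
    fix \<nu> :: "nat \<Rightarrow> int" assume "\<nu> \<in> ev_null"
    then have "fourier_coeff F (\<lambda>j. - \<nu> j) = fourier_coeff G (\<lambda>j. - \<nu> j)" by (intro coeff) simp
    then show "(LINT z|torus_measure. (F z - G z) * monomial z \<nu>) = 0"
      using fourier_coeff_complex[OF int(1), of "\<lambda>j. - \<nu> j"] fourier_coeff_complex[OF int(2), of "\<lambda>j. - \<nu> j"]
      by (simp add: left_diff_distrib)
  qed
  from fourier_null_AE_zero[OF this] show ?thesis by simp
qed

lemma Lp_norm_bohr_eq:
  fixes F G :: "(nat \<Rightarrow> complex) \<Rightarrow> complex"
  assumes F: "F \<in> Hp_torus p" and G: "G \<in> Hp_torus p" and p: "1 \<le> p" and eq: "bohr F = bohr G"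
  shows "Lp_norm p torus_measure F = Lp_norm p torus_measure G"
proof -
  have m: "F \<in> borel_measurable torus_measure" "G \<in> borel_measurable torus_measure"
    using Hp_torus_complex_integrable[OF F p] Hp_torus_complex_integrable[OF G p] by auto
  have "(LINT z|torus_measure. norm (F z) powr p) = (LINT z|torus_measure. norm (G z) powr p)"
    by (rule integral_cong_AE) (use m bohr_eq_imp_AE_eq[OF assms] in auto)
  then show ?thesis by (simp add: Lp_norm_def)
qed

definition linear_poly :: "nat set \<Rightarrow> (nat \<Rightarrow> complex) \<Rightarrow> (nat \<Rightarrow> complex) \<Rightarrow> complex"
  where "linear_poly J a z = (\<Sum>j\<in>J. a j * z j)"

lemma linear_poly_measurable [measurable]: "linear_poly J a \<in> borel_measurable torus_measure"
  unfolding linear_poly_def[abs_def] by measurable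

lemma norm_linear_poly_le: "z \<in> space torus_measure \<Longrightarrow> cmod (linear_poly J a z) \<le> (\<Sum>j\<in>J. cmod (a j))"
  unfolding linear_poly_def using norm_sum[of "\<lambda>j. a j * z j" J] by (simp add: norm_mult cmod_torus)

lemma fourier_coeff_linear_poly:
  assumes "finite J" "\<nu> \<in> ev_null"
  shows "fourier_coeff (linear_poly J a) \<nu> = (\<Sum>j\<in>J. if \<nu> = unit_index j then a j else 0)"
proof -
  have "fourier_coeff (linear_poly J a) \<nu> = (LINT z|torus_measure. linear_poly J a z * monomial z (\<lambda>j. - \<nu> j))"
    by (rule fourier_coeff_complex(1), rule integrable_torus_bounded[OF _ norm_linear_poly_le]) auto
  also have "\<dots> = (LINT z|torus_measure. (\<Sum>j\<in>J. a j * monomial z (\<lambda>i. unit_index j i - \<nu> i)))"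
  proof (rule Bochner_Integration.integral_cong[OF refl])
    fix z assume z: "z \<in> space torus_measure"
    have "monomial z (\<lambda>i. unit_index j i - \<nu> i) = z j * monomial z (\<lambda>i. - \<nu> i)" for j
      using monomial_add[of "unit_index j" "\<lambda>i. - \<nu> i" z] assms(2) torus_nonzero[OF z] by simp
    then show "linear_poly J a z * monomial z (\<lambda>j. - \<nu> j) = (\<Sum>j\<in>J. a j * monomial z (\<lambda>i. unit_index j i - \<nu> i))"
      by (simp add: linear_poly_def sum_distrib_right mult.assoc)
  qed
  also have "\<dots> = (\<Sum>j\<in>J. LINT z|torus_measure. a j * monomial z (\<lambda>i. unit_index j i - \<nu> i))"
    by (rule Bochner_Integration.integral_sum)
       (auto intro!: integrable_mult_right integrable_torus_bounded[of _ 1] simp: norm_monomial)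
  also have "\<dots> = (\<Sum>j\<in>J. if \<nu> = unit_index j then a j else 0)"
    using assms(2) by (intro sum.cong) (auto simp: integral_monomial fun_eq_iff)
  finally show ?thesis .
qed

lemma linear_poly_Hp:
  assumes J: "finite J" and p: "0 \<le> p"
  shows "linear_poly J a \<in> Hp_torus p"
proof -
  have "integrable torus_measure (\<lambda>z. norm (linear_poly J a z) powr p)"
    by (rule integrable_torus_bounded[of _ "(\<Sum>j\<in>J. cmod (a j)) powr p"])
       (auto intro!: powr_mono2 norm_linear_poly_le p)
  moreover have "fourier_coeff (linear_poly J a) \<nu> = 0" if \<nu>: "\<nu> \<in> ev_null - ev_null_nonneg" for \<nu>
  proof -
    have "unit_index j i \<ge> 0" for i j by (simp add: unit_index_def)
    then have "\<nu> \<noteq> unit_index j" for j using \<nu> by (auto simp: ev_null_nonneg_def)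
    then show ?thesis using \<nu> fourier_coeff_linear_poly[OF J, of \<nu> a] by simp
  qed
  ultimately show ?thesis
    by (simp add: Hp_torus_def Lp_space_def strongly_measurable_complex_iff)
qed

lemma bohr_linear_poly:
  assumes J: "finite J"
  shows "bohr (linear_poly J a) n = (\<Sum>j\<in>J. if n = nth_prime j then a j else 0)"
proof (cases "n = 0")
  case True
  have "n \<noteq> nth_prime j" for j using prime_gt_0_nat[OF prime_nth_prime, of j] True by simp
  then have "(\<Sum>j\<in>J. if n = nth_prime j then a j else 0) = 0" by (intro sum.neutral) auto
  then show ?thesis using True by (simp add: bohr_def)
next
  case False
  then have n: "n > 0" by simp
  have "(prime_exponents n = unit_index j) = (n = nth_prime j)" for j
    using prime_exponents_inj[OF n prime_gt_0_nat[OF prime_nth_prime], of j] by (auto simp: prime_exponents_nth_prime)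
  then show ?thesis using n fourier_coeff_linear_poly[OF J prime_exponents_ev_null[OF n], of a]
    by (simp add: bohr_def)
qed

text \<open>The norm is taken at an unspecified preimage under the Bohr transform; since that transform
determines a scalar function almost everywhere, the linear polynomial itself may be used.\<close>

lemma hardy_norm_linear_poly:
  assumes J: "finite J" and p: "1 \<le> p"
  shows "bohr (linear_poly J a) \<in> hardy p"
    and "hardy_norm p (bohr (linear_poly J a)) = Lp_norm p torus_measure (linear_poly J a)"
proof -
  have H: "linear_poly J a \<in> Hp_torus p" using linear_poly_Hp[OF J] p by simp
  then show "bohr (linear_poly J a) \<in> hardy p" unfolding hardy_def by blast
  have im: "bohr (linear_poly J a) \<in> bohr ` (Hp_torus p :: ((nat \<Rightarrow> complex) \<Rightarrow> complex) set)" using H by blast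
  show "hardy_norm p (bohr (linear_poly J a)) = Lp_norm p torus_measure (linear_poly J a)"
    unfolding hardy_norm_def
    by (rule Lp_norm_bohr_eq[OF inv_into_into[OF im] H p f_inv_into_f[OF im]])
qed

section \<open>Khinchin's inequality for Steinhaus variables\<close>

lemma powr_le_exp:
  fixes x p :: real
  assumes "0 \<le> x" "0 < p"
  shows "x powr p \<le> p powr p * exp x"
proof (cases "x = 0")
  case False
  then have x: "x > 0" using assms by simp
  have "x / p \<le> exp (x / p)" using exp_ge_add_one_self[of "x / p"] by linarith
  then have "(x / p) powr p \<le> exp (x / p) powr p" using x assms by (intro powr_mono2) auto
  also have "\<dots> = exp x" using assms by (simp add: exp_powr_real)
  finally show ?thesis using x assms by (simp add: powr_divide field_simps)
qed (use assms in simp)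

text \<open>\<open>Re (c * z)\<close> has mean zero and lies between \<open>- cmod c\<close> and \<open>cmod c\<close>, which is the situation of
Hoeffding's lemma.\<close>

lemma circle_exp_moment:
  "(LINT z|circle_measure. exp (Re (c * z))) \<le> exp ((cmod c)\<^sup>2 / 2)"
  "integrable circle_measure (\<lambda>z. exp (Re (c * z)))"
proof -
  show i: "integrable circle_measure (\<lambda>z. exp (Re (c * z)))"
  proof (rule integrable_circle_bounded[of _ "exp (cmod c)"])
    fix z :: complex assume "cmod z = 1"
    then have "Re (c * z) \<le> cmod c" using complex_Re_le_cmod[of "c * z"] by (simp add: norm_mult)
    then show "norm (exp (Re (c * z))) \<le> exp (cmod c)" by simp
  qed measurable
  interpret interval_bounded_random_variable circle_measure "\<lambda>z. Re (c * z)" "- cmod c" "cmod c"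
  proof
    show "(\<lambda>z. Re (c * z)) \<in> borel_measurable circle_measure" by measurable
    show "AE z in circle_measure. Re (c * z) \<in> {- cmod c..cmod c}"
    proof (rule AE_I2)
      fix z assume "z \<in> space circle_measure"
      then show "Re (c * z) \<in> {- cmod c..cmod c}"
        using abs_Re_le_cmod[of "c * z"] by (simp add: space_circle_measure norm_mult abs_le_iff del: times_complex.sel)
    qed
  qed
  have iz: "integrable circle_measure (\<lambda>z. z)" by (rule integrable_circle_bounded[of _ 1]) auto
  have "(LINT z|circle_measure. z) = (0::complex)" using integral_circle_powi[of 1] by simp
  then have "(LINT z|circle_measure. c * z) = 0" by simp
  then have "circle.expectation (\<lambda>z. Re (c * z)) = 0"
    using integral_Re[of circle_measure "\<lambda>z. c * z"] iz by (auto simp del: times_complex.sel)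
  moreover have "(0 :: real) < 1" by simp
  ultimately have "(\<integral>\<^sup>+z. ennreal (exp (1 * Re (c * z))) \<partial>circle_measure) \<le> ennreal (exp (1\<^sup>2 * (cmod c - - cmod c)\<^sup>2 / 8))"
    by (rule Hoeffdings_lemma_nn_integral_0[rotated])
  then
  have "(\<integral>\<^sup>+z. ennreal (exp (Re (c * z))) \<partial>circle_measure) \<le> ennreal (exp ((cmod c)\<^sup>2 / 2))"
    by (simp add: power2_eq_square field_simps del: times_complex.sel)
  then have "ennreal (LINT z|circle_measure. exp (Re (c * z))) \<le> ennreal (exp ((cmod c)\<^sup>2 / 2))"
    using nn_integral_eq_integral[OF i] by simp
  then show "(LINT z|circle_measure. exp (Re (c * z))) \<le> exp ((cmod c)\<^sup>2 / 2)"
    by (simp add: ennreal_le_iff)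
qed

lemma linear_poly_exp_moment:
  assumes J: "finite J"
  shows "(LINT z|torus_measure. exp (Re (b * linear_poly J a z))) \<le> exp ((cmod b)\<^sup>2 * (\<Sum>j\<in>J. (cmod (a j))\<^sup>2) / 2)"
    and "integrable torus_measure (\<lambda>z. exp (Re (b * linear_poly J a z)))"
proof -
  have e: "exp (Re (b * linear_poly J a z)) = (\<Prod>j\<in>J. exp (Re (b * a j * z j)))" for z
  proof -
    have "Re (b * linear_poly J a z) = (\<Sum>j\<in>J. Re (b * a j * z j))"
      unfolding linear_poly_def sum_distrib_left Re_sum by (simp only: mult.assoc)
    then show ?thesis using J by (simp only: exp_sum)
  qed
  show "integrable torus_measure (\<lambda>z. exp (Re (b * linear_poly J a z)))"
    unfolding e by (rule integral_torus_prod(2)[OF J circle_exp_moment(2)])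
  have "(LINT z|torus_measure. exp (Re (b * linear_poly J a z))) = (\<Prod>j\<in>J. (LINT z|circle_measure. exp (Re (b * a j * z))))"
    unfolding e by (rule integral_torus_prod(1)[OF J circle_exp_moment(2)])
  also have "\<dots> \<le> (\<Prod>j\<in>J. exp ((cmod (b * a j))\<^sup>2 / 2))"
    by (rule prod_mono) (auto intro!: integral_nonneg_AE circle_exp_moment(1) simp del: times_complex.sel)
  also have "\<dots> = exp (\<Sum>j\<in>J. (cmod (b * a j))\<^sup>2 / 2)" using J by (simp only: exp_sum)
  also have "(\<Sum>j\<in>J. (cmod (b * a j))\<^sup>2 / 2) = (cmod b)\<^sup>2 * (\<Sum>j\<in>J. (cmod (a j))\<^sup>2) / 2"
    by (simp add: norm_mult power_mult_distrib sum_divide_distrib sum_distrib_left)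
  finally show "(LINT z|torus_measure. exp (Re (b * linear_poly J a z))) \<le> exp ((cmod b)\<^sup>2 * (\<Sum>j\<in>J. (cmod (a j))\<^sup>2) / 2)" .
qed

text \<open>The right-hand side consists of exponentials of real parts of multiples of \<open>w\<close>, which
factor over independent coordinates when \<open>w\<close> is a linear form, whereas \<open>exp (cmod w)\<close> does not.\<close>

lemma exp_cmod_le:
  "exp (cmod w) \<le> exp (Re (2 * w)) + exp (Re ((-2) * w)) + exp (Re ((2 * \<i>) * w)) + exp (Re ((-2 * \<i>) * w))"
proof -
  have "exp \<bar>2 * x\<bar> \<le> exp (2 * x) + exp (- (2 * x))" for x :: real
    by (cases "x \<ge> 0") auto
  note ab = this[of "Re w"] this[of "Im w"]
  have "cmod w \<le> max \<bar>2 * Re w\<bar> \<bar>2 * Im w\<bar>" using cmod_le[of w] by (simp add: max_def abs_mult) 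
  then have "exp (cmod w) \<le> exp (max \<bar>2 * Re w\<bar> \<bar>2 * Im w\<bar>)" by simp
  also have "\<dots> \<le> exp \<bar>2 * Re w\<bar> + exp \<bar>2 * Im w\<bar>" by (simp add: max_def)
  finally show ?thesis using ab by simp
qed

text \<open>Powers are dominated by the exponential, and exponential moments of a sum of independent variables
are products. The constant matters only in that it does not depend on \<open>J\<close>.\<close>

theorem Khinchin_upper:
  assumes J: "finite J" and a: "(\<Sum>j\<in>J. (cmod (a j))\<^sup>2) \<le> 2" and p: "0 < p"
  shows "(LINT z|torus_measure. norm (linear_poly J a z) powr p) \<le> p powr p * (4 * exp 4)"
proof -
  let ?L = "linear_poly J a"
  have m: "(LINT z|torus_measure. exp (Re (b * ?L z))) \<le> exp 4" if "b \<in> {2, -2, 2 * \<i>, -2 * \<i>}" for b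
  proof -
    have "(cmod b)\<^sup>2 = 4" using that by (auto simp: norm_mult)
    then have "(cmod b)\<^sup>2 * (\<Sum>j\<in>J. (cmod (a j))\<^sup>2) / 2 \<le> 4" using a by simp
    then have "exp ((cmod b)\<^sup>2 * (\<Sum>j\<in>J. (cmod (a j))\<^sup>2) / 2) \<le> exp 4" by (simp only: exp_le_cancel_iff)
    then show ?thesis using linear_poly_exp_moment(1)[OF J, of b a] by (rule order_trans[rotated])
  qed
  note i = linear_poly_exp_moment(2)[OF J, of _ a]
  have "(LINT z|torus_measure. norm (?L z) powr p) \<le> (LINT z|torus_measure. p powr p *
      (exp (Re (2 * ?L z)) + exp (Re ((-2) * ?L z)) + exp (Re ((2 * \<i>) * ?L z)) + exp (Re ((-2 * \<i>) * ?L z))))"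
  proof (rule integral_mono)
    show "integrable torus_measure (\<lambda>z. norm (?L z) powr p)"
      using linear_poly_Hp[OF J, of p a] p by (simp add: Hp_torus_def Lp_space_def)
    show "integrable torus_measure (\<lambda>z. p powr p *
      (exp (Re (2 * ?L z)) + exp (Re ((-2) * ?L z)) + exp (Re ((2 * \<i>) * ?L z)) + exp (Re ((-2 * \<i>) * ?L z))))"
      by (intro integrable_mult_right Bochner_Integration.integrable_add i)
    fix z
    have "norm (?L z) powr p \<le> p powr p * exp (norm (?L z))" by (rule powr_le_exp) (use p in auto)
    also have "\<dots> \<le> p powr p * (exp (Re (2 * ?L z)) + exp (Re ((-2) * ?L z)) + exp (Re ((2 * \<i>) * ?L z)) + exp (Re ((-2 * \<i>) * ?L z)))"
      by (rule mult_left_mono[OF exp_cmod_le]) simp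
    finally show "norm (?L z) powr p \<le> p powr p * (exp (Re (2 * ?L z)) + exp (Re ((-2) * ?L z)) + exp (Re ((2 * \<i>) * ?L z)) + exp (Re ((-2 * \<i>) * ?L z)))" .
  qed
  also have "\<dots> = p powr p * ((LINT z|torus_measure. exp (Re (2 * ?L z))) + (LINT z|torus_measure. exp (Re ((-2) * ?L z)))
      + (LINT z|torus_measure. exp (Re ((2 * \<i>) * ?L z))) + (LINT z|torus_measure. exp (Re ((-2 * \<i>) * ?L z))))"
    by (simp only: integral_mult_right_zero Bochner_Integration.integral_add Bochner_Integration.integrable_add i)
  also have "\<dots> \<le> p powr p * (4 * exp 4)"
    using m[of 2] m[of "-2"] m[of "2 * \<i>"] m[of "-2 * \<i>"] by (intro mult_left_mono) auto
  finally show ?thesis .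
qed

section \<open>Riesz products and PL-convexity\<close>

text \<open>For distinct indices, \<open>riesz_poly c js \<mu>\<close> is the polynomial of degree at most one in each variable \<open>w j\<close> with \<open>j\<close> in \<open>js\<close> whose
coefficient at the product of the \<open>w j\<close> over a subset \<open>S\<close> is \<open>c\<close> at \<open>\<mu>\<close> plus the
indicator of \<open>S\<close>, divided by \<open>2 ^ card S\<close>. The recursion splits off one
variable, which is the form that all inductions below need.\<close>

fun riesz_poly :: "((nat \<Rightarrow> int) \<Rightarrow> 'a::complex_banach) \<Rightarrow> nat list \<Rightarrow> (nat \<Rightarrow> int) \<Rightarrow> (nat \<Rightarrow> complex) \<Rightarrow> 'a"
  where
    "riesz_poly c [] \<mu> w = c \<mu>"
  | "riesz_poly c (j # js) \<mu> w =
      riesz_poly c js \<mu> w + (w j / 2) *\<^sub>C riesz_poly c js (\<lambda>i. \<mu> i + unit_index j i) w"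

text \<open>The Riesz product. Its Fourier coefficients are supported on exponents in \<open>{-1, 0, 1}\<close>,
with value \<open>1/2\<close> for each nonzero entry.\<close>

definition riesz_kernel :: "nat set \<Rightarrow> (nat \<Rightarrow> complex) \<Rightarrow> (nat \<Rightarrow> complex) \<Rightarrow> real"
  where "riesz_kernel J w z = (\<Prod>j\<in>J. 1 + Re (w j * cnj (z j)))"

lemma riesz_poly_cong: "(\<And>j. j \<in> set js \<Longrightarrow> v j = w j) \<Longrightarrow> riesz_poly c js \<mu> v = riesz_poly c js \<mu> w"
  by (induction js arbitrary: \<mu>) auto

text \<open>Adding unit vectors at positions different from \<open>i\<close> cannot repair a negative entry at \<open>i\<close>.\<close>

lemma riesz_poly_eq_zero:
  assumes "\<And>\<nu>. \<nu> \<in> ev_null \<Longrightarrow> \<nu> i < 0 \<Longrightarrow> c \<nu> = 0" "i \<notin> set js" "\<mu> \<in> ev_null" "\<mu> i < 0"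
  shows "riesz_poly c js \<mu> w = 0"
  using assms(2,3,4)
proof (induction js arbitrary: \<mu>)
  case (Cons j js)
  have "unit_index j i = 0" using Cons.prems by (simp add: unit_index_def)
  then show ?case using Cons by (simp add: linear_0[OF linear_scaleC_right])
qed (simp add: assms(1))

lemma fourier_coeff_has_integral:
  fixes F :: "(nat \<Rightarrow> complex) \<Rightarrow> 'a::complex_banach"
  assumes F: "strongly_measurable torus_measure F" and int: "integrable torus_measure (\<lambda>z. norm (F z))"
  shows "has_strong_integral torus_measure (\<lambda>z. monomial z (\<lambda>j. - \<nu> j) *\<^sub>C F z) (fourier_coeff F \<nu>)"
proof -
  have sm: "strongly_measurable torus_measure (\<lambda>z. monomial z (\<lambda>j. - \<nu> j) *\<^sub>C F z)"
    by (rule strongly_measurable_scaleC[OF monomial_measurable F])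
  have "integrable torus_measure (\<lambda>z. norm (monomial z (\<lambda>j. - \<nu> j) *\<^sub>C F z)) = integrable torus_measure (\<lambda>z. norm (F z))"
    by (rule Bochner_Integration.integrable_cong) (simp_all add: norm_scaleC norm_monomial)
  then obtain x where "has_strong_integral torus_measure (\<lambda>z. monomial z (\<lambda>j. - \<nu> j) *\<^sub>C F z) x"
    using has_strong_integral_exists[OF sm] int by auto
  then show ?thesis unfolding fourier_coeff_def using strong_integral_eq by metis
qed

text \<open>Convolution with the Riesz product. Each factor contributes the shifts of the exponent at
\<open>j\<close> by \<open>1\<close>, \<open>0\<close> and \<open>-1\<close>; analyticity removes the last one because
the exponent \<open>\<mu>\<close> vanishes at \<open>j\<close>.\<close>

lemma riesz_poly_has_integral:
  fixes F :: "(nat \<Rightarrow> complex) \<Rightarrow> 'a::complex_banach"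
  assumes F: "strongly_measurable torus_measure F" and int: "integrable torus_measure (\<lambda>z. norm (F z))"
    and an: "\<And>\<nu>. \<nu> \<in> ev_null - ev_null_nonneg \<Longrightarrow> fourier_coeff F \<nu> = 0"
    and "distinct js" "\<mu> \<in> ev_null" "\<And>j. j \<in> set js \<Longrightarrow> \<mu> j = 0"
  shows "has_strong_integral torus_measure
    (\<lambda>z. (of_real (riesz_kernel (set js) w z) * monomial z (\<lambda>j. - \<mu> j)) *\<^sub>C F z) (riesz_poly (fourier_coeff F) js \<mu> w)"
  using assms(4-)
proof (induction js arbitrary: \<mu>)
  case Nil
  then show ?case using fourier_coeff_has_integral[OF F int] by (simp add: riesz_kernel_def)
next
  case (Cons j js)
  let ?P = "\<lambda>\<mu>. riesz_poly (fourier_coeff F) js \<mu> w"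
  let ?I = "\<lambda>\<mu> z. (of_real (riesz_kernel (set js) w z) * monomial z (\<lambda>j. - \<mu> j)) *\<^sub>C F z"
  let ?p = "\<lambda>i. \<mu> i + unit_index j i" and ?m = "\<lambda>i. \<mu> i - unit_index j i"
  have j: "j \<notin> set js" "distinct js" "\<mu> j = 0" and \<mu>: "\<mu> \<in> ev_null" using Cons.prems by auto
  have u0: "unit_index j i = 0" if "i \<in> set js" for i using that j by (auto simp: unit_index_def)
  have I: "has_strong_integral torus_measure (?I \<mu>) (?P \<mu>)" "has_strong_integral torus_measure (?I ?p) (?P ?p)"
    "has_strong_integral torus_measure (?I ?m) (?P ?m)"
    by (rule Cons.IH[OF j(2)]; use Cons.prems u0 in simp)+
  \<comment> \<open>the shift by \<open>-1\<close> contributes nothing, by analyticity\<close>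
  have m0: "?P ?m = 0"
  proof (rule riesz_poly_eq_zero[where i=j])
    show "?m j < 0" using j by (simp add: unit_index_def)
    show "fourier_coeff F \<nu> = 0" if "\<nu> \<in> ev_null" "\<nu> j < 0" for \<nu>
      using that by (intro an) (auto simp: ev_null_nonneg_def not_le intro: exI[of _ j])
  qed (use j \<mu> in auto)
  have H: "has_strong_integral torus_measure (\<lambda>z. ?I \<mu> z + ((w j / 2) *\<^sub>C ?I ?p z + (cnj (w j) / 2) *\<^sub>C ?I ?m z))
      (?P \<mu> + ((w j / 2) *\<^sub>C ?P ?p + (cnj (w j) / 2) *\<^sub>C ?P ?m))"
    by (intro has_strong_integral_add has_strong_integral_scaleC I)
  have E1: "?P \<mu> + ((w j / 2) *\<^sub>C ?P ?p + (cnj (w j) / 2) *\<^sub>C ?P ?m) = riesz_poly (fourier_coeff F) (j # js) \<mu> w"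
    unfolding m0 by (simp add: linear_0[OF linear_scaleC_right])
  have E2: "?I \<mu> z + ((w j / 2) *\<^sub>C ?I ?p z + (cnj (w j) / 2) *\<^sub>C ?I ?m z) =
      (of_real (riesz_kernel (set (j # js)) w z) * monomial z (\<lambda>j. - \<mu> j)) *\<^sub>C F z" if z: "z \<in> space torus_measure" for z
  proof -
    let ?k = "complex_of_real (riesz_kernel (set js) w z)" and ?M = "monomial z (\<lambda>j. - \<mu> j)"
    have mp: "monomial z (\<lambda>i. - ?p i) = ?M * cnj (z j)"
      using monomial_add[of "\<lambda>i. - \<mu> i" "\<lambda>i. - unit_index j i" z] \<mu> torus_nonzero[OF z] inverse_torus[OF z, of j]
      by (simp add: monomial_uminus)
    have mm: "monomial z (\<lambda>i. - ?m i) = ?M * z j"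
      using monomial_add[of "\<lambda>i. - \<mu> i" "unit_index j" z] \<mu> torus_nonzero[OF z] by simp
    have re: "complex_of_real (1 + Re (w j * cnj (z j))) = 1 + w j / 2 * cnj (z j) + cnj (w j) / 2 * z j"
      by (simp add: complex_eq_iff field_simps)
    have "riesz_kernel (set (j # js)) w z = (1 + Re (w j * cnj (z j))) * riesz_kernel (set js) w z"
      using j by (simp add: riesz_kernel_def)
    then have "complex_of_real (riesz_kernel (set (j # js)) w z) = (1 + w j / 2 * cnj (z j) + cnj (w j) / 2 * z j) * ?k"
      by (simp only: of_real_mult re)
    then have "of_real (riesz_kernel (set (j # js)) w z) * ?M =
        ?k * ?M + (w j / 2 * (?k * (?M * cnj (z j))) + cnj (w j) / 2 * (?k * (?M * z j)))"
      by (simp add: algebra_simps)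
    then show ?thesis unfolding mp mm by (simp only: scaleC_add_left scaleC_scaleC)
  qed
  show ?case by (rule iffD1[OF has_strong_integral_cong[OF E2] H[unfolded E1]])
qed

lemma integral_one_plus_Re: 
  assumes "cmod w \<le> 1"
  shows "(LINT z|circle_measure. 1 + Re (w * cnj z)) = 1" "(LINT z|circle_measure. 1 + Re (z * cnj w)) = 1"
    "integrable circle_measure (\<lambda>z. 1 + Re (w * cnj z))" "integrable circle_measure (\<lambda>z. 1 + Re (z * cnj w))"
proof -
  have iz: "integrable circle_measure (\<lambda>z. z)"
    by (rule integrable_circle_bounded[of _ 1]) auto
  have 0: "(LINT z|circle_measure. z) = (0::complex)" using integral_circle_powi[of 1] by simp
  have i: "integrable circle_measure (\<lambda>z. Re (z * cnj w))" using iz by (intro integrable_Re integrable_mult_left) auto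
  have z: "(LINT z|circle_measure. Re (z * cnj w)) = 0"
    using iz 0 by (subst integral_Re) auto
  show "integrable circle_measure (\<lambda>z. 1 + Re (z * cnj w))" using i by auto
  show "(LINT z|circle_measure. 1 + Re (z * cnj w)) = 1" using i z by (simp add: circle.prob_space del: times_complex.sel)
  have e: "Re (w * cnj z) = Re (z * cnj w)" for z by simp
  show "integrable circle_measure (\<lambda>z. 1 + Re (w * cnj z))" unfolding e using i by auto
  show "(LINT z|circle_measure. 1 + Re (w * cnj z)) = 1" unfolding e using i z by (simp add: circle.prob_space del: times_complex.sel)
qed

lemma riesz_factor_bounds:
  assumes "cmod w = 1" "cmod z = 1"
  shows "0 \<le> 1 + Re (w * cnj z)" "1 + Re (w * cnj z) \<le> 2"
  using abs_Re_le_cmod[of "w * cnj z"] assms by (auto simp: norm_mult simp del: times_complex.sel)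

lemma riesz_kernel_bounds:
  assumes "\<And>j. j \<in> J \<Longrightarrow> cmod (w j) = 1" "\<And>j. j \<in> J \<Longrightarrow> cmod (z j) = 1"
  shows "0 \<le> riesz_kernel J w z" "riesz_kernel J w z \<le> 2 ^ card J"
proof -
  show "0 \<le> riesz_kernel J w z"
    unfolding riesz_kernel_def by (rule prod_nonneg) (use assms riesz_factor_bounds in auto)
  have "riesz_kernel J w z \<le> (\<Prod>j\<in>J. 2)"
    unfolding riesz_kernel_def by (rule prod_mono) (use assms riesz_factor_bounds in auto)
  then show "riesz_kernel J w z \<le> 2 ^ card J" by simp
qed

text \<open>The graph of a convex function lies above its tangent at \<open>t\<close>. This is the form in which
convexity enters Jensen's inequality for a kernel of total mass one.\<close>

lemma powr_tangent:
  fixes x t p :: real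
  assumes "1 \<le> p" "0 \<le> x" "0 < t"
  shows "t powr p + p * t powr (p - 1) * (x - t) \<le> x powr p"
proof (cases "x = 0")
  case True
  have "t powr (p - 1) * t = t powr p" using assms powr_add[of t "p - 1" 1] by simp
  then have "t powr p + p * t powr (p - 1) * (x - t) = t powr p * (1 - p)" using True by (simp add: algebra_simps)
  also have "\<dots> \<le> 0" using assms by (intro mult_nonneg_nonpos) auto
  finally show ?thesis using True by simp
next
  case False
  define u where "u = x / t"
  have u: "u > 0" "x = u * t" using False assms by (auto simp: u_def)
  have "(u powr p) powr (1 / p) * 1 powr (1 - 1 / p) \<le> 1 / p * u powr p + (1 - 1 / p) * 1"
    by (rule Youngs_inequality_0) (use assms u in auto)
  then have "u \<le> 1 / p * u powr p + (1 - 1 / p)" using assms u by (simp add: powr_powr)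
  then have "p * u \<le> p * (1 / p * u powr p + (1 - 1 / p))" using assms by (intro mult_left_mono) auto
  also have "\<dots> = u powr p + (p - 1)" using assms by (simp add: ring_distribs)
  finally have "p * u \<le> u powr p + (p - 1)" .
  then have "(1 + p * (u - 1)) * t powr p \<le> u powr p * t powr p"
    by (intro mult_right_mono) (auto simp: algebra_simps)
  moreover have "t powr (p - 1) * t = t powr p" using assms powr_add[of t "p - 1" 1] by simp
  then have "p * t powr (p - 1) * (x - t) = p * (u - 1) * t powr p" unfolding u(2) by (simp add: algebra_simps)
  ultimately show ?thesis unfolding u(2) using u assms by (simp add: powr_mult algebra_simps)
qed

text \<open>Jensen's inequality for the probability density given by the Riesz product.\<close>

lemma riesz_poly_powr_le:
  fixes F :: "(nat \<Rightarrow> complex) \<Rightarrow> 'a::complex_banach"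
  assumes F: "strongly_measurable torus_measure F" and int: "integrable torus_measure (\<lambda>z. norm (F z))"
    and intp: "integrable torus_measure (\<lambda>z. norm (F z) powr p)" and p: "1 \<le> p"
    and an: "\<And>\<nu>. \<nu> \<in> ev_null - ev_null_nonneg \<Longrightarrow> fourier_coeff F \<nu> = 0"
    and js: "distinct js" "\<mu> \<in> ev_null" "\<And>j. j \<in> set js \<Longrightarrow> \<mu> j = 0"
    and w: "\<And>j. j \<in> set js \<Longrightarrow> cmod (w j) = 1"
  shows "ennreal (norm (riesz_poly (fourier_coeff F) js \<mu> w) powr p)
    \<le> (\<integral>\<^sup>+z. ennreal (riesz_kernel (set js) w z * norm (F z) powr p) \<partial>torus_measure)"
proof -
  let ?K = "riesz_kernel (set js) w" and ?Q = "riesz_poly (fourier_coeff F) js \<mu> w"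
  define t where "t = norm ?Q"
  have K: "0 \<le> ?K z" "?K z \<le> 2 ^ card (set js)" if "z \<in> space torus_measure" for z
    using riesz_kernel_bounds[of "set js" w z] w cmod_torus[OF that] by auto
  have K1: "(LINT z|torus_measure. ?K z) = 1" "integrable torus_measure ?K"
    unfolding riesz_kernel_def
    using integral_torus_prod[of "set js" "\<lambda>j z. 1 + Re (w j * cnj z)"] integral_one_plus_Re w by (auto simp del: times_complex.sel)
  have Km [measurable]: "?K \<in> borel_measurable torus_measure" using K1(2) by simp
  have intK: "integrable torus_measure (\<lambda>z. ?K z * f z)" if f: "integrable torus_measure f" for f :: "_ \<Rightarrow> real"
  proof (rule Bochner_Integration.integrable_bound[of _ "\<lambda>z. 2 ^ card (set js) * f z"])
    show "AE z in torus_measure. norm (?K z * f z) \<le> norm (2 ^ card (set js) * f z)"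
      using K by (intro AE_I2) (auto simp: abs_mult intro!: mult_right_mono)
  qed (use f in auto)
  note i = intK[OF int] intK[OF intp]
  have "ennreal t \<le> (\<integral>\<^sup>+z. norm ((of_real (?K z) * monomial z (\<lambda>j. - \<mu> j)) *\<^sub>C F z) \<partial>torus_measure)"
    unfolding t_def by (rule has_strong_integral_norm_le[OF riesz_poly_has_integral[OF F int an js]])
  also have "\<dots> = (\<integral>\<^sup>+z. ennreal (?K z * norm (F z)) \<partial>torus_measure)"
    by (rule nn_integral_cong) (simp add: norm_scaleC norm_mult norm_monomial K)
  also have "\<dots> = ennreal (LINT z|torus_measure. ?K z * norm (F z))"
    by (rule nn_integral_eq_integral[OF i(1)]) (use K in auto)
  finally have tle: "t \<le> (LINT z|torus_measure. ?K z * norm (F z))"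
    by (subst (asm) ennreal_le_iff) (auto intro!: integral_nonneg_AE AE_I2 K mult_nonneg_nonneg)
  have "t powr p \<le> (LINT z|torus_measure. ?K z * norm (F z) powr p)"
  proof (cases "t = 0")
    case True
    then show ?thesis by (auto intro!: integral_nonneg_AE AE_I2 K mult_nonneg_nonneg)
  next
    case False
    then have t: "t > 0" by (simp add: t_def)
    let ?c = "p * t powr (p - 1)"
    have c: "?c \<ge> 0" using p by simp
    have "t powr p \<le> t powr p + ?c * ((LINT z|torus_measure. ?K z * norm (F z)) - t)"
      using mult_nonneg_nonneg[OF c, of "(LINT z|torus_measure. ?K z * norm (F z)) - t"] tle by simp
    also have "\<dots> = (LINT z|torus_measure. ?K z * t powr p + (?c * (?K z * norm (F z)) - ?c * t * ?K z))"
    proof -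
      have "(LINT z|torus_measure. ?K z * t powr p + (?c * (?K z * norm (F z)) - ?c * t * ?K z)) =
          (LINT z|torus_measure. ?K z * t powr p) + (LINT z|torus_measure. ?c * (?K z * norm (F z)) - ?c * t * ?K z)"
        by (rule Bochner_Integration.integral_add) (use i K1 in auto)
      also have "(LINT z|torus_measure. ?c * (?K z * norm (F z)) - ?c * t * ?K z) =
          (LINT z|torus_measure. ?c * (?K z * norm (F z))) - (LINT z|torus_measure. ?c * t * ?K z)"
        by (rule Bochner_Integration.integral_diff) (use i K1 in auto)
      finally show ?thesis by (simp only: integral_mult_right_zero integral_mult_left_zero K1(1) right_diff_distrib mult_1_left mult_1_right)
    qed
    also have "\<dots> \<le> (LINT z|torus_measure. ?K z * norm (F z) powr p)"
    proof (rule integral_mono)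
      fix z assume z: "z \<in> space torus_measure"
      have "?K z * (t powr p + ?c * (norm (F z) - t)) \<le> ?K z * norm (F z) powr p"
        by (rule mult_left_mono[OF powr_tangent[OF p norm_ge_zero t] K(1)[OF z]])
      then show "?K z * t powr p + (?c * (?K z * norm (F z)) - ?c * t * ?K z) \<le> ?K z * norm (F z) powr p"
        by (simp add: algebra_simps)
    qed (use i K1 in auto)
    finally show ?thesis .
  qed
  then have "ennreal (t powr p) \<le> ennreal (LINT z|torus_measure. ?K z * norm (F z) powr p)" by (rule ennreal_leI)
  also have "\<dots> = (\<integral>\<^sup>+z. ennreal (?K z * norm (F z) powr p) \<partial>torus_measure)"
    by (rule nn_integral_eq_integral[OF i(2), symmetric]) (use K in auto)
  finally show ?thesis by (simp add: t_def)
qed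

abbreviation finite_torus :: "nat set \<Rightarrow> (nat \<Rightarrow> complex) measure"
  where "finite_torus J \<equiv> PiM J (\<lambda>_. circle_measure)"

lemma prob_space_finite_torus: "prob_space (finite_torus J)"
  by (rule prob_space_PiM) (rule prob_space_circle_measure)

lemma space_finite_torus: "w \<in> space (finite_torus J) \<Longrightarrow> j \<in> J \<Longrightarrow> cmod (w j) = 1"
  by (auto simp: space_PiM space_circle_measure)

lemma measurable_finite_torus_component: "j \<in> J \<Longrightarrow> (\<lambda>w. w j) \<in> borel_measurable (finite_torus J)"
  using measurable_compose[OF measurable_component_singleton[of j J "\<lambda>_. circle_measure"] measurable_id_circle] by simp

lemma strongly_measurable_riesz_poly:
  "set js \<subseteq> J \<Longrightarrow> strongly_measurable (finite_torus J) (riesz_poly c js \<mu>)"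
proof (induction js arbitrary: \<mu>)
  case (Cons j js)
  have "(\<lambda>w. w j / 2) \<in> borel_measurable (finite_torus J)"
    using measurable_finite_torus_component[of j J] Cons.prems by simp
  then have "strongly_measurable (finite_torus J) (\<lambda>w. riesz_poly c js \<mu> w + (w j / 2) *\<^sub>C riesz_poly c js (\<lambda>i. \<mu> i + unit_index j i) w)"
    using Cons by (intro strongly_measurable_add strongly_measurable_scaleC) auto
  moreover have "riesz_poly c (j # js) \<mu> = (\<lambda>w. riesz_poly c js \<mu> w + (w j / 2) *\<^sub>C riesz_poly c js (\<lambda>i. \<mu> i + unit_index j i) w)"
    by (simp add: fun_eq_iff)
  ultimately show ?case by (simp only:)
next
  case Nil
  have "riesz_poly c [] \<mu> = (\<lambda>w. c \<mu>)" by (simp add: fun_eq_iff)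
  then show ?case by (simp only: strongly_measurable_const)
qed

text \<open>Integrating Jensen's inequality over \<open>w\<close> and exchanging the integrals leaves the mass of the Riesz product
in the variable \<open>w\<close>, which is again one.\<close>

lemma riesz_contraction:
  fixes F :: "(nat \<Rightarrow> complex) \<Rightarrow> 'a::complex_banach"
  assumes F: "strongly_measurable torus_measure F" and int: "integrable torus_measure (\<lambda>z. norm (F z))"
    and intp: "integrable torus_measure (\<lambda>z. norm (F z) powr p)" and p: "1 \<le> p"
    and an: "\<And>\<nu>. \<nu> \<in> ev_null - ev_null_nonneg \<Longrightarrow> fourier_coeff F \<nu> = 0"
    and js: "distinct js" "\<mu> \<in> ev_null" "\<And>j. j \<in> set js \<Longrightarrow> \<mu> j = 0"
  shows "(\<integral>\<^sup>+w. ennreal (norm (riesz_poly (fourier_coeff F) js \<mu> w) powr p) \<partial>finite_torus (set js))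
    \<le> (\<integral>\<^sup>+z. ennreal (norm (F z) powr p) \<partial>torus_measure)"
proof -
  let ?J = "set js"
  let ?T = "finite_torus ?J"
  interpret T: prob_space ?T by (rule prob_space_finite_torus)
  interpret pair: pair_sigma_finite ?T torus_measure ..
  have Fm [measurable]: "(\<lambda>z. norm (F z)) \<in> borel_measurable torus_measure" by (rule strongly_measurable_norm[OF F])
  have cw [measurable]: "(\<lambda>x. fst x j) \<in> borel_measurable (?T \<Otimes>\<^sub>M torus_measure)" if "j \<in> ?J" for j
    by (rule measurable_compose[OF measurable_fst measurable_finite_torus_component[OF that]])
  have cz: "(\<lambda>x. snd x j) \<in> borel_measurable (?T \<Otimes>\<^sub>M torus_measure)" for j
    by (rule measurable_compose[OF measurable_snd measurable_torus_component])
  have "(\<lambda>x. \<Prod>j\<in>?J. 1 + Re (fst x j * cnj (snd x j))) \<in> borel_measurable (?T \<Otimes>\<^sub>M torus_measure)"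
  proof (rule borel_measurable_prod)
    fix j assume "j \<in> ?J"
    note [measurable] = cw[OF this] cz[of j]
    have "(\<lambda>x. 1 + (Re (fst x j) * Re (snd x j) + Im (fst x j) * Im (snd x j))) \<in> borel_measurable (?T \<Otimes>\<^sub>M torus_measure)"
      by measurable
    then show "(\<lambda>x. 1 + Re (fst x j * cnj (snd x j))) \<in> borel_measurable (?T \<Otimes>\<^sub>M torus_measure)"
      by simp
  qed
  then have Km: "(\<lambda>x. riesz_kernel ?J (fst x) (snd x)) \<in> borel_measurable (?T \<Otimes>\<^sub>M torus_measure)"
    by (simp only: riesz_kernel_def)
  have "(\<lambda>x. norm (F (snd x)) powr p) \<in> borel_measurable (?T \<Otimes>\<^sub>M torus_measure)" by measurable
  with Km have m: "(\<lambda>x. ennreal (riesz_kernel ?J (fst x) (snd x) * norm (F (snd x)) powr p)) \<in> borel_measurable (?T \<Otimes>\<^sub>M torus_measure)"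
    by simp
  have "(\<integral>\<^sup>+w. ennreal (norm (riesz_poly (fourier_coeff F) js \<mu> w) powr p) \<partial>?T)
      \<le> (\<integral>\<^sup>+w. \<integral>\<^sup>+z. ennreal (riesz_kernel ?J w z * norm (F z) powr p) \<partial>torus_measure \<partial>?T)"
    by (intro nn_integral_mono riesz_poly_powr_le F int intp p an js) (auto simp: space_finite_torus)
  also have "\<dots> = (\<integral>\<^sup>+z. \<integral>\<^sup>+w. ennreal (riesz_kernel ?J w z * norm (F z) powr p) \<partial>?T \<partial>torus_measure)"
    using pair.Fubini'[of "\<lambda>w z. ennreal (riesz_kernel ?J w z * norm (F z) powr p)"] m by (simp add: case_prod_beta')
  also have "\<dots> = (\<integral>\<^sup>+z. ennreal (norm (F z) powr p) \<partial>torus_measure)"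
  proof (rule nn_integral_cong)
    fix z assume z: "z \<in> space torus_measure"
    have i: "integrable ?T (\<lambda>w. riesz_kernel ?J w z)" "(LINT w|?T. riesz_kernel ?J w z) = 1"
      unfolding riesz_kernel_def
      using torus.product_integral_prod[of ?J "\<lambda>j w. 1 + Re (w * cnj (z j))"]
        torus.product_integrable_prod[of ?J "\<lambda>j w. 1 + Re (w * cnj (z j))"]
        integral_one_plus_Re cmod_torus[OF z]
      by (auto simp del: times_complex.sel)
    have K0: "0 \<le> riesz_kernel ?J w z" if "w \<in> space ?T" for w
      using riesz_kernel_bounds(1)[of ?J w z] cmod_torus[OF z] space_finite_torus[OF that] by auto
    have "(\<integral>\<^sup>+w. ennreal (riesz_kernel ?J w z * norm (F z) powr p) \<partial>?T) = ennreal (LINT w|?T. riesz_kernel ?J w z * norm (F z) powr p)"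
      by (rule nn_integral_eq_integral) (use i K0 in auto)
    then show "(\<integral>\<^sup>+w. ennreal (riesz_kernel ?J w z * norm (F z) powr p) \<partial>?T) = ennreal (norm (F z) powr p)"
      using i by simp
  qed
  finally show ?thesis .
qed

lemma PL_convex_nn_integral:
  fixes x y :: "'a::complex_banach"
  assumes PL: "\<And>x y::'a. (LINT \<xi>|circle_measure. norm (x + \<xi> *\<^sub>C y) powr p) \<ge> norm x powr p + C * norm y powr p"
    and p: "0 \<le> p" 
  shows "ennreal (norm x powr p + C * norm y powr p) \<le> (\<integral>\<^sup>+\<xi>. ennreal (norm (x + \<xi> *\<^sub>C y) powr p) \<partial>circle_measure)"
proof -
  have "strongly_measurable circle_measure (\<lambda>\<xi>. x + \<xi> *\<^sub>C y)"
    by (intro strongly_measurable_add strongly_measurable_scaleC strongly_measurable_const) simp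
  note [measurable] = strongly_measurable_norm[OF this]
  have "integrable circle_measure (\<lambda>\<xi>. norm (x + \<xi> *\<^sub>C y) powr p)"
  proof (rule integrable_circle_bounded[of _ "(norm x + norm y) powr p"])
    fix z :: complex assume "cmod z = 1"
    then have "norm (x + z *\<^sub>C y) \<le> norm x + norm y" using norm_triangle_ineq[of x "z *\<^sub>C y"] by (simp add: norm_scaleC)
    then have "norm (x + z *\<^sub>C y) powr p \<le> (norm x + norm y) powr p" using p by (intro powr_mono2) auto
    then show "norm (norm (x + z *\<^sub>C y) powr p) \<le> (norm x + norm y) powr p" by simp
  qed simp
  then have "(\<integral>\<^sup>+\<xi>. ennreal (norm (x + \<xi> *\<^sub>C y) powr p) \<partial>circle_measure) = ennreal (LINT \<xi>|circle_measure. norm (x + \<xi> *\<^sub>C y) powr p)"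
    by (intro nn_integral_eq_integral) auto
  then show ?thesis using PL[of x y] by (simp add: ennreal_leI)
qed

text \<open>In the variable \<open>w j\<close> that the recursion splits off, the polynomial has the form \<open>x + \<xi> y\<close>
with \<open>x\<close> and \<open>y\<close> constant; the definition of PL-convexity
applies and leaves the polynomials for the shorter list, at \<open>\<mu>\<close> and at the shifted
exponent. From the former the induction hypothesis keeps everything, from the latter only the constant coefficient.\<close>

lemma riesz_poly_lower_bound:
  fixes c :: "(nat \<Rightarrow> int) \<Rightarrow> 'a::complex_banach"
  assumes PL: "\<And>x y::'a. (LINT \<xi>|circle_measure. norm (x + \<xi> *\<^sub>C y) powr p) \<ge> norm x powr p + C * norm y powr p"
    and p: "0 \<le> p" and C: "0 \<le> C" and "distinct js"
  shows "ennreal (norm (c \<mu>) powr p + C * (1 / 2) powr p * (\<Sum>j\<in>set js. norm (c (\<lambda>i. \<mu> i + unit_index j i)) powr p))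
    \<le> (\<integral>\<^sup>+w. ennreal (norm (riesz_poly c js \<mu> w) powr p) \<partial>finite_torus (set js))"
  using assms(4)
proof (induction js arbitrary: \<mu>)
  case Nil
  interpret T: prob_space "finite_torus {}" by (rule prob_space_finite_torus)
  show ?case using T.emeasure_space_1 by simp
next
  case (Cons j js)
  let ?J = "set js" and ?D = "C * (1 / 2) powr p" and ?\<mu> = "\<lambda>i. \<mu> i + unit_index j i"
  let ?S = "\<lambda>\<mu>. (\<Sum>j\<in>?J. norm (c (\<lambda>i. \<mu> i + unit_index j i)) powr p)"
  let ?A = "riesz_poly c js \<mu>" and ?B = "riesz_poly c js ?\<mu>"
  have j: "j \<notin> ?J" "distinct js" using Cons.prems by auto
  have D: "?D \<ge> 0" using C by simp
  have Am [measurable]: "(\<lambda>w. norm (?A w)) \<in> borel_measurable (finite_torus ?J)"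
    "(\<lambda>w. norm (?B w)) \<in> borel_measurable (finite_torus ?J)"
    by (intro strongly_measurable_norm strongly_measurable_riesz_poly order_refl)+
  have fm: "(\<lambda>w. ennreal (norm (riesz_poly c (j # js) \<mu> w) powr p)) \<in> borel_measurable (finite_torus (insert j ?J))"
    using strongly_measurable_norm[OF strongly_measurable_riesz_poly[of "j # js" "insert j ?J" c \<mu>]] by (simp del: riesz_poly.simps)
  have "ennreal (norm (c \<mu>) powr p + ?D * (\<Sum>i\<in>set (j # js). norm (c (\<lambda>k. \<mu> k + unit_index i k)) powr p))
      = ennreal (norm (c \<mu>) powr p + ?D * ?S \<mu>) + ennreal ?D * ennreal (norm (c ?\<mu>) powr p)"
  proof -
    have s: "(\<Sum>i\<in>set (j # js). norm (c (\<lambda>k. \<mu> k + unit_index i k)) powr p) = ?S \<mu> + norm (c ?\<mu>) powr p"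
      using j by simp
    have a: "0 \<le> norm (c \<mu>) powr p + ?D * ?S \<mu>"
      using C by (intro add_nonneg_nonneg mult_nonneg_nonneg sum_nonneg) auto
    have "ennreal ((norm (c \<mu>) powr p + ?D * ?S \<mu>) + ?D * norm (c ?\<mu>) powr p)
      = ennreal (norm (c \<mu>) powr p + ?D * ?S \<mu>) + ennreal (?D * norm (c ?\<mu>) powr p)"
      by (rule ennreal_plus[OF a]) (use C D in simp)
    also have "ennreal (?D * norm (c ?\<mu>) powr p) = ennreal ?D * ennreal (norm (c ?\<mu>) powr p)"
      by (rule ennreal_mult) (use C D in auto)
    finally show ?thesis unfolding s by (simp only: distrib_left add.assoc)
  qed
  also have "\<dots> \<le> (\<integral>\<^sup>+w. ennreal (norm (?A w) powr p) \<partial>finite_torus ?J) + ennreal ?D * (\<integral>\<^sup>+w. ennreal (norm (?B w) powr p) \<partial>finite_torus ?J)"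
  proof (intro add_mono mult_left_mono)
    have "ennreal (norm (c ?\<mu>) powr p) \<le> ennreal (norm (c ?\<mu>) powr p + ?D * ?S ?\<mu>)"
      using D by (intro ennreal_leI) (simp add: sum_nonneg)
    also have "\<dots> \<le> (\<integral>\<^sup>+w. ennreal (norm (?B w) powr p) \<partial>finite_torus ?J)" by (rule Cons.IH[OF j(2)])
    finally show "ennreal (norm (c ?\<mu>) powr p) \<le> (\<integral>\<^sup>+w. ennreal (norm (?B w) powr p) \<partial>finite_torus ?J)" .
  qed (use Cons.IH[OF j(2)] in auto)
  also have "\<dots> = (\<integral>\<^sup>+w. ennreal (norm (?A w) powr p) + ennreal ?D * ennreal (norm (?B w) powr p) \<partial>finite_torus ?J)"
    by (simp add: nn_integral_add nn_integral_cmult)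
  also have "\<dots> \<le> (\<integral>\<^sup>+w. \<integral>\<^sup>+\<xi>. ennreal (norm (riesz_poly c (j # js) \<mu> (w(j := \<xi>))) powr p) \<partial>circle_measure \<partial>finite_torus ?J)"
  proof (rule nn_integral_mono)
    fix w
    have eq: "riesz_poly c (j # js) \<mu> (w(j := \<xi>)) = ?A w + \<xi> *\<^sub>C ((1 / 2) *\<^sub>C ?B w)" for \<xi>
    proof -
      have "riesz_poly c js \<nu> (w(j := \<xi>)) = riesz_poly c js \<nu> w" for \<nu>
        by (rule riesz_poly_cong) (use j in auto)
      then show ?thesis by (simp add: scaleC_scaleC)
    qed
    have "norm ((1 / 2) *\<^sub>C ?B w) powr p = (1 / 2) powr p * norm (?B w) powr p"
      by (simp add: norm_scaleC powr_divide powr_mult[symmetric])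
    then have "ennreal (norm (?A w) powr p) + ennreal ?D * ennreal (norm (?B w) powr p)
       = ennreal (norm (?A w) powr p + C * norm ((1 / 2) *\<^sub>C ?B w) powr p)"
      using D C by (simp add: ennreal_mult[symmetric] ennreal_plus[symmetric] mult_ac del: ennreal_plus)
    also have "\<dots> \<le> (\<integral>\<^sup>+\<xi>. ennreal (norm (?A w + \<xi> *\<^sub>C ((1 / 2) *\<^sub>C ?B w)) powr p) \<partial>circle_measure)"
      by (rule PL_convex_nn_integral[OF PL p])
    finally show "ennreal (norm (?A w) powr p) + ennreal ?D * ennreal (norm (?B w) powr p)
      \<le> (\<integral>\<^sup>+\<xi>. ennreal (norm (riesz_poly c (j # js) \<mu> (w(j := \<xi>))) powr p) \<partial>circle_measure)" unfolding eq .
  qed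
  also have "\<dots> = (\<integral>\<^sup>+w. ennreal (norm (riesz_poly c (j # js) \<mu> w) powr p) \<partial>finite_torus (insert j ?J))"
    by (rule torus.product_nn_integral_insert[symmetric, OF _ j(1) fm]) simp
  finally show ?case by simp
qed

text \<open>A cotype inequality for analytic functions: the norm controls the Fourier coefficients at the
neighbours \<open>\<mu> + e\<^sub>j\<close> of a multi-index that does not involve the variables in \<open>J\<close>.\<close>

theorem Hp_torus_lower_bound:
  fixes F :: "(nat \<Rightarrow> complex) \<Rightarrow> 'a::complex_banach"
  assumes PL: "\<And>x y::'a. (LINT \<xi>|circle_measure. norm (x + \<xi> *\<^sub>C y) powr p) \<ge> norm x powr p + C * norm y powr p"
    and p: "1 \<le> p" and C: "0 \<le> C" and F: "F \<in> Hp_torus p"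
    and J: "finite J" "\<mu> \<in> ev_null" "\<And>j. j \<in> J \<Longrightarrow> \<mu> j = 0"
  shows "C * (1 / 2) powr p * (\<Sum>j\<in>J. norm (fourier_coeff F (\<lambda>i. \<mu> i + unit_index j i)) powr p)
    \<le> (LINT z|torus_measure. norm (F z) powr p)"
proof -
  have sm: "strongly_measurable torus_measure F" and intp: "integrable torus_measure (\<lambda>z. norm (F z) powr p)"
    and an: "\<And>\<nu>. \<nu> \<in> ev_null - ev_null_nonneg \<Longrightarrow> fourier_coeff F \<nu> = 0"
    using F by (auto simp: Hp_torus_def Lp_space_def)
  have int: "integrable torus_measure (\<lambda>z. norm (F z))" by (rule Hp_torus_integrable_norm[OF F p])
  obtain js where js: "set js = J" "distinct js" using finite_distinct_list[OF J(1)] by blast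
  let ?X = "C * (1 / 2) powr p * (\<Sum>j\<in>J. norm (fourier_coeff F (\<lambda>i. \<mu> i + unit_index j i)) powr p)"
  have p0: "0 \<le> p" using p by simp
  have "ennreal ?X \<le> ennreal (norm (fourier_coeff F \<mu>) powr p + ?X)" by (rule ennreal_leI) simp
  also have "\<dots> \<le> (\<integral>\<^sup>+w. ennreal (norm (riesz_poly (fourier_coeff F) js \<mu> w) powr p) \<partial>finite_torus (set js))"
    using riesz_poly_lower_bound[OF PL p0 C js(2), of "fourier_coeff F" \<mu>] js(1) by simp
  also have "\<dots> \<le> (\<integral>\<^sup>+z. ennreal (norm (F z) powr p) \<partial>torus_measure)"
    by (rule riesz_contraction[OF sm int intp p an js(2) J(2)]) (use J(3) js(1) in auto)
  also have "\<dots> = ennreal (LINT z|torus_measure. norm (F z) powr p)"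
    by (rule nn_integral_eq_integral[OF intp]) simp
  finally show ?thesis by (simp add: ennreal_le_iff integral_nonneg_AE)
qed

section \<open>Dvoretzky-Rogers vectors\<close>

text \<open>Coordinates on a finite-dimensional subspace are bounded. In the induction the new vector has
positive distance to the span of the old ones: coefficients of approximating combinations form
Cauchy sequences, so that a zero distance would put the vector into the span.\<close>

lemma independent_coefficients_bounded:
  fixes y :: "nat \<Rightarrow> 'a::real_normed_vector"
  assumes "\<And>k. k < n \<Longrightarrow> y k \<notin> span (y ` {..<k})"
  shows "\<exists>c>0. \<forall>a. \<forall>i<n. c * \<bar>a i\<bar> \<le> norm (\<Sum>j<n. a j *\<^sub>R y j)"
  using assms
proof (induction n)
  case 0
  then show ?case by (intro exI[of _ 1]) auto
next
  case (Suc n)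
  have "\<exists>c>0. \<forall>a. \<forall>i<n. c * \<bar>a i\<bar> \<le> norm (\<Sum>j<n. a j *\<^sub>R y j)"
    by (rule Suc.IH, rule Suc.prems) simp
  then obtain c where c: "c > 0" "\<And>a i. i < n \<Longrightarrow> c * \<bar>a i\<bar> \<le> norm (\<Sum>j<n. a j *\<^sub>R y j)"
    by blast
  have "\<exists>d>0. \<forall>b. d \<le> norm (y n - (\<Sum>j<n. b j *\<^sub>R y j))"
  proof (rule ccontr)
    assume "\<not> ?thesis"
    then have neg: "\<exists>b. norm (y n - (\<Sum>j<n. b j *\<^sub>R y j)) < d" if "d > 0" for d
      using that by (auto simp: not_le)
    have "\<exists>b. norm (y n - (\<Sum>j<n. b j *\<^sub>R y j)) < 1 / real (Suc m)" for m
      by (rule neg) simp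
    then obtain b where b: "\<And>m. norm (y n - (\<Sum>j<n. b m j *\<^sub>R y j)) < 1 / real (Suc m)" by metis
    have lim: "(\<lambda>m. \<Sum>j<n. b m j *\<^sub>R y j) \<longlonglongrightarrow> y n"
    proof (rule Lim_null[THEN iffD2], rule Lim_null_comparison)
      show "eventually (\<lambda>m. norm ((\<Sum>j<n. b m j *\<^sub>R y j) - y n) \<le> 1 / real (Suc m)) sequentially"
        using b by (auto simp: norm_minus_commute intro!: always_eventually less_imp_le)
      show "(\<lambda>m. 1 / real (Suc m)) \<longlonglongrightarrow> 0" by (rule LIMSEQ_Suc[OF lim_1_over_n])
    qed
    have "Cauchy (\<lambda>m. b m i)" if i: "i < n" for i
    proof (rule metric_CauchyI)
      fix e :: real assume e: "e > 0"
      have "Cauchy (\<lambda>m. \<Sum>j<n. b m j *\<^sub>R y j)" using lim LIMSEQ_imp_Cauchy by blast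
      then obtain M where M: "\<And>m k. m \<ge> M \<Longrightarrow> k \<ge> M \<Longrightarrow>
          dist (\<Sum>j<n. b m j *\<^sub>R y j) (\<Sum>j<n. b k j *\<^sub>R y j) < c * e"
        using metric_CauchyD[of "\<lambda>m. \<Sum>j<n. b m j *\<^sub>R y j" "c * e"] mult_pos_pos[OF c(1) e] by blast
      have "dist (b m i) (b k i) < e" if "m \<ge> M" "k \<ge> M" for m k
      proof -
        have "c * \<bar>b m i - b k i\<bar> \<le> norm (\<Sum>j<n. (b m j - b k j) *\<^sub>R y j)"
          using c(2)[OF i, of "\<lambda>j. b m j - b k j"] .
        also have "\<dots> = dist (\<Sum>j<n. b m j *\<^sub>R y j) (\<Sum>j<n. b k j *\<^sub>R y j)"
          by (simp add: dist_norm scaleR_diff_left sum_subtractf)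
        also have "\<dots> < c * e" by (rule M[OF that])
        finally show ?thesis using c(1) by (simp add: dist_real_def)
      qed
      then show "\<exists>M. \<forall>m\<ge>M. \<forall>k\<ge>M. dist (b m i) (b k i) < e" by blast
    qed
    then have "\<exists>l. (\<lambda>m. b m i) \<longlonglongrightarrow> l" if "i < n" for i
      using that Cauchy_convergent convergent_def by blast
    then obtain l where l: "\<And>i. i < n \<Longrightarrow> (\<lambda>m. b m i) \<longlonglongrightarrow> l i" by metis
    have "(\<lambda>m. \<Sum>j<n. b m j *\<^sub>R y j) \<longlonglongrightarrow> (\<Sum>j<n. l j *\<^sub>R y j)"
      by (rule tendsto_sum, rule tendsto_scaleR) (use l in auto)
    then have "y n = (\<Sum>j<n. l j *\<^sub>R y j)" using lim LIMSEQ_unique by blast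
    also have "\<dots> \<in> span (y ` {..<n})"
      by (intro span_sum span_scale span_base) auto
    finally show False using Suc.prems[of n] by simp
  qed
  then obtain d where d: "d > 0" "\<And>b. d \<le> norm (y n - (\<Sum>j<n. b j *\<^sub>R y j))" by blast
  \<comment> \<open>the norm of the part without \<open>y n\<close> is at most \<open>K\<close> times the norm of the whole combination\<close>
  define K where "K = 1 + norm (y n) / d"
  have K: "K > 0" using d(1) by (simp add: K_def add_pos_nonneg)
  have "min d (c / K) * \<bar>a i\<bar> \<le> norm (\<Sum>j<Suc n. a j *\<^sub>R y j)" if i: "i < Suc n" for a i
  proof -
    let ?S = "\<Sum>j<n. a j *\<^sub>R y j" and ?T = "\<Sum>j<Suc n. a j *\<^sub>R y j"
    have T: "?T = ?S + a n *\<^sub>R y n" by simp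
    have an: "d * \<bar>a n\<bar> \<le> norm ?T"
    proof (cases "a n = 0")
      case False
      have "?T = a n *\<^sub>R (y n - (\<Sum>j<n. (- a j / a n) *\<^sub>R y j))"
      proof -
        have e: "(\<Sum>j<n. (- a j / a n) *\<^sub>R y j) = (- 1 / a n) *\<^sub>R ?S"
          unfolding scaleR_sum_right by (rule sum.cong) simp_all
        show ?thesis unfolding T e using False by (simp add: scaleR_right_diff_distrib scaleR_add_right)
      qed
      then have "norm ?T = \<bar>a n\<bar> * norm (y n - (\<Sum>j<n. (- a j / a n) *\<^sub>R y j))" by simp
      then show ?thesis using mult_left_mono[OF d(2)[of "\<lambda>j. - a j / a n"], of "\<bar>a n\<bar>"] by (simp add: mult.commute)
    qed simp
    show ?thesis
    proof (cases "i = n")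
      case True
      then show ?thesis using an mult_right_mono[of "min d (c / K)" d "\<bar>a n\<bar>"] by simp
    next
      case False
      then have "c * \<bar>a i\<bar> \<le> norm ?S" using i c(2) by simp
      also have "norm ?S \<le> norm ?T + \<bar>a n\<bar> * norm (y n)"
        using norm_triangle_ineq4[of ?T "a n *\<^sub>R y n"] T by simp
      also have "\<bar>a n\<bar> * norm (y n) \<le> norm ?T * (norm (y n) / d)"
        using mult_right_mono[OF an, of "norm (y n) / d"] d(1) by (simp add: field_simps)
      finally have "c * \<bar>a i\<bar> \<le> norm ?T * K" by (simp add: K_def algebra_simps)
      then have "c / K * \<bar>a i\<bar> \<le> norm ?T" using K by (simp add: field_simps)
      then show ?thesis using mult_right_mono[of "min d (c / K)" "c / K" "\<bar>a i\<bar>"] by simp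
    qed
  qed
  then show ?case using d(1) c(1) K by (intro exI[of _ "min d (c / K)"]) auto
qed

definition column_comb :: "(nat \<Rightarrow> 'a::real_normed_vector) \<Rightarrow> real mat \<Rightarrow> nat \<Rightarrow> 'a"
  where "column_comb y A k = (\<Sum>j<dim_row A. A $$ (j, k) *\<^sub>R y j)"

text \<open>\<open>x\<close> is the image of the standard basis under a linear map of norm at most one from the
\<open>n\<close>-dimensional real Hilbert space.\<close>

definition ell2_contraction :: "nat \<Rightarrow> (nat \<Rightarrow> 'a::real_normed_vector) \<Rightarrow> bool"
  where "ell2_contraction n x \<longleftrightarrow> (\<forall>a. (norm (\<Sum>k<n. a k *\<^sub>R x k))\<^sup>2 \<le> (\<Sum>k<n. (a k)\<^sup>2))"

lemma ell2_contraction_norm_le: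
  assumes "ell2_contraction n x" "k < n"
  shows "norm (x k) \<le> 1"
proof -
  have "(norm (\<Sum>i<n. (if i = k then 1 else 0) *\<^sub>R x i))\<^sup>2 \<le> (\<Sum>i<n. (if i = k then 1 else 0 :: real)\<^sup>2)"
    by (rule assms(1)[unfolded ell2_contraction_def, rule_format])
  also have "(\<Sum>i<n. (if i = k then 1 else 0 :: real)\<^sup>2) = 1"
    using assms(2) by (subst sum.mono_neutral_right[of _ "{k}"]) auto
  also have "(\<Sum>i<n. (if i = k then 1 else 0) *\<^sub>R x i) = x k"
    using assms(2) by (subst sum.mono_neutral_right[of _ "{k}"]) auto
  finally show ?thesis by (simp add: power_le_one_iff abs_le_square_iff[of _ 1, simplified])
qed

lemma ell2_contraction_scaled_exists:
  fixes y :: "nat \<Rightarrow> 'a::real_normed_vector"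
  shows "\<exists>\<delta>>0. ell2_contraction n (\<lambda>k. \<delta> *\<^sub>R y k)"
proof -
  define S where "S = 1 + (\<Sum>k<n. (norm (y k))\<^sup>2)"
  have S: "S > 0" unfolding S_def by (intro add_pos_nonneg sum_nonneg) auto
  have "(norm (\<Sum>k<n. a k *\<^sub>R (1 / sqrt S) *\<^sub>R y k))\<^sup>2 \<le> (\<Sum>k<n. (a k)\<^sup>2)" for a
  proof -
    have "(\<Sum>k<n. a k *\<^sub>R (1 / sqrt S) *\<^sub>R y k) = (1 / sqrt S) *\<^sub>R (\<Sum>k<n. a k *\<^sub>R y k)"
      by (simp add: scaleR_sum_right mult.commute)
    then have e: "(norm (\<Sum>k<n. a k *\<^sub>R (1 / sqrt S) *\<^sub>R y k))\<^sup>2 = (norm (\<Sum>k<n. a k *\<^sub>R y k))\<^sup>2 / S"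
      using S by (simp add: power_mult_distrib power_divide)
    have "norm (\<Sum>k<n. a k *\<^sub>R y k) \<le> (\<Sum>k<n. \<bar>a k\<bar> * norm (y k))"
      by (rule order_trans[OF norm_sum]) simp
    then have "(norm (\<Sum>k<n. a k *\<^sub>R y k))\<^sup>2 \<le> (\<Sum>k<n. \<bar>a k\<bar> * norm (y k))\<^sup>2"
      by (rule power_mono) simp
    also have "\<dots> \<le> (\<Sum>k<n. \<bar>a k\<bar>\<^sup>2) * (\<Sum>k<n. (norm (y k))\<^sup>2)"
      by (rule Cauchy_Schwarz_ineq_sum)
    also have "\<dots> \<le> (\<Sum>k<n. (a k)\<^sup>2) * S"
      unfolding S_def by (simp add: sum_nonneg mult_left_mono)
    finally show ?thesis unfolding e using S by (simp add: divide_le_eq)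
  qed
  then show ?thesis unfolding ell2_contraction_def using S by (intro exI[of _ "1 / sqrt S"]) auto
qed

lemma abs_signof_real [simp]: "\<bar>signof p\<bar> = (1 :: real)"
  by (simp add: sign_def)

lemma abs_det_le:
  fixes A :: "real mat"
  assumes A: "A \<in> carrier_mat n n" and B: "\<And>i j. i < n \<Longrightarrow> j < n \<Longrightarrow> \<bar>A $$ (i, j)\<bar> \<le> B"
  shows "\<bar>det A\<bar> \<le> fact n * B ^ n"
proof -
  have "\<bar>det A\<bar> \<le> (\<Sum>p | p permutes {0..<n}. \<bar>signof p * (\<Prod>i=0..<n. A $$ (i, p i))\<bar>)"
    unfolding det_def'[OF A] by (rule sum_abs)
  also have "\<dots> \<le> (\<Sum>p | p permutes {0..<n}. B ^ n)"
  proof (rule sum_mono)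
    fix p assume "p \<in> {p. p permutes {0..<n}}"
    then have p: "p i < n" if "i < n" for i using permutes_in_image[of p "{0..<n}" i] that by auto
    have "\<bar>signof p * (\<Prod>i=0..<n. A $$ (i, p i))\<bar> = (\<Prod>i=0..<n. \<bar>A $$ (i, p i)\<bar>)"
      by (simp add: abs_mult abs_prod)
    also have "\<dots> \<le> (\<Prod>i=0..<n. B)" by (rule prod_mono) (use B p in auto)
    finally show "\<bar>signof p * (\<Prod>i=0..<n. A $$ (i, p i))\<bar> \<le> B ^ n" by simp
  qed
  also have "\<dots> = fact n * B ^ n" by (simp add: card_permutations[of _ n])
  finally show ?thesis .
qed

lemma det_scale_columns:
  fixes A :: "real mat"
  assumes A: "A \<in> carrier_mat n n"
  shows "det (mat n n (\<lambda>(i, k). d k * A $$ (i, k))) = (\<Prod>k<n. d k) * det A"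
proof -
  have "det (mat n n (\<lambda>(i, k). d k * A $$ (i, k))) =
    (\<Sum>p | p permutes {0..<n}. signof p * (\<Prod>i=0..<n. mat n n (\<lambda>(i, k). d k * A $$ (i, k)) $$ (i, p i)))"
    by (rule det_def') simp
  also have "\<dots> = (\<Sum>p | p permutes {0..<n}. (\<Prod>k<n. d k) * (signof p * (\<Prod>i=0..<n. A $$ (i, p i))))"
  proof (rule sum.cong[OF refl])
    fix p assume "p \<in> {p. p permutes {0..<n}}"
    then have pp: "p permutes {0..<n}" by simp
    have p: "p i < n" if "i < n" for i using permutes_in_image[OF pp, of i] that by auto
    have "(\<Prod>i=0..<n. mat n n (\<lambda>(i, k). d k * A $$ (i, k)) $$ (i, p i)) = (\<Prod>i=0..<n. d (p i) * A $$ (i, p i))"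
      by (rule prod.cong) (use p in auto)
    also have "\<dots> = (\<Prod>i=0..<n. d (p i)) * (\<Prod>i=0..<n. A $$ (i, p i))" by (rule prod.distrib)
    also have "(\<Prod>i=0..<n. d (p i)) = (\<Prod>i=0..<n. d i)"
      using prod.permute[OF pp, of d] by (simp add: comp_def)
    finally show "signof p * (\<Prod>i=0..<n. mat n n (\<lambda>(i, k). d k * A $$ (i, k)) $$ (i, p i)) = (\<Prod>k<n. d k) * (signof p * (\<Prod>i=0..<n. A $$ (i, p i)))"
      by (simp add: atLeast0LessThan)
  qed
  also have "\<dots> = (\<Prod>k<n. d k) * det A" by (simp only: sum_distrib_left det_def'[OF A])
  finally show ?thesis .
qed

lemma column_comb_scale:
  assumes "A \<in> carrier_mat n n" "k < n"
  shows "column_comb y (mat n n (\<lambda>(i, k). d k * A $$ (i, k))) k = d k *\<^sub>R column_comb y A k"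
  using assms by (simp add: column_comb_def scaleR_sum_right)

text \<open>The volume argument. If the map were bounded by \<open>1/4\<close> on the span of the last \<open>2 * N - t\<close> basis
vectors, then doubling it there and multiplying by \<open>4/5\<close> would give another contraction, as
\<open>4/5 * (1 + 1/4) = 1\<close>. Its determinant is larger by a factor of at least
\<open>(4/5) ^ (2 * N) * 2 ^ N = (32/25) ^ N\<close>, which is too much for a nearly maximal one. Working with
near maximality avoids the compactness needed for an exact maximum.\<close>

lemma near_maximal_large_combination:
  fixes y :: "nat \<Rightarrow> 'a::real_normed_vector"
  assumes A: "A \<in> carrier_mat (2 * N) (2 * N)" and con: "ell2_contraction (2 * N) (column_comb y A)"
    and pos: "\<bar>det A\<bar> > 25 / 32 * s"
    and s: "\<And>A'. A' \<in> carrier_mat (2 * N) (2 * N) \<Longrightarrow> ell2_contraction (2 * N) (column_comb y A') \<Longrightarrow> \<bar>det A'\<bar> \<le> s"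
    and t: "t \<le> N" and N: "N \<ge> 1"
  shows "\<exists>a. (\<forall>k<t. a k = 0) \<and> (\<Sum>k<2*N. (a k)\<^sup>2) = 1 \<and> norm (\<Sum>k<2*N. a k *\<^sub>R column_comb y A k) \<ge> 1 / 4"
proof (rule ccontr)
  assume neg: "\<not> ?thesis"
  let ?n = "2 * N" and ?x = "column_comb y A"
  have small: "norm (\<Sum>k<?n. a k *\<^sub>R ?x k) \<le> 1 / 4 * sqrt (\<Sum>k<?n. (a k)\<^sup>2)" if a: "\<And>k. k < t \<Longrightarrow> a k = 0" for a
  proof (cases "(\<Sum>k<?n. (a k)\<^sup>2) = 0")
    case True
    then have "\<And>k. k < ?n \<Longrightarrow> a k = 0" by (auto simp: sum_nonneg_eq_0_iff)
    then show ?thesis by (simp add: True)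
  next
    case False
    define r where "r = sqrt (\<Sum>k<?n. (a k)\<^sup>2)"
    have r: "r > 0" "r\<^sup>2 = (\<Sum>k<?n. (a k)\<^sup>2)" using False by (simp_all add: r_def sum_nonneg less_le)
    have "(\<Sum>k<?n. (a k / r)\<^sup>2) = 1"
      using False by (simp add: power_divide r(2) flip: sum_divide_distrib)
    then have "norm (\<Sum>k<?n. (a k / r) *\<^sub>R ?x k) < 1 / 4"
      using neg a by (auto simp: not_le)
    moreover have "(\<Sum>k<?n. (a k / r) *\<^sub>R ?x k) = (1 / r) *\<^sub>R (\<Sum>k<?n. a k *\<^sub>R ?x k)"
      by (simp add: scaleR_sum_right)
    ultimately have "norm (\<Sum>k<?n. a k *\<^sub>R ?x k) \<le> 1 / 4 * r" using r(1) by (simp add: field_simps)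
    then show ?thesis unfolding r_def .
  qed
  define d where "d k = (if k < t then 4 / 5 else 8 / 5 :: real)" for k
  define A' where "A' = mat ?n ?n (\<lambda>(i, k). d k * A $$ (i, k))"
  have A': "A' \<in> carrier_mat ?n ?n" by (simp add: A'_def)
  have "ell2_contraction ?n (column_comb y A')"
    unfolding ell2_contraction_def
  proof
    fix a :: "nat \<Rightarrow> real"
    let ?r = "sqrt (\<Sum>k<?n. (a k)\<^sup>2)"
    define b where "b k = (if k < t then 0 else a k)" for k
    have b: "norm (\<Sum>k<?n. b k *\<^sub>R ?x k) \<le> 1 / 4 * ?r"
    proof -
      have "(\<Sum>k<?n. (b k)\<^sup>2) \<le> (\<Sum>k<?n. (a k)\<^sup>2)" by (rule sum_mono) (simp add: b_def)
      then have "sqrt (\<Sum>k<?n. (b k)\<^sup>2) \<le> ?r" by simp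
      moreover have "norm (\<Sum>k<?n. b k *\<^sub>R ?x k) \<le> 1 / 4 * sqrt (\<Sum>k<?n. (b k)\<^sup>2)"
        by (rule small) (simp add: b_def)
      ultimately show ?thesis by linarith
    qed
    have a: "norm (\<Sum>k<?n. a k *\<^sub>R ?x k) \<le> ?r"
      using con unfolding ell2_contraction_def by (intro real_le_rsqrt) blast
    have "(\<Sum>k<?n. a k *\<^sub>R column_comb y A' k) = (\<Sum>k<?n. (4 / 5) *\<^sub>R (a k *\<^sub>R ?x k + b k *\<^sub>R ?x k))"
    proof (rule sum.cong[OF refl])
      fix k assume "k \<in> {..<?n}"
      then have "column_comb y A' k = d k *\<^sub>R ?x k" unfolding A'_def by (intro column_comb_scale[OF A]) simp
      then show "a k *\<^sub>R column_comb y A' k = (4 / 5) *\<^sub>R (a k *\<^sub>R ?x k + b k *\<^sub>R ?x k)"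
        by (simp add: d_def b_def scaleR_add_left[symmetric])
    qed
    also have "\<dots> = (4 / 5) *\<^sub>R ((\<Sum>k<?n. a k *\<^sub>R ?x k) + (\<Sum>k<?n. b k *\<^sub>R ?x k))"
      by (simp only: scaleR_sum_right[symmetric] sum.distrib)
    finally have "norm (\<Sum>k<?n. a k *\<^sub>R column_comb y A' k) \<le> 4 / 5 * (?r + 1 / 4 * ?r)"
      using norm_triangle_ineq[of "\<Sum>k<?n. a k *\<^sub>R ?x k" "\<Sum>k<?n. b k *\<^sub>R ?x k"] a b by simp
    then have "norm (\<Sum>k<?n. a k *\<^sub>R column_comb y A' k) \<le> ?r" by simp
    then have "(norm (\<Sum>k<?n. a k *\<^sub>R column_comb y A' k))\<^sup>2 \<le> ?r\<^sup>2" by (rule power_mono) simp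
    then show "(norm (\<Sum>k<?n. a k *\<^sub>R column_comb y A' k))\<^sup>2 \<le> (\<Sum>k<?n. (a k)\<^sup>2)" by (simp add: sum_nonneg)
  qed
  then have le: "\<bar>det A'\<bar> \<le> s" by (rule s[OF A'])
  have "(\<Prod>k<?n. d k) \<ge> 32 / 25"
  proof -
    have "(\<Prod>k<?n. d k) = (\<Prod>k<N. d k) * (\<Prod>k=N..<?n. d k)"
      by (simp add: atLeast0LessThan[symmetric] prod.atLeastLessThan_concat)
    also have "(\<Prod>k=N..<?n. d k) = (\<Prod>k=N..<?n. 8 / 5)" by (rule prod.cong) (use t in \<open>auto simp: d_def\<close>)
    also have "\<dots> = (8 / 5) ^ N" by simp
    also have "(\<Prod>k<N. d k) * (8 / 5) ^ N \<ge> (\<Prod>k<N. 4 / 5) * (8 / 5) ^ N"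
      by (intro mult_right_mono prod_mono) (auto simp: d_def)
    finally have "(\<Prod>k<?n. d k) \<ge> (4 / 5) ^ N * (8 / 5) ^ N" by simp
    also have "(4 / 5) ^ N * (8 / 5 :: real) ^ N = (32 / 25) ^ N" by (simp flip: power_mult_distrib)
    also have "(32 / 25 :: real) ^ N \<ge> (32 / 25) ^ 1" by (rule power_increasing[OF N]) simp
    finally show ?thesis by simp
  qed
  then have "32 / 25 * \<bar>det A\<bar> \<le> \<bar>\<Prod>k<?n. d k\<bar> * \<bar>det A\<bar>"
    by (intro mult_right_mono) auto
  moreover have "\<bar>det A'\<bar> = \<bar>\<Prod>k<?n. d k\<bar> * \<bar>det A\<bar>"
    unfolding A'_def by (simp only: det_scale_columns[OF A] abs_mult)
  ultimately have "\<bar>det A'\<bar> \<ge> 32 / 25 * \<bar>det A\<bar>" by simp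
  then show False using pos le by simp
qed

text \<open>The reflection that exchanges the unit vectors \<open>a\<close> and \<open>e\<^sub>r\<close>
moves a prescribed unit combination into position \<open>r\<close>. It is orthogonal, so the contraction
property and the modulus of the determinant survive, and it fixes \<open>e\<^sub>k\<close> for \<open>k < r\<close>.\<close>

lemma householder_exchange:
  fixes y :: "nat \<Rightarrow> 'a::real_normed_vector"
  assumes A: "A \<in> carrier_mat n n" and con: "ell2_contraction n (column_comb y A)"
    and a: "\<And>k. k < r \<Longrightarrow> a k = 0" "(\<Sum>k<n. (a k)\<^sup>2) = 1" and r: "r < n"
  shows "\<exists>A'. A' \<in> carrier_mat n n \<and> ell2_contraction n (column_comb y A') \<and> \<bar>det A'\<bar> = \<bar>det A\<bar> \<and>
    (\<forall>k<r. column_comb y A' k = column_comb y A k) \<and>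
    column_comb y A' r = (\<Sum>k<n. a k *\<^sub>R column_comb y A k)"
proof -
  let ?x = "column_comb y A"
  define v where "v k = a k - (if k = r then 1 else 0)" for k
  define \<beta> where "\<beta> = (\<Sum>k<n. (v k)\<^sup>2)"
  have "\<beta> = (\<Sum>k<n. (a k)\<^sup>2) + (\<Sum>k<n. (if k = r then 1 - 2 * a k else 0))"
    unfolding \<beta>_def v_def by (subst sum.distrib[symmetric]) (auto intro!: sum.cong simp: power2_eq_square algebra_simps)
  then have \<beta>r: "\<beta> = - 2 * v r" using r a(2) by (simp add: v_def)
  show ?thesis
  proof (cases "\<beta> = 0")
    case True
    then have "v k = 0" if "k < n" for k
      using that unfolding \<beta>_def by (auto simp: sum_nonneg_eq_0_iff)
    then have "a k = (if k = r then 1 else 0)" if "k < n" for k using that by (auto simp: v_def)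
    then have "(\<Sum>k<n. a k *\<^sub>R ?x k) = (\<Sum>k<n. if k = r then ?x k else 0)" by (intro sum.cong) auto
    then have "(\<Sum>k<n. a k *\<^sub>R ?x k) = ?x r" using r by simp
    then show ?thesis using A con by (intro exI[of _ A]) auto
  next
    case False
    define h where "h i k = (if i = k then 1 else 0) - 2 * v i * v k / \<beta>" for i k
    define H where "H = mat n n (\<lambda>(i, k). h i k)"
    have H: "H \<in> carrier_mat n n" by (simp add: H_def)
    have hsum: "(\<Sum>i<n. h j i * b i) = b j - 2 * v j * (\<Sum>i<n. v i * b i) / \<beta>" if "j < n" for j b
    proof -
      have "(\<Sum>i<n. h j i * b i) = (\<Sum>i<n. (if i = j then b i else 0) - 2 * v j / \<beta> * (v i * b i))"
        by (rule sum.cong) (auto simp: h_def algebra_simps)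
      also have "\<dots> = b j - 2 * v j / \<beta> * (\<Sum>i<n. v i * b i)"
        using that by (simp add: sum_subtractf sum_distrib_left)
      finally show ?thesis by simp
    qed
    have "H * H = 1\<^sub>m n"
    proof (rule eq_matI)
      fix i j assume "i < dim_row (1\<^sub>m n)" "j < dim_col (1\<^sub>m n)"
      then have i: "i < n" and j: "j < n" by auto
      have "(H * H) $$ (i, j) = (\<Sum>k<n. h i k * h k j)"
        using i j by (simp add: H_def scalar_prod_def atLeast0LessThan)
      also have "\<dots> = h i j - 2 * v i * (\<Sum>k<n. v k * h k j) / \<beta>" by (rule hsum[OF i])
      also have "(\<Sum>k<n. v k * h k j) = (\<Sum>k<n. h j k * v k)"
        by (rule sum.cong) (auto simp: h_def)
      also have "\<dots> = v j - 2 * v j * (\<Sum>k<n. v k * v k) / \<beta>" by (rule hsum[OF j])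
      also have "(\<Sum>k<n. v k * v k) = \<beta>" by (simp add: \<beta>_def power2_eq_square)
      also have "h i j - 2 * v i * (v j - 2 * v j * \<beta> / \<beta>) / \<beta> = (if i = j then 1 else 0)"
        using False by (simp add: h_def)
      finally show "(H * H) $$ (i, j) = 1\<^sub>m n $$ (i, j)" using i j by simp
    qed (auto simp: H_def)
    then have "det H * det H = 1" using det_mult[OF H H] by simp
    then have detH: "\<bar>det H\<bar> = 1" by (metis abs_1 abs_mult_self_eq abs_square_eq_1 power2_eq_square)
    have col: "column_comb y (A * H) k = (\<Sum>i<n. h i k *\<^sub>R ?x i)" if k: "k < n" for k
    proof -
      have "column_comb y (A * H) k = (\<Sum>j<n. (\<Sum>i<n. A $$ (j, i) * h i k) *\<^sub>R y j)"
        unfolding column_comb_def using A k by (intro sum.cong) (auto simp: H_def scalar_prod_def atLeast0LessThan)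
      also have "\<dots> = (\<Sum>j<n. \<Sum>i<n. h i k *\<^sub>R A $$ (j, i) *\<^sub>R y j)"
        by (simp add: scaleR_sum_left mult.commute)
      also have "\<dots> = (\<Sum>i<n. \<Sum>j<n. h i k *\<^sub>R A $$ (j, i) *\<^sub>R y j)" by (rule sum.swap)
      also have "\<dots> = (\<Sum>i<n. h i k *\<^sub>R ?x i)"
        unfolding column_comb_def scaleR_sum_right using A by auto
      finally show ?thesis .
    qed
    have "ell2_contraction n (column_comb y (A * H))"
      unfolding ell2_contraction_def
    proof
      fix b :: "nat \<Rightarrow> real"
      define c where "c i = (\<Sum>k<n. h i k * b k)" for i
      define t where "t = (\<Sum>i<n. v i * b i)"
      have c: "c i = b i - 2 * v i * t / \<beta>" if "i < n" for i unfolding c_def t_def by (rule hsum[OF that])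
      have "(\<Sum>k<n. b k *\<^sub>R column_comb y (A * H) k) = (\<Sum>k<n. \<Sum>i<n. (h i k * b k) *\<^sub>R ?x i)"
        by (intro sum.cong) (auto simp: col scaleR_sum_right mult.commute)
      also have "\<dots> = (\<Sum>i<n. \<Sum>k<n. (h i k * b k) *\<^sub>R ?x i)" by (rule sum.swap)
      also have "\<dots> = (\<Sum>i<n. c i *\<^sub>R ?x i)" by (simp add: c_def scaleR_sum_left)
      finally have "(norm (\<Sum>k<n. b k *\<^sub>R column_comb y (A * H) k))\<^sup>2 \<le> (\<Sum>i<n. (c i)\<^sup>2)"
        using con by (simp add: ell2_contraction_def)
      also have "(\<Sum>i<n. (c i)\<^sup>2) = (\<Sum>i<n. (b i)\<^sup>2 - 4 * t / \<beta> * (v i * b i) + 4 * t\<^sup>2 / \<beta>\<^sup>2 * (v i)\<^sup>2)"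
        by (intro sum.cong) (auto simp: c power2_eq_square algebra_simps)
      also have "\<dots> = (\<Sum>i<n. (b i)\<^sup>2) - 4 * t / \<beta> * t + 4 * t\<^sup>2 / \<beta>\<^sup>2 * \<beta>"
        by (simp add: sum.distrib sum_subtractf sum_distrib_left t_def \<beta>_def)
      also have "\<dots> = (\<Sum>i<n. (b i)\<^sup>2)" using False by (simp add: power2_eq_square)
      finally show "(norm (\<Sum>k<n. b k *\<^sub>R column_comb y (A * H) k))\<^sup>2 \<le> (\<Sum>i<n. (b i)\<^sup>2)" .
    qed
    moreover have "column_comb y (A * H) k = ?x k" if k: "k < r" for k
    proof -
      have "v k = 0" using k a(1) by (simp add: v_def)
      then have "(\<Sum>i<n. h i k *\<^sub>R ?x i) = (\<Sum>i<n. if i = k then ?x i else 0)"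
        by (intro sum.cong) (auto simp: h_def)
      then show ?thesis using col[of k] k r by simp
    qed
    moreover have "column_comb y (A * H) r = (\<Sum>k<n. a k *\<^sub>R ?x k)"
    proof -
      have "h i r = a i" for i
        using False by (simp add: h_def \<beta>r) (simp add: v_def)
      then show ?thesis using col[OF r] by simp
    qed
    moreover have "\<bar>det (A * H)\<bar> = \<bar>det A\<bar>" by (simp add: det_mult[OF A H] abs_mult detH)
    ultimately show ?thesis using A H by (intro exI[of _ "A * H"]) auto
  qed
qed

text \<open>Among all contractions into the span of \<open>2 * N\<close> independent vectors one is chosen whose determinant is
nearly maximal. As long as at least \<open>N\<close> dimensions remain, the volume argument finds
a unit vector with a large image in them, and a reflection moves it to the next position.\<close>

theorem Dvoretzky_Rogers:
  assumes inf: "\<And>S :: 'a::real_normed_vector set. finite S \<Longrightarrow> span S \<noteq> UNIV"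
  shows "\<exists>x :: nat \<Rightarrow> 'a. (\<forall>k<N. norm (x k) \<ge> 1 / 4) \<and> ell2_contraction N x"
proof (cases "N = 0")
  case True
  then show ?thesis by (simp add: ell2_contraction_def)
next
  case False
  then have N: "N \<ge> 1" by simp
  let ?n = "2 * N"
  have "\<exists>y :: nat \<Rightarrow> 'a. \<forall>k<n. y k \<notin> span (y ` {..<k})" for n
  proof (induction n)
    case (Suc n)
    then obtain y :: "nat \<Rightarrow> 'a" where y: "\<And>k. k < n \<Longrightarrow> y k \<notin> span (y ` {..<k})" by blast
    obtain w where w: "w \<notin> span (y ` {..<n})" using inf[of "y ` {..<n}"] by auto
    have im: "(y(n := w)) ` {..<k} = y ` {..<k}" if "k \<le> n" for k
      using that by (auto simp: image_iff)
    have "(y(n := w)) k \<notin> span ((y(n := w)) ` {..<k})" if "k < Suc n" for k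
      using that y[of k] w im[of k] by (cases "k = n") auto
    then show ?case by blast
  qed simp
  then obtain y :: "nat \<Rightarrow> 'a" where y: "\<And>k. k < ?n \<Longrightarrow> y k \<notin> span (y ` {..<k})" by blast
  obtain c where c: "c > 0" "\<And>a i. i < ?n \<Longrightarrow> c * \<bar>a i\<bar> \<le> norm (\<Sum>j<?n. a j *\<^sub>R y j)"
    using independent_coefficients_bounded[of ?n y, OF y] by blast
  define D where "D = {\<bar>det A\<bar> | A. A \<in> carrier_mat ?n ?n \<and> ell2_contraction ?n (column_comb y A)}"
  have bdd: "\<bar>det A\<bar> \<le> fact ?n * (1 / c) ^ ?n"
    if A: "A \<in> carrier_mat ?n ?n" and con: "ell2_contraction ?n (column_comb y A)" for A
  proof (rule abs_det_le[OF A])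
    fix i k assume i: "i < ?n" and k: "k < ?n"
    have "c * \<bar>A $$ (i, k)\<bar> \<le> norm (column_comb y A k)"
      using c(2)[OF i, of "\<lambda>j. A $$ (j, k)"] A by (simp add: column_comb_def)
    also have "\<dots> \<le> 1" by (rule ell2_contraction_norm_le[OF con k])
    finally show "\<bar>A $$ (i, k)\<bar> \<le> 1 / c" using c(1) by (simp add: field_simps)
  qed
  have bddD: "bdd_above D" unfolding D_def bdd_above_def using bdd by blast
  define s where "s = Sup D"
  have s: "\<bar>det A\<bar> \<le> s" if "A \<in> carrier_mat ?n ?n" "ell2_contraction ?n (column_comb y A)" for A
    unfolding s_def by (rule cSup_upper[OF _ bddD]) (use that in \<open>auto simp: D_def\<close>)
  obtain \<delta> where \<delta>: "\<delta> > 0" "ell2_contraction ?n (\<lambda>k. \<delta> *\<^sub>R y k)"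
    using ell2_contraction_scaled_exists by blast
  have I: "\<delta> \<cdot>\<^sub>m 1\<^sub>m ?n \<in> carrier_mat ?n ?n" by simp
  have "column_comb y (\<delta> \<cdot>\<^sub>m 1\<^sub>m ?n) k = \<delta> *\<^sub>R y k" if "k < ?n" for k
  proof -
    have "column_comb y (\<delta> \<cdot>\<^sub>m 1\<^sub>m ?n) k = (\<Sum>j<?n. if j = k then \<delta> *\<^sub>R y j else 0)"
      unfolding column_comb_def using that by (intro sum.cong) auto
    then show ?thesis using that by simp
  qed
  then have "ell2_contraction ?n (column_comb y (\<delta> \<cdot>\<^sub>m 1\<^sub>m ?n))"
    using \<delta>(2) by (simp add: ell2_contraction_def)
  then have mem: "\<bar>det (\<delta> \<cdot>\<^sub>m 1\<^sub>m ?n)\<bar> \<in> D" unfolding D_def using I by blast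
  have "0 < \<bar>det (\<delta> \<cdot>\<^sub>m 1\<^sub>m ?n)\<bar>" using \<delta>(1) by simp
  also have "\<dots> \<le> s" unfolding s_def by (rule cSup_upper[OF mem bddD])
  finally have "25 / 32 * s < Sup D" unfolding s_def by simp
  then obtain A0 where A0: "A0 \<in> carrier_mat ?n ?n" "ell2_contraction ?n (column_comb y A0)" "25 / 32 * s < \<bar>det A0\<bar>"
    using less_cSup_iff[of D "25 / 32 * s"] mem bddD by (auto simp: D_def)
  have "\<exists>A. A \<in> carrier_mat ?n ?n \<and> ell2_contraction ?n (column_comb y A) \<and> 25 / 32 * s < \<bar>det A\<bar> \<and>
      (\<forall>k<t. norm (column_comb y A k) \<ge> 1 / 4)" if "t \<le> N" for t
    using that
  proof (induction t)
    case 0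
    then show ?case using A0 by auto
  next
    case (Suc t)
    then obtain A where A: "A \<in> carrier_mat ?n ?n" "ell2_contraction ?n (column_comb y A)" "25 / 32 * s < \<bar>det A\<bar>"
      "\<And>k. k < t \<Longrightarrow> norm (column_comb y A k) \<ge> 1 / 4" by auto
    obtain a where a: "\<And>k. k < t \<Longrightarrow> a k = 0" "(\<Sum>k<?n. (a k)\<^sup>2) = 1"
        "norm (\<Sum>k<?n. a k *\<^sub>R column_comb y A k) \<ge> 1 / 4"
      using near_maximal_large_combination[OF A(1,2,3) s _ N, of t] Suc.prems by auto
    have "t < ?n" using Suc.prems by simp
    from householder_exchange[OF A(1,2) a(1,2) this] obtain A' where
      A': "A' \<in> carrier_mat ?n ?n" "ell2_contraction ?n (column_comb y A')" "\<bar>det A'\<bar> = \<bar>det A\<bar>"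
      "\<And>k. k < t \<Longrightarrow> column_comb y A' k = column_comb y A k"
      "column_comb y A' t = (\<Sum>k<?n. a k *\<^sub>R column_comb y A k)" by auto
    have "norm (column_comb y A' k) \<ge> 1 / 4" if "k < Suc t" for k
      using that A'(4,5) A(4) a(3) by (cases "k = t") auto
    then show ?case using A' A(3) by auto
  qed
  from this[of N] obtain A where A: "ell2_contraction ?n (column_comb y A)"
    "\<And>k. k < N \<Longrightarrow> norm (column_comb y A k) \<ge> 1 / 4" by auto
  have "ell2_contraction N (column_comb y A)"
    unfolding ell2_contraction_def
  proof
    fix a :: "nat \<Rightarrow> real"
    let ?b = "\<lambda>k. if k < N then a k else 0"
    have "(norm (\<Sum>k<?n. ?b k *\<^sub>R column_comb y A k))\<^sup>2 \<le> (\<Sum>k<?n. (?b k)\<^sup>2)"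
      by (rule A(1)[unfolded ell2_contraction_def, rule_format])
    moreover have "(\<Sum>k<?n. ?b k *\<^sub>R column_comb y A k) = (\<Sum>k<N. a k *\<^sub>R column_comb y A k)"
      by (rule sum.mono_neutral_cong_right) auto
    moreover have "(\<Sum>k<?n. (?b k)\<^sup>2) = (\<Sum>k<N. (a k)\<^sup>2)"
      by (rule sum.mono_neutral_cong_right) auto
    ultimately show "(norm (\<Sum>k<N. a k *\<^sub>R column_comb y A k))\<^sup>2 \<le> (\<Sum>k<N. (a k)\<^sup>2)" by simp
  qed
  then show ?thesis using A(2) by blast
qed

section \<open>Dirichlet series and the Volterra operator\<close>

lemma norm_nat_powr: "cmod (of_nat n powr s) = real n powr Re s"
  using norm_powr_real_powr[of "of_nat n" s] by simp

lemma norm_dterm: "norm (dterm a s n) = norm (a n) * real n powr (- Re s)"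
  by (simp add: dterm_def norm_scaleC norm_nat_powr)

text \<open>Absolute convergence on the closed half-plane \<open>Re s \<ge> \<sigma>\<close>, expressed through the coefficients.\<close>

definition abs_conv :: "(nat \<Rightarrow> 'a::complex_banach) \<Rightarrow> real \<Rightarrow> bool"
  where "abs_conv a \<sigma> \<longleftrightarrow> summable (\<lambda>n. norm (a n) * real n powr (- \<sigma>))"

lemma powr_uminus_antimono: "\<sigma> \<le> \<tau> \<Longrightarrow> real n powr (- \<tau>) \<le> real n powr (- \<sigma>)"
  by (cases "n = 0") (auto intro: powr_mono)

lemma abs_conv_mono:
  assumes "abs_conv a \<sigma>" "\<sigma> \<le> \<tau>"
  shows "abs_conv a \<tau>"
  unfolding abs_conv_def
  by (rule summable_comparison_test'[OF assms(1)[unfolded abs_conv_def], of 0])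
     (use powr_uminus_antimono[OF assms(2)] in \<open>auto intro: mult_left_mono\<close>)

lemma abs_conv_bound:
  assumes "abs_conv a \<sigma>" "\<And>n. norm (b n) \<le> norm (a n)"
  shows "abs_conv b \<sigma>"
  unfolding abs_conv_def
  by (rule summable_comparison_test'[OF assms(1)[unfolded abs_conv_def], of 0])
     (use assms(2) in \<open>auto intro: mult_right_mono\<close>)

lemma abs_conv_summable:
  fixes a :: "nat \<Rightarrow> 'a::complex_banach"
  assumes "abs_conv a \<sigma>" "\<sigma> \<le> Re s"
  shows "summable (dterm a s)"
  by (rule summable_norm_cancel)
     (use abs_conv_mono[OF assms] in \<open>simp add: norm_dterm abs_conv_def\<close>)

text \<open>At a point of convergence the terms are bounded; moving two units to the right gains the summable
factor \<open>n powr -2\<close>.\<close>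

lemma Dirichlet_abs_conv:
  assumes "a \<in> Dirichlet"
  shows "\<exists>\<sigma>. abs_conv a \<sigma>"
proof -
  obtain s where s: "summable (dterm a s)" using assms by (auto simp: Dirichlet_def conv_set_def)
  have "Bseq (dterm a s)" using summable_LIMSEQ_zero[OF s] by (intro convergent_imp_Bseq) (auto simp: convergent_def)
  then obtain B where B: "\<And>n. norm (dterm a s n) \<le> B" by (auto simp: Bseq_def)
  have "abs_conv a (Re s + 2)"
    unfolding abs_conv_def
  proof (rule summable_comparison_test')
    show "summable (\<lambda>n. B * real n powr (- 2))"
      using summable_real_powr_iff[of "-2"] by (intro summable_mult) simp
    fix n :: nat assume "n \<ge> 0"
    have "norm (a n) * real n powr (- (Re s + 2)) = norm (dterm a s n) * real n powr (- 2)"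
      by (simp add: norm_dterm powr_add[symmetric])
    also have "\<dots> \<le> B * real n powr (- 2)" by (rule mult_right_mono[OF B]) simp
    finally show "norm (norm (a n) * real n powr (- (Re s + 2))) \<le> B * real n powr (- 2)" by simp
  qed
  then show ?thesis by blast
qed

lemma DirichletI: "a 0 = 0 \<Longrightarrow> abs_conv a \<sigma> \<Longrightarrow> a \<in> Dirichlet"
  using abs_conv_summable[of a \<sigma> "of_real \<sigma>"] by (auto simp: Dirichlet_def conv_set_def)

lemma abs_conv_add:
  assumes "abs_conv a \<sigma>" "abs_conv b \<sigma>"
  shows "abs_conv (\<lambda>n. a n + b n) \<sigma>"
  unfolding abs_conv_def
proof (rule summable_comparison_test')
  show "summable (\<lambda>n. norm (a n) * real n powr (- \<sigma>) + norm (b n) * real n powr (- \<sigma>))"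
    using assms by (intro summable_add) (auto simp: abs_conv_def)
  show "norm (norm (a n + b n) * real n powr - \<sigma>) \<le> norm (a n) * real n powr - \<sigma> + norm (b n) * real n powr - \<sigma>" for n
    using mult_right_mono[OF norm_triangle_ineq[of "a n" "b n"], of "real n powr - \<sigma>"]
    by (simp add: ring_distribs)
qed

lemma abs_conv_zero [simp]: "abs_conv (\<lambda>n. 0) \<sigma>"
  by (simp add: abs_conv_def)

lemma abs_conv_sum: "finite J \<Longrightarrow> (\<And>j. j \<in> J \<Longrightarrow> abs_conv (a j) \<sigma>) \<Longrightarrow> abs_conv (\<lambda>n. \<Sum>j\<in>J. a j n) \<sigma>"
  by (induction rule: finite_induct) (auto intro: abs_conv_add)

lemma abs_conv_scaleC_left:
  assumes "abs_conv b \<sigma>" shows "abs_conv (\<lambda>n. b n *\<^sub>C (x :: 'a::complex_banach)) \<sigma>"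
proof -
  have "summable (\<lambda>n. norm x * (cmod (b n) * real n powr - \<sigma>))"
    using assms unfolding abs_conv_def by (rule summable_mult)
  then show ?thesis unfolding abs_conv_def by (simp add: norm_scaleC mult_ac)
qed

text \<open>If \<open>d n\<close> is the first coefficient that is not known to vanish, it is minus the tail of the series times
\<open>n powr t\<close>, and this decays like \<open>(n / (n + 1)) powr t\<close> as \<open>t\<close> grows.\<close>

lemma dirichlet_sum_eq_zero_imp:
  fixes d :: "nat \<Rightarrow> 'a::complex_banach"
  assumes d0: "d 0 = 0" and conv: "abs_conv d \<sigma>"
    and zero: "\<And>t. t > \<tau> \<Longrightarrow> dirichlet_sum d (of_real t) = 0"
  shows "d n = 0"
proof (induction n rule: less_induct)
  case (less n)
  show ?case
  proof (cases "n = 0")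
    case False
    then have n: "n \<ge> 1" by simp
    define S where "S = (\<Sum>m. norm (d m) * real m powr (- \<sigma>))"
    have sm: "summable (\<lambda>m. norm (d m) * real m powr (- \<sigma>))" using conv by (simp add: abs_conv_def)
    have "norm (d n) \<le> S * real (Suc n) powr \<sigma> * (real n / real (Suc n)) powr t" if t: "t > \<tau>" "t \<ge> \<sigma>" for t
    proof -
      have sum: "summable (dterm d (of_real t))" by (rule abs_conv_summable[OF conv]) (use t in simp)
      have z: "dterm d (of_real t) m = 0" if "m < n" for m using less.IH[OF that] by (simp add: dterm_def linear_0[OF linear_scaleC_right])
      have "0 = (\<Sum>m. dterm d (of_real t) (m + Suc n)) + (\<Sum>m<Suc n. dterm d (of_real t) m)"
        using zero[OF t(1)] suminf_split_initial_segment[OF sum, of "Suc n"] by (simp add: dirichlet_sum_def)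
      also have "(\<Sum>m<Suc n. dterm d (of_real t) m) = dterm d (of_real t) n" using z by simp
      finally have e: "norm (dterm d (of_real t) n) = norm (\<Sum>m. dterm d (of_real t) (m + Suc n))"
        by (metis add_eq_0_iff2 norm_minus_cancel)
      let ?c = "real (Suc n) powr (- (t - \<sigma>))"
      have bd: "norm (dterm d (of_real t) (m + Suc n)) \<le> ?c * (norm (d (m + Suc n)) * real (m + Suc n) powr (- \<sigma>))" for m
      proof -
        have "real (m + Suc n) powr (- t) = real (m + Suc n) powr (- (t - \<sigma>)) * real (m + Suc n) powr (- \<sigma>)"
          by (simp add: powr_add[symmetric])
        also have "\<dots> \<le> ?c * real (m + Suc n) powr (- \<sigma>)"
          by (rule mult_right_mono, rule powr_mono2') (use t in auto)
        finally show ?thesis by (simp add: norm_dterm mult.left_commute mult_left_mono)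
      qed
      have sm': "summable (\<lambda>m. norm (d (m + Suc n)) * real (m + Suc n) powr (- \<sigma>))"
        using sm by (rule summable_ignore_initial_segment)
      have "norm (\<Sum>m. dterm d (of_real t) (m + Suc n)) \<le> (\<Sum>m. ?c * (norm (d (m + Suc n)) * real (m + Suc n) powr (- \<sigma>)))"
        by (rule norm_suminf_le[OF bd summable_mult[OF sm']])
      also have "\<dots> = ?c * (\<Sum>m. norm (d (m + Suc n)) * real (m + Suc n) powr (- \<sigma>))" by (rule suminf_mult[OF sm'])
      also have "\<dots> \<le> ?c * S"
      proof (rule mult_left_mono)
        have "0 \<le> (\<Sum>m<Suc n. norm (d m) * real m powr (- \<sigma>))" by (rule sum_nonneg) simp
        then show "(\<Sum>m. norm (d (m + Suc n)) * real (m + Suc n) powr (- \<sigma>)) \<le> S"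
          unfolding S_def suminf_split_initial_segment[OF sm, of "Suc n"] by linarith
      qed simp
      finally have "norm (d n) * real n powr (- t) \<le> ?c * S" using e by (simp add: norm_dterm)
      then have "norm (d n) * real n powr (- t) * real n powr t \<le> ?c * S * real n powr t"
        by (rule mult_right_mono) simp
      moreover have "real n powr (- t) * real n powr t = 1" using n by (simp add: powr_add[symmetric])
      moreover have "?c * real n powr t = real (Suc n) powr \<sigma> * (real n / real (Suc n)) powr t"
        by (simp add: powr_divide powr_diff powr_minus field_simps)
      ultimately show ?thesis by (simp add: mult_ac)
    qed
    note bound = this
    let ?q = "real n / real (Suc n)"
    obtain K :: nat where K: "max \<tau> \<sigma> < real K" using reals_Archimedean2 by blast
    have "norm (d n) \<le> S * real (Suc n) powr \<sigma> * ?q ^ k" if "k \<ge> K" for k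
      using bound[of "real k"] K that n by (simp add: powr_realpow)
    then have "\<exists>N. \<forall>k\<ge>N. norm (d n) \<le> S * real (Suc n) powr \<sigma> * ?q ^ k" by blast
    moreover have "(\<lambda>k. S * real (Suc n) powr \<sigma> * ?q ^ k) \<longlonglongrightarrow> S * real (Suc n) powr \<sigma> * 0"
      by (rule tendsto_mult[OF tendsto_const LIMSEQ_realpow_zero]) auto
    ultimately have "norm (d n) \<le> S * real (Suc n) powr \<sigma> * 0"
      using LIMSEQ_le_const by blast
    then show ?thesis by simp
  qed (simp add: d0)
qed


lemma Dirichlet_unique:
  fixes a b :: "nat \<Rightarrow> 'a::complex_banach"
  assumes "a \<in> Dirichlet" "b \<in> Dirichlet"
    and eq: "\<And>s. Re s > \<tau> \<Longrightarrow> dirichlet_sum a s = dirichlet_sum b s"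
  shows "a = b"
proof
  fix n
  obtain \<alpha> where \<alpha>: "abs_conv a \<alpha>" using Dirichlet_abs_conv[OF assms(1)] by blast
  obtain \<beta> where \<beta>: "abs_conv b \<beta>" using Dirichlet_abs_conv[OF assms(2)] by blast
  have ab: "abs_conv a (max \<alpha> \<beta>)" "abs_conv b (max \<alpha> \<beta>)"
    by (rule abs_conv_mono[OF \<alpha>], simp) (rule abs_conv_mono[OF \<beta>], simp)
  let ?\<sigma> = "max \<alpha> \<beta>"
  have "abs_conv (\<lambda>n. - b n) ?\<sigma>" by (rule abs_conv_bound[OF ab(2)]) simp
  from abs_conv_add[OF ab(1) this] have d: "abs_conv (\<lambda>n. a n - b n) ?\<sigma>" by simp
  have "a n - b n = 0"
  proof (rule dirichlet_sum_eq_zero_imp[OF _ d, of "max \<tau> ?\<sigma>"])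
    show "a 0 - b 0 = 0" using assms by (simp add: Dirichlet_def)
    fix t assume t: "t > max \<tau> ?\<sigma>"
    have "dirichlet_sum (\<lambda>n. a n - b n) (of_real t) = (\<Sum>n. dterm a (of_real t) n - dterm b (of_real t) n)"
      by (simp add: dirichlet_sum_def dterm_def linear_diff[OF linear_scaleC_right])
    also have "\<dots> = dirichlet_sum a (of_real t) - dirichlet_sum b (of_real t)"
      unfolding dirichlet_sum_def
      by (rule suminf_diff[symmetric]; rule abs_conv_summable, rule ab) (use t in auto)
    also have "\<dots> = 0" using eq[of "of_real t"] t by simp
    finally show "dirichlet_sum (\<lambda>n. a n - b n) (of_real t) = 0" .
  qed
  then show "a n = b n" by simp
qed

lemma abs_ln_mult_powr_le:
  "\<bar>ln (real n)\<bar> * real n powr (- (\<sigma> + 1)) \<le> real n powr (- \<sigma>)"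
proof (cases "n = 0")
  case False
  then have "ln (real n) \<le> real n" using ln_le_minus_one[of "real n"] by simp
  then have "\<bar>ln (real n)\<bar> * real n powr (- (\<sigma> + 1)) \<le> real n powr 1 * real n powr (- (\<sigma> + 1))"
    using False by (intro mult_right_mono) auto
  also have "\<dots> = real n powr (- \<sigma>)" by (simp only: powr_add[symmetric]) simp
  finally show ?thesis .
qed simp

lemma dirichlet_sum_has_field_derivative:
  fixes b :: "nat \<Rightarrow> complex"
  assumes conv: "abs_conv b \<sigma>" and s: "Re s > \<sigma> + 1"
  shows "(dirichlet_sum b has_field_derivative dirichlet_sum (\<lambda>n. - of_real (ln (real n)) * b n) s) (at s)"
proof -
  let ?S = "{z. Re z \<ge> \<sigma> + 1}"
  let ?f' = "\<lambda>n z. - of_real (ln (real n)) * dterm b z n"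
  have sm: "summable (\<lambda>n. norm (b n) * real n powr (- \<sigma>))" using conv by (simp add: abs_conv_def)
  have "convex ?S" by (rule convex_halfspace_Re_ge)
  moreover have "((\<lambda>z. dterm b z n) has_field_derivative ?f' n z) (at z within ?S)" for n z
  proof (cases "n = 0")
    case True
    then show ?thesis by (simp add: dterm_def)
  next
    case False
    have "((\<lambda>z. of_nat n powr (- z)) has_field_derivative Ln (of_nat n) * of_nat n powr (- z) * (- 1)) (at z within ?S)"
      by (rule DERIV_chain2[OF has_field_derivative_powr_right]) (use False in \<open>auto intro!: derivative_eq_intros\<close>)
    from DERIV_cmult_right[OF this, of "b n"] show ?thesis
      using False by (simp add: dterm_def scaleC_complex_def Ln_of_nat mult_ac)
  qed
  moreover have "uniformly_convergent_on ?S (\<lambda>n z. \<Sum>i<n. ?f' i z)"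
  proof (rule Weierstrass_m_test'[OF _ sm])
    fix n z assume z: "z \<in> ?S"
    have "\<bar>ln (real n)\<bar> * real n powr (- Re z) \<le> \<bar>ln (real n)\<bar> * real n powr (- (\<sigma> + 1))"
      by (intro mult_left_mono powr_uminus_antimono) (use z in auto)
    also have "\<dots> \<le> real n powr (- \<sigma>)" by (rule abs_ln_mult_powr_le)
    finally have "\<bar>ln (real n)\<bar> * real n powr (- Re z) \<le> real n powr (- \<sigma>)" .
    then have "cmod (b n) * (\<bar>ln (real n)\<bar> * real n powr (- Re z)) \<le> cmod (b n) * real n powr (- \<sigma>)"
      by (rule mult_left_mono) simp
    then show "norm (?f' n z) \<le> norm (b n) * real n powr (- \<sigma>)"
      by (simp add: norm_mult norm_dterm mult_ac)
  qed
  moreover have "s \<in> ?S" "summable (dterm b s)" using s by (auto intro!: abs_conv_summable[OF conv])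
  moreover have "s \<in> interior ?S"
  proof -
    have "open {z. \<sigma> + 1 < Re z}" by (rule open_halfspace_Re_gt)
    then show ?thesis using s by (intro interiorI[of "{z. \<sigma> + 1 < Re z}"]) auto
  qed
  ultimately have "((\<lambda>z. \<Sum>n. dterm b z n) has_field_derivative (\<Sum>n. ?f' n s)) (at s)"
    by (rule has_field_derivative_series'(2))
  moreover have "(\<lambda>n. ?f' n s) = dterm (\<lambda>n. - of_real (ln (real n)) * b n) s"
    by (simp add: fun_eq_iff dterm_def scaleC_complex_def)
  ultimately show ?thesis by (simp add: dirichlet_sum_def[abs_def])
qed

text \<open>The coefficients of \<open>T\<^sub>g\<close> applied to \<open>k powr -s\<close>: the derivative of \<open>g\<close> contributes \<open>ln n\<close>, and integrating \<open>m powr -s\<close> along the half-line divides it by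
\<open>ln m\<close>, where \<open>m = n * k\<close>.\<close>

definition volterra_coeff :: "(nat \<Rightarrow> complex) \<Rightarrow> nat \<Rightarrow> nat \<Rightarrow> complex"
  where "volterra_coeff g k m = (if k dvd m then g (m div k) * of_real (ln (real (m div k)) / ln (real m)) else 0)"

lemma volterra_coeff_mult:
  "k > 0 \<Longrightarrow> volterra_coeff g k (n * k) = g n * of_real (ln (real n) / ln (real (n * k)))"
  by (simp add: volterra_coeff_def)

lemma volterra_coeff_sums:
  assumes conv: "abs_conv g \<sigma>" and g0: "g 0 = 0" and k: "k \<ge> 2" and s: "\<sigma> \<le> Re s"
  shows "dterm (volterra_coeff g k) s sums
    (of_nat k powr (- s) * dirichlet_sum (\<lambda>n. g n * of_real (ln (real n) / ln (real (n * k)))) s)"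
    and "abs_conv (\<lambda>n. g n * of_real (ln (real n) / ln (real (n * k)))) \<sigma>"
proof -
  let ?b = "\<lambda>n. g n * of_real (ln (real n) / ln (real (n * k)))"
  show b: "abs_conv ?b \<sigma>"
  proof (rule abs_conv_bound[OF conv])
    fix n
    have "\<bar>ln (real n) / ln (real (n * k))\<bar> \<le> 1"
    proof (cases "n = 0")
      case False
      then have "ln (real n) \<le> ln (real (n * k))" "0 \<le> ln (real n)" using k by auto
      then show ?thesis by (cases "ln (real (n * k)) = 0") (auto simp: divide_le_eq_1)
    qed simp
    from mult_left_mono[OF this norm_ge_zero, of "g n"] show "norm (?b n) \<le> norm (g n)"
      by (simp only: norm_mult norm_of_real mult_1_right)
  qed
  have "dterm ?b s sums dirichlet_sum ?b s"
    unfolding dirichlet_sum_def by (rule summable_sums[OF abs_conv_summable[OF b s]])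
  then have "(\<lambda>n. of_nat k powr (- s) * dterm ?b s n) sums (of_nat k powr (- s) * dirichlet_sum ?b s)"
    by (rule sums_mult)
  moreover have "of_nat k powr (- s) * dterm ?b s n = dterm (volterra_coeff g k) s (n * k)" for n
  proof -
    have e: "(of_nat (n * k) :: complex) powr (- s) = of_nat n powr (- s) * of_nat k powr (- s)"
      unfolding of_nat_mult by (rule powr_times_real) auto
    have "k > 0" using k by simp
    show ?thesis
      unfolding dterm_def scaleC_complex_def volterra_coeff_mult[OF \<open>k > 0\<close>] e by (simp only: mult_ac)
  qed
  ultimately have "(\<lambda>n. dterm (volterra_coeff g k) s (n * k)) sums (of_nat k powr (- s) * dirichlet_sum ?b s)"
    by simp
  then show "dterm (volterra_coeff g k) s sums (of_nat k powr (- s) * dirichlet_sum ?b s)"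
  proof (subst (asm) sums_mono_reindex)
    show "strict_mono (\<lambda>n. n * k)" using k by (auto simp: strict_mono_def)
    fix m assume "m \<notin> range (\<lambda>n. n * k)"
    then have "\<not> k dvd m" by (auto simp: dvd_def mult.commute)
    then show "dterm (volterra_coeff g k) s m = 0" by (simp add: dterm_def volterra_coeff_def scaleC_complex_def)
  qed
qed


lemma abs_conv_log:
  fixes b :: "nat \<Rightarrow> complex"
  assumes conv: "abs_conv b \<sigma>"
  shows "abs_conv (\<lambda>n. - of_real (ln (real n)) * b n) (\<sigma> + 1)"
  unfolding abs_conv_def
proof (rule summable_comparison_test'[OF conv[unfolded abs_conv_def], of 0])
  fix n :: nat assume "n \<ge> 0"
  from mult_left_mono[OF abs_ln_mult_powr_le, of "cmod (b n)" n \<sigma>]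
  show "norm (norm (- of_real (ln (real n)) * b n) * real n powr - (\<sigma> + 1)) \<le> norm (b n) * real n powr - \<sigma>"
    by (simp add: norm_mult mult_ac)
qed

text \<open>The fundamental theorem of calculus on a half-line, for values in a Banach space.\<close>

lemma has_integral_to_infinity:
  fixes f :: "real \<Rightarrow> 'a::banach"
  assumes int: "\<And>b. b \<ge> 0 \<Longrightarrow> (f has_integral (F b - F 0)) {0..b}"
    and lim: "(F \<longlongrightarrow> L) at_top"
  shows "(f has_integral (L - F 0)) {0..}"
  unfolding has_integral_alt'[of f "L - F 0"]
proof (intro conjI allI impI)
  let ?g = "\<lambda>x. if x \<in> {0..} then f x else 0"
  fix a b :: real
  have "((\<lambda>x. if x \<in> {0..max 0 b} then f x else 0) has_integral (F (max 0 b) - F 0)) UNIV"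
    by (subst has_integral_restrict_UNIV) (rule int, simp)
  then have "(\<lambda>x. if x \<in> {0..max 0 b} then f x else 0) integrable_on cbox a b"
    using integrable_on_subcbox[of _ UNIV a b] by (auto simp: integrable_on_def)
  then show "?g integrable_on cbox a b"
    by (rule integrable_eq) auto
next
  let ?g = "\<lambda>x. if x \<in> {0..} then f x else 0"
  fix e :: real assume "e > 0"
  then have "eventually (\<lambda>b. dist (F b) L < e) at_top" by (rule tendstoD[OF lim])
  then obtain B where B: "\<And>b. b \<ge> B \<Longrightarrow> dist (F b) L < e" by (auto simp: eventually_at_top_linorder)
  show "\<exists>B>0. \<forall>a b. ball 0 B \<subseteq> cbox a b \<longrightarrow> norm (integral (cbox a b) ?g - (L - F 0)) < e"
  proof (intro exI[of _ "max 1 B"] conjI allI impI)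
    fix a b :: real assume sub: "ball 0 (max 1 B) \<subseteq> cbox a b"
    have "{- max 1 B<..<max 1 B} \<subseteq> {a..b}" using sub by (auto simp: dist_real_def subset_iff abs_less_iff)
    then have ab: "a \<le> - max 1 B" "max 1 B \<le> b"
      using closure_mono[of "{- max 1 B<..<max 1 B}" "{a..b}"] by auto
    have r: "((\<lambda>x. if x \<in> {0..b} then f x else 0) has_integral (F b - F 0)) (cbox a b)"
      by (subst has_integral_restrict) (use ab int[of b] in auto)
    have "(?g has_integral (F b - F 0)) (cbox a b)"
      by (rule has_integral_eq[OF _ r]) auto
    then have "integral (cbox a b) ?g = F b - F 0" by (rule integral_unique)
    then show "norm (integral (cbox a b) ?g - (L - F 0)) < e"
      using B[of b] ab by (simp add: dist_norm)
  qed simp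
qed

text \<open>The primitive is \<open>\<Phi> z = (\<Sum>n. g n * (ln n / ln (n * k)) * (n * k) powr -z)\<close>. Differentiation multiplies the terms
by \<open>- ln (n * k)\<close>, which restores the product of \<open>k powr -z\<close> and the derivative of \<open>g\<close>; at
infinity \<open>\<Phi>\<close> tends to zero because of the factor \<open>k powr -z\<close> with \<open>k \<ge> 2\<close>.\<close>

lemma volterra_monomial_integral:
  assumes conv: "abs_conv g \<sigma>" and g0: "g 0 = 0" and k: "k \<ge> 2" and s: "Re s > \<sigma> + 1"
  shows "((\<lambda>t. deriv (dirichlet_sum g) (s + of_real t) * of_nat k powr (- (s + of_real t)))
    has_integral - dirichlet_sum (volterra_coeff g k) s) {0..}"
proof -
  define b where "b n = g n * of_real (ln (real n) / ln (real (n * k)))" for n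
  define \<Phi> where "\<Phi> z = of_nat k powr (- z) * dirichlet_sum b z" for z
  have bconv: "abs_conv b \<sigma>"
    using volterra_coeff_sums(2)[OF conv g0 k, of "of_real \<sigma>"] by (simp add: b_def[abs_def])
  have \<Phi>: "dirichlet_sum (volterra_coeff g k) z = \<Phi> z" if "\<sigma> \<le> Re z" for z
    using volterra_coeff_sums(1)[OF conv g0 k that] by (simp add: dirichlet_sum_def sums_iff \<Phi>_def b_def[abs_def])
  have deriv: "(\<Phi> has_field_derivative deriv (dirichlet_sum g) z * of_nat k powr (- z)) (at z)"
    if z: "Re z > \<sigma> + 1" for z
  proof -
    have k0: "(of_nat k :: complex) \<noteq> 0" using k by simp
    have g': "deriv (dirichlet_sum g) z = dirichlet_sum (\<lambda>n. - of_real (ln (real n)) * g n) z"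
      by (rule DERIV_imp_deriv[OF dirichlet_sum_has_field_derivative[OF conv z]])
    have d1: "((\<lambda>z. of_nat k powr (- z)) has_field_derivative Ln (of_nat k) * of_nat k powr (- z) * (- 1)) (at z)"
      by (rule DERIV_chain2[OF has_field_derivative_powr_right[OF k0]]) (auto intro!: derivative_eq_intros)
    have d: "(\<Phi> has_field_derivative of_nat k powr (- z) * dirichlet_sum (\<lambda>n. - of_real (ln (real n)) * b n) z
        + (Ln (of_nat k) * of_nat k powr (- z) * (- 1)) * dirichlet_sum b z) (at z)"
      unfolding \<Phi>_def by (rule DERIV_mult'[OF d1 dirichlet_sum_has_field_derivative[OF bconv z]])
    have sb: "summable (dterm b z)" by (rule abs_conv_summable[OF bconv]) (use z in simp)
    have sb': "summable (dterm (\<lambda>n. - of_real (ln (real n)) * b n) z)"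
      by (rule abs_conv_summable[OF abs_conv_log[OF bconv]]) (use z in simp)
    have trm: "dterm (\<lambda>n. - of_real (ln (real n)) * g n) z n =
        dterm (\<lambda>n. - of_real (ln (real n)) * b n) z n - of_real (ln (real k)) * dterm b z n" for n
    proof (cases "n = 0")
      case False
      have l: "ln (real (n * k)) = ln (real n) + ln (real k)" using False k by (simp add: ln_mult)
      moreover have "ln (real n) \<ge> 0" "ln (real k) > 0" using False k by auto
      ultimately have "ln (real (n * k)) \<noteq> 0" by linarith
      then have "b n * of_real (ln (real (n * k))) = g n * of_real (ln (real n))"
        unfolding b_def by (simp del: of_nat_mult)
      then have "g n * of_real (ln (real n)) = b n * (of_real (ln (real n)) + of_real (ln (real k)))"
        unfolding l by simp
      then have "of_nat n powr (- z) * (g n * of_real (ln (real n))) = of_nat n powr (- z) * (b n * (of_real (ln (real n)) + of_real (ln (real k))))"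
        by (rule arg_cong)
      then show ?thesis by (simp add: dterm_def scaleC_complex_def algebra_simps)
    qed (simp add: dterm_def scaleC_complex_def g0 b_def)
    have "deriv (dirichlet_sum g) z = dirichlet_sum (\<lambda>n. - of_real (ln (real n)) * b n) z - of_real (ln (real k)) * dirichlet_sum b z"
      unfolding g' dirichlet_sum_def trm
      by (subst suminf_diff[symmetric, OF sb' summable_mult[OF sb]]) (simp add: suminf_mult[OF sb])
    moreover have "Ln (of_nat k) = of_real (ln (real k))" using k by (simp add: Ln_of_nat)
    ultimately show ?thesis
      by (intro DERIV_cong[OF d]) (simp only: ring_distribs mult_ac mult_minus_left mult_minus_right mult_1_left mult_1_right diff_conv_add_uminus)
  qed
  have "((\<lambda>t. deriv (dirichlet_sum g) (s + of_real t) * of_nat k powr (- (s + of_real t)))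
    has_integral 0 - \<Phi> (s + of_real 0)) {0..}"
  proof (rule has_integral_to_infinity)
    fix c :: real assume c: "c \<ge> 0"
    show "((\<lambda>t. deriv (dirichlet_sum g) (s + of_real t) * of_nat k powr (- (s + of_real t)))
      has_integral \<Phi> (s + of_real c) - \<Phi> (s + of_real 0)) {0..c}"
    proof (rule fundamental_theorem_of_calculus[OF c])
      fix t assume t: "t \<in> {0..c}"
      have "((\<lambda>t. s + of_real t) has_vector_derivative 1) (at t within {0..c})"
        by (auto intro!: derivative_eq_intros)
      moreover have "(\<Phi> has_field_derivative deriv (dirichlet_sum g) (s + of_real t) * of_nat k powr (- (s + of_real t)))
          (at (s + of_real t) within (\<lambda>t. s + of_real t) ` {0..c})"
        by (rule has_field_derivative_at_within[OF deriv]) (use s t in simp)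
      ultimately show "((\<lambda>t. \<Phi> (s + of_real t)) has_vector_derivative
        deriv (dirichlet_sum g) (s + of_real t) * of_nat k powr (- (s + of_real t))) (at t within {0..c})"
        using field_vector_diff_chain_within[of "\<lambda>t. s + of_real t" 1 t "{0..c}" \<Phi>] by (simp add: o_def)
    qed
  next
    define S where "S = (\<Sum>n. norm (b n) * real n powr (- \<sigma>))"
    have sm: "summable (\<lambda>n. norm (b n) * real n powr (- \<sigma>))" using bconv by (simp add: abs_conv_def)
    have lim: "((\<lambda>t. exp (- (ln (real k) * (Re s + t))) * S) \<longlongrightarrow> 0 * S) at_top"
    proof (rule tendsto_mult[OF filterlim_compose[OF exp_at_bot] tendsto_const])
      have "filterlim (\<lambda>t. ln (real k) * (Re s + t)) at_top at_top"
        by (rule filterlim_tendsto_pos_mult_at_top[OF tendsto_const])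
           (use k in \<open>auto intro: filterlim_tendsto_add_at_top[OF tendsto_const filterlim_ident]\<close>)
      then show "filterlim (\<lambda>t. - (ln (real k) * (Re s + t))) at_bot at_top"
        by (simp add: filterlim_uminus_at_top)
    qed
    show "((\<lambda>t. \<Phi> (s + of_real t)) \<longlongrightarrow> 0) at_top"
    proof (rule Lim_null_comparison)
      show "((\<lambda>t. exp (- (ln (real k) * (Re s + t))) * S) \<longlongrightarrow> 0) at_top" using lim by simp
      have "norm (\<Phi> (s + of_real t)) \<le> exp (- (ln (real k) * (Re s + t))) * S" if t: "t \<ge> 0" for t
      proof -
        have "norm (dterm b (s + of_real t) n) \<le> norm (b n) * real n powr (- \<sigma>)" for n
          unfolding norm_dterm by (intro mult_left_mono powr_uminus_antimono) (use s t in auto)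
        then have "norm (dirichlet_sum b (s + of_real t)) \<le> S"
          unfolding dirichlet_sum_def S_def by (rule norm_suminf_le[OF _ sm])
        moreover have "norm ((of_nat k :: complex) powr (- (s + of_real t))) = exp (- (ln (real k) * (Re s + t)))"
          unfolding norm_nat_powr powr_def using k by (simp add: algebra_simps)
        ultimately show ?thesis unfolding \<Phi>_def norm_mult by (simp add: mult_left_mono)
      qed
      then show "eventually (\<lambda>t. norm (\<Phi> (s + of_real t)) \<le> exp (- (ln (real k) * (Re s + t))) * S) at_top"
        using eventually_ge_at_top[of "0::real"] by (rule eventually_mono[rotated])
    qed
  qed
  then show ?thesis using \<Phi>[of s] s by simp
qed

text \<open>Integration term by term gives a Dirichlet series with the integral representation that the
definition asks for; since a Dirichlet series is determined by its sum on a half-plane, no other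
series has it.\<close>

lemma volterra_polynomial:
  fixes x :: "nat \<Rightarrow> 'a::complex_banach"
  assumes g: "g \<in> Dirichlet" and Q: "finite Q" "\<And>q. q \<in> Q \<Longrightarrow> q \<ge> 2"
  shows "volterra g (\<lambda>m. if m \<in> Q then x m else 0) = (\<lambda>m. \<Sum>q\<in>Q. volterra_coeff g q m *\<^sub>C x q)"
proof -
  let ?f = "\<lambda>m. if m \<in> Q then x m else 0" and ?h = "\<lambda>m. \<Sum>q\<in>Q. volterra_coeff g q m *\<^sub>C x q"
  let ?I = "\<lambda>s t. deriv (dirichlet_sum g) (s + of_real t) *\<^sub>C dirichlet_sum ?f (s + of_real t)"
  let ?P = "\<lambda>h. h \<in> Dirichlet \<and> (\<exists>\<sigma>::real. \<forall>s. Re s > \<sigma> \<longrightarrow> (?I s has_integral - dirichlet_sum h s) {0..})"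
  obtain \<sigma> where conv: "abs_conv g \<sigma>" using Dirichlet_abs_conv[OF g] by blast
  have g0: "g 0 = 0" using g by (simp add: Dirichlet_def)
  have f: "dirichlet_sum ?f z = (\<Sum>q\<in>Q. of_nat q powr (- z) *\<^sub>C x q)" for z
    unfolding dirichlet_sum_def dterm_def
    by (subst suminf_finite[OF Q(1)]) (auto simp: linear_0[OF linear_scaleC_right])
  have vconv: "abs_conv (volterra_coeff g q) \<sigma>" if "q \<in> Q" for q
  proof -
    have q2: "q \<ge> 2" using Q(2)[OF that] .
    have "summable (\<lambda>n. norm (g n * of_real (ln (real n) / ln (real (n * q)))) * real n powr (- \<sigma>))"
      using volterra_coeff_sums(2)[OF conv g0 q2, of "of_real \<sigma>"] by (simp add: abs_conv_def)
    then have "summable (\<lambda>n. real q powr (- \<sigma>) * (norm (g n * of_real (ln (real n) / ln (real (n * q)))) * real n powr (- \<sigma>)))"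
      by (rule summable_mult)
    moreover have eq: "real q powr (- \<sigma>) * (norm (g n * of_real (ln (real n) / ln (real (n * q)))) * real n powr (- \<sigma>)) =
        norm (volterra_coeff g q (n * q)) * real (n * q) powr (- \<sigma>)" for n
      using q2 volterra_coeff_mult[of q g n] by (simp add: powr_mult mult_ac)
    ultimately have "summable (\<lambda>n. norm (volterra_coeff g q (n * q)) * real (n * q) powr (- \<sigma>))" by (simp only: eq)
    then show ?thesis unfolding abs_conv_def
    proof (subst (asm) summable_mono_reindex)
      show "strict_mono (\<lambda>n. n * q)" using q2 by (auto simp: strict_mono_def)
      fix m assume "m \<notin> range (\<lambda>n. n * q)"
      then have "\<not> q dvd m" by (auto simp: dvd_def mult.commute)
      then show "norm (volterra_coeff g q m) * real m powr (- \<sigma>) = 0" by (simp add: volterra_coeff_def)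
    qed
  qed
  have hconv: "abs_conv ?h \<sigma>" by (intro abs_conv_sum abs_conv_scaleC_left vconv Q(1))
  have "?h 0 = 0" by (simp add: volterra_coeff_def g0 linear_0[OF linear_scaleC_left])
  then have hD: "?h \<in> Dirichlet" using hconv by (rule DirichletI)
  have int: "(?I s has_integral - dirichlet_sum ?h s) {0..}" if s: "Re s > \<sigma> + 1" for s
  proof -
    have "((\<lambda>t. (deriv (dirichlet_sum g) (s + of_real t) * of_nat q powr (- (s + of_real t))) *\<^sub>C x q)
      has_integral (- dirichlet_sum (volterra_coeff g q) s) *\<^sub>C x q) {0..}" if "q \<in> Q" for q
      using has_integral_linear[OF volterra_monomial_integral[OF conv g0 Q(2)[OF that] s] bounded_linear_scaleC_left[of "x q"]]
      by (simp only: o_def)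
    then have "((\<lambda>t. \<Sum>q\<in>Q. (deriv (dirichlet_sum g) (s + of_real t) * of_nat q powr (- (s + of_real t))) *\<^sub>C x q)
      has_integral (\<Sum>q\<in>Q. (- dirichlet_sum (volterra_coeff g q) s) *\<^sub>C x q)) {0..}"
      by (rule has_integral_sum[OF Q(1)])
    moreover have "(\<Sum>q\<in>Q. (deriv (dirichlet_sum g) (s + of_real t) * of_nat q powr (- (s + of_real t))) *\<^sub>C x q) = ?I s t" for t
      unfolding f by (simp add: linear_sum[OF linear_scaleC_right] scaleC_scaleC)
    moreover have "dirichlet_sum ?h s = (\<Sum>q\<in>Q. dirichlet_sum (volterra_coeff g q) s *\<^sub>C x q)"
    proof -
      have "(\<lambda>n. dterm (volterra_coeff g q) s n *\<^sub>C x q) sums (dirichlet_sum (volterra_coeff g q) s *\<^sub>C x q)" if "q \<in> Q" for q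
        unfolding dirichlet_sum_def
        by (rule bounded_linear.sums[OF bounded_linear_scaleC_left summable_sums[OF abs_conv_summable[OF vconv[OF that]]]])
           (use s in simp)
      then have "(\<lambda>n. \<Sum>q\<in>Q. dterm (volterra_coeff g q) s n *\<^sub>C x q) sums (\<Sum>q\<in>Q. dirichlet_sum (volterra_coeff g q) s *\<^sub>C x q)"
        by (rule sums_sum)
      moreover have "(\<Sum>q\<in>Q. dterm (volterra_coeff g q) s n *\<^sub>C x q) = dterm ?h s n" for n
        by (simp add: dterm_def scaleC_complex_def linear_sum[OF linear_scaleC_right] scaleC_scaleC)
      ultimately show ?thesis by (simp add: dirichlet_sum_def sums_iff)
    qed
    moreover have "(\<Sum>q\<in>Q. (- dirichlet_sum (volterra_coeff g q) s) *\<^sub>C x q) = - (\<Sum>q\<in>Q. dirichlet_sum (volterra_coeff g q) s *\<^sub>C x q)"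
      by (simp add: linear_neg[OF linear_scaleC_left] sum_negf)
    ultimately show ?thesis by simp
  qed
  show ?thesis
    unfolding volterra_def
  proof (rule the_equality)
    show "?P ?h" using hD int by blast
    fix h assume h: "?P h"
    then obtain \<tau> where \<tau>: "\<And>s. Re s > \<tau> \<Longrightarrow> (?I s has_integral - dirichlet_sum h s) {0..}" by blast
    show "h = ?h"
    proof (rule Dirichlet_unique[of _ _ "max \<tau> (\<sigma> + 1)"])
      fix s assume "Re s > max \<tau> (\<sigma> + 1)"
      then have "- dirichlet_sum h s = - dirichlet_sum ?h s"
        using has_integral_unique[OF \<tau>[of s] int[of s]] by simp
      then show "dirichlet_sum h s = dirichlet_sum ?h s" by simp
    qed (use h hD in auto)
  qed
qed

section \<open>Divergence of the sum of inverse primes\<close>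

text \<open>An integer is determined by its square part and the set of primes in its squarefree part.\<close>

lemma card_smooth_le:
  fixes B :: "nat set"
  assumes B: "finite B"
  shows "card {n \<in> {1..m\<^sup>2}. prime_factors n \<subseteq> B} \<le> 2 ^ card B * m"
proof -
  let ?S = "{n \<in> {1..m\<^sup>2}. prime_factors n \<subseteq> B}"
  let ?f = "\<lambda>n :: nat. (prime_factors (squarefree_part n), square_part n)"
  have "inj_on ?f ?S"
  proof (rule inj_onI)
    fix n k assume n: "n \<in> ?S" and k: "k \<in> ?S" and eq: "?f n = ?f k"
    have "squarefree_part n = squarefree_part k"
    proof (rule multiplicity_eq_nat)
      show "squarefree_part n > 0" "squarefree_part k > 0" by (simp_all add: zero_less_iff_neq_zero)
      fix p :: nat assume p: "prime p"
      have one: "multiplicity p (squarefree_part j) = (if p \<in> prime_factors (squarefree_part j) then 1 else 0)" for j :: nat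
      proof (cases "p \<in> prime_factors (squarefree_part j)")
        case True
        then have "multiplicity p (squarefree_part j) > 0" by (simp add: prime_factors_multiplicity)
        moreover have "multiplicity p (squarefree_part j) \<le> Suc 0" by (rule prime_multiplicity_squarefree_part_le_Suc_0[OF p])
        ultimately show ?thesis using True by simp
      next
        case False
        then show ?thesis using p by (simp add: prime_factors_multiplicity)
      qed
      show "multiplicity p (squarefree_part n) = multiplicity p (squarefree_part k)"
        using eq unfolding one by simp
    qed
    then show "n = k" using eq squarefree_decompose[of n] squarefree_decompose[of k] by simp
  qed
  moreover have "?f ` ?S \<subseteq> Pow B \<times> {1..m}"
  proof (rule image_subsetI)
    fix n assume "n \<in> ?S"
    then have n: "1 \<le> n" "n \<le> m\<^sup>2" and nB: "prime_factors n \<subseteq> B" by auto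
    have "squarefree_part n dvd n" using squarefree_decompose[of n] by (metis dvd_triv_left)
    then have "prime_factors (squarefree_part n) \<subseteq> prime_factors n"
      using n by (intro dvd_prime_factors) auto
    moreover have "(square_part n)\<^sup>2 \<le> m\<^sup>2"
      using n dvd_imp_le[OF square_part_square_dvd[of n]] by (intro order_trans[of "(square_part n)\<^sup>2" n "m\<^sup>2"]) auto
    then have "square_part n \<le> m" by (simp only: power2_nat_le_eq_le)
    moreover have "square_part n \<noteq> 0" using n by simp
    then have "1 \<le> square_part n" by arith
    ultimately show "?f n \<in> Pow B \<times> {1..m}" using nB by simp
  qed
  ultimately have "card ?S \<le> card (Pow B \<times> {1..m})"
    by (rule card_inj_on_le) (use B in auto)
  then show ?thesis using B by (simp add: card_cartesian_product card_Pow)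
qed

text \<open>The argument of Erdos. If the sum of the inverses of the primes \<open>p \<ge> y\<close> were below \<open>1/2\<close>, then fewer
than half of the integers up to \<open>m\<^sup>2\<close> would have such a prime factor, and the remaining
ones are too few: at most \<open>2 ^ card B * m\<close>, where \<open>B\<close> is the set of primes below \<open>y\<close>.\<close>

lemma not_summable_inverse_primes: "\<not> summable (\<lambda>n. if prime n then 1 / real n else 0)"
proof
  let ?f = "\<lambda>n :: nat. if prime n then 1 / real n else 0"
  assume s: "summable ?f"
  obtain y where y: "\<And>m n. m \<ge> y \<Longrightarrow> norm (sum ?f {m..<n}) < 1 / 2"
    using s[unfolded summable_Cauchy, rule_format, of "1 / 2"] by auto
  define B where "B = {p :: nat. prime p \<and> p < y}"
  have B: "finite B" unfolding B_def by simp
  \<comment> \<open>so large that \<open>2 ^ card B * m < m\<^sup>2 / 2\<close>\<close>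
  define m where "m = 2 * 2 ^ card B + (1::nat)"
  let ?S = "{n \<in> {1..m\<^sup>2}. prime_factors n \<subseteq> B}"
  let ?P = "{p \<in> {y..<Suc (m\<^sup>2)}. prime p}"
  let ?M = "\<lambda>p. {n \<in> {1..m\<^sup>2}. p dvd n}"
  have cover: "{1..m\<^sup>2} \<subseteq> ?S \<union> (\<Union>p\<in>?P. ?M p)"
  proof
    fix n assume n: "n \<in> {1..m\<^sup>2}"
    show "n \<in> ?S \<union> (\<Union>p\<in>?P. ?M p)"
    proof (cases "prime_factors n \<subseteq> B")
      case False
      then obtain p where p: "prime p" "p dvd n" "p \<notin> B" using n by (auto simp: in_prime_factors_iff)
      then have "p \<le> m\<^sup>2" using n dvd_imp_le[of p n] by auto
      then show ?thesis using p n by (auto simp: B_def)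
    qed (use n in auto)
  qed
  have cardM: "real (card (?M p)) \<le> real (m\<^sup>2) * (1 / real p)" if "p > 0" for p
  proof -
    have "?M p \<subseteq> (\<lambda>k. p * k) ` {1..m\<^sup>2 div p}"
    proof
      fix n assume "n \<in> ?M p"
      then obtain k where k: "n = p * k" "1 \<le> n" "n \<le> m\<^sup>2" by auto
      then have "1 \<le> k" "k \<le> m\<^sup>2 div p"
        using that by (auto simp: less_eq_div_iff_mult_less_eq mult.commute intro: Suc_leI Nat.gr0I)
      then show "n \<in> (\<lambda>k. p * k) ` {1..m\<^sup>2 div p}" using k by auto
    qed
    then have "card (?M p) \<le> card {1..m\<^sup>2 div p}" by (intro surj_card_le) auto
    then have "real (card (?M p)) \<le> real (m\<^sup>2 div p)" by simp
    also have "\<dots> \<le> real (m\<^sup>2) / real p" by (metis floor_divide_of_nat_eq of_int_floor_le of_int_of_nat_eq)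
    finally show ?thesis by simp
  qed
  have "m\<^sup>2 = card {1..m\<^sup>2}" by simp
  also have "\<dots> \<le> card (?S \<union> (\<Union>p\<in>?P. ?M p))" by (rule card_mono[OF _ cover]) auto
  also have "\<dots> \<le> card ?S + card (\<Union>p\<in>?P. ?M p)" by (rule card_Un_le)
  also have "card (\<Union>p\<in>?P. ?M p) \<le> (\<Sum>p\<in>?P. card (?M p))" by (rule card_UN_le) auto
  also have "card ?S \<le> 2 ^ card B * m" by (rule card_smooth_le[OF B])
  finally have "m\<^sup>2 \<le> 2 ^ card B * m + (\<Sum>p\<in>?P. card (?M p))" by simp
  then have "real (m\<^sup>2) \<le> real (2 ^ card B * m + (\<Sum>p\<in>?P. card (?M p)))" by (rule of_nat_mono)
  then have "real (m\<^sup>2) \<le> real (2 ^ card B * m) + (\<Sum>p\<in>?P. real (card (?M p)))"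
    by (simp only: of_nat_add of_nat_sum)
  also have "(\<Sum>p\<in>?P. real (card (?M p))) \<le> (\<Sum>p\<in>?P. real (m\<^sup>2) * (1 / real p))"
    by (rule sum_mono, rule cardM) (auto simp: prime_gt_0_nat)
  also have "\<dots> = real (m\<^sup>2) * (\<Sum>p\<in>?P. 1 / real p)" by (simp only: sum_distrib_left)
  also have "(\<Sum>p\<in>?P. 1 / real p) = sum ?f {y..<Suc (m\<^sup>2)}"
    by (subst sum.inter_filter[symmetric]) auto
  also have "real (m\<^sup>2) * sum ?f {y..<Suc (m\<^sup>2)} \<le> real (m\<^sup>2) * (1 / 2)"
    using y[of y "Suc (m\<^sup>2)"] by (intro mult_left_mono) auto
  finally have "real (m\<^sup>2) \<le> 2 * real (2 ^ card B * m)" by linarith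
  then have "real m * real m \<le> real m * (2 * real (2 ^ card B))"
    by (simp only: power2_eq_square of_nat_mult) (simp only: mult_ac)
  moreover have "m > 0" unfolding m_def by simp
  then have "real m > 0" by simp
  ultimately have "real m \<le> 2 * real (2 ^ card B)" by (simp only: mult_le_cancel_left_pos)
  then show False by (simp add: m_def)
qed

lemma ln_powr_le_linear:
  fixes p :: real
  assumes "p > 0"
  shows "\<exists>K>0. \<forall>x\<ge>1. (ln x) powr p \<le> K * x"
proof -
  have "(ln x) powr p \<le> p powr p * x" if "x \<ge> 1" for x :: real
  proof -
    have "ln x \<le> p * x powr (1 / p)"
      using ln_powr[of x "1 / p"] ln_le_minus_one[of "x powr (1/p)"] that assms by (simp add: field_simps)
    then have "(ln x) powr p \<le> (p * x powr (1 / p)) powr p" using that assms by (intro powr_mono2) auto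
    also have "\<dots> = p powr p * x" using that assms by (simp add: powr_mult powr_powr)
    finally show ?thesis .
  qed
  then show ?thesis using assms by (intro exI[of _ "p powr p"]) auto
qed

text \<open>For \<open>q > n\<close> the term \<open>1 / (ln (n * q)) powr p\<close> is at least a constant, depending on \<open>n\<close>
and \<open>p\<close>, times \<open>1 / q\<close>. So a bound for these sums would make the sum of the inverses of the primes converge.\<close>

lemma prime_log_sums_unbounded:
  fixes p K :: real
  assumes "p > 0" "n \<ge> 1"
  shows "\<exists>Q. finite Q \<and> (\<forall>q\<in>Q. prime q \<and> q > (n::nat)) \<and> (\<Sum>q\<in>Q. 1 / (ln (real (n * q))) powr p) > K"
proof (rule ccontr)
  assume neg: "\<not> ?thesis"
  obtain c where c: "c > 0" "\<And>x. x \<ge> 1 \<Longrightarrow> (ln x) powr p \<le> c * x" using ln_powr_le_linear[OF assms(1)] by blast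
  let ?f = "\<lambda>q :: nat. if prime q then 1 / real q else 0"
  have "summable (\<lambda>q. ?f (q + Suc n))"
  proof (rule bounded_imp_summable)
    fix N
    let ?Q = "{q \<in> {Suc n..<N + Suc n + 1}. prime q}"
    have "(\<Sum>q\<le>N. ?f (q + Suc n)) = sum ?f {Suc n..<N + Suc n + 1}"
      using sum.shift_bounds_nat_ivl[of ?f 0 "Suc n" "Suc N"] by (simp add: atLeast0LessThan lessThan_Suc_atMost)
    also have "\<dots> = (\<Sum>q\<in>?Q. 1 / real q)" by (subst sum.inter_filter) auto
    also have "\<dots> \<le> (\<Sum>q\<in>?Q. c * real n * (1 / (ln (real (n * q))) powr p))"
    proof (rule sum_mono)
      fix q assume q: "q \<in> ?Q"
      then have qn: "q > n" "prime q" by auto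
      then have q2: "n * q \<ge> 2" using assms(2) prime_ge_2_nat[OF qn(2)] mult_le_mono[of 1 n 2 q] by simp
      then have "real (n * q) > 1" by linarith
      then have "ln (real (n * q)) > 0" by (rule ln_gt_zero)
      then have ln: "ln (real (n * q)) powr p > 0" by (metis less_irrefl powr_gt_zero)
      have "real (n * q) \<ge> 1" using q2 by linarith
      then have "ln (real (n * q)) powr p \<le> c * real (n * q)" by (rule c(2))
      then show "1 / real q \<le> c * real n * (1 / (ln (real (n * q))) powr p)"
        using ln qn prime_gt_0_nat[OF qn(2)] by (simp add: field_simps)
    qed
    also have "\<dots> = c * real n * (\<Sum>q\<in>?Q. 1 / (ln (real (n * q))) powr p)" by (simp only: sum_distrib_left)
    also have "\<dots> \<le> c * real n * K"
    proof (rule mult_left_mono)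
      have "finite ?Q" "\<forall>q\<in>?Q. prime q \<and> q > n" by auto
      then show "(\<Sum>q\<in>?Q. 1 / (ln (real (n * q))) powr p) \<le> K" using neg not_le by blast
    qed (use c(1) in simp)
    finally show "(\<Sum>q\<le>N. ?f (q + Suc n)) \<le> c * real n * K" .
  qed simp
  then have "summable ?f" by (rule summable_iff_shift[THEN iffD1])
  then show False using not_summable_inverse_primes by simp
qed

section \<open>Boundedness forces constancy\<close>

text \<open>The real span of a finite set is contained in its complex span, and a finite complex spanning set contains a basis.
Thus infinite dimension over the complex numbers suffices for the real Dvoretzky-Rogers lemma.\<close>

lemma span_finite_neq_UNIV:
  assumes inf: "infinite_dimensional TYPE('a::complex_banach)" and S: "finite S"
  shows "span S \<noteq> (UNIV :: 'a set)"
proof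
  interpret V: vector_space "scaleC :: complex \<Rightarrow> 'a \<Rightarrow> 'a" by (rule vector_space_scaleC)
  assume U: "span S = (UNIV :: 'a set)"
  have "subspace (V.span S)"
  proof (rule subspaceI)
    fix c :: real and x assume "x \<in> V.span S"
    then have "of_real c *\<^sub>C x \<in> V.span S" by (rule V.span_scale)
    then show "c *\<^sub>R x \<in> V.span S" by (simp add: scaleC_of_real)
  qed (auto intro: V.span_zero V.span_add)
  then have "span S \<subseteq> V.span S" by (intro span_minimal V.span_superset)
  then have VU: "V.span S = UNIV" using U by auto
  obtain B where B: "B \<subseteq> S" "V.independent B" "S \<subseteq> V.span B"
    using V.maximal_independent_subset[of S] by blast
  have "V.span S \<subseteq> V.span B" by (rule V.span_minimal[OF B(3) V.subspace_span])
  then have "V.span B = UNIV" using VU by auto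
  then have "finite_dimensional_vector_space (scaleC :: complex \<Rightarrow> 'a \<Rightarrow> 'a) B"
    using B S by unfold_locales (auto intro: finite_subset)
  then show False using inf unfolding infinite_dimensional_def by blast
qed

text \<open>Testing the contraction with the real vectors \<open>Re (\<phi> (x k))\<close> and \<open>Im (\<phi> (x k))\<close> bounds each of the two sums
of squares by one.\<close>

lemma dual_weakly_square_summable:
  fixes x :: "nat \<Rightarrow> 'a::complex_banach"
  assumes \<phi>: "\<phi> \<in> dual_unit_ball" and x: "ell2_contraction N x"
  shows "(\<Sum>k<N. (cmod (\<phi> (x k)))\<^sup>2) \<le> 2"
proof -
  have bl: "bounded_linear \<phi>" and on: "onorm \<phi> \<le> 1" using \<phi> by (auto simp: dual_unit_ball_def complex_dual_def)
  interpret bounded_linear \<phi> by (rule bl)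
  have le: "cmod (\<phi> v) \<le> norm v" for v
    using onorm[OF bl, of v] mult_right_mono[OF on, of "norm v"] by simp
  have key: "(\<Sum>k<N. (a k)\<^sup>2) \<le> 1" if a: "cmod (\<phi> (\<Sum>k<N. a k *\<^sub>R x k)) \<ge> (\<Sum>k<N. (a k)\<^sup>2)" for a
  proof -
    let ?R = "\<Sum>k<N. (a k)\<^sup>2"
    have R0: "?R \<ge> 0" by (simp add: sum_nonneg)
    have "?R \<le> norm (\<Sum>k<N. a k *\<^sub>R x k)" using a le[of "\<Sum>k<N. a k *\<^sub>R x k"] by linarith
    then have "?R\<^sup>2 \<le> (norm (\<Sum>k<N. a k *\<^sub>R x k))\<^sup>2" using R0 by (rule power_mono)
    also have "\<dots> \<le> ?R" using x unfolding ell2_contraction_def by blast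
    finally have "?R * ?R \<le> ?R * 1" by (simp add: power2_eq_square)
    then show ?thesis using R0 by (cases "?R = 0") (auto simp: mult_le_cancel_left)
  qed
  have e: "\<phi> (\<Sum>k<N. a k *\<^sub>R x k) = (\<Sum>k<N. a k *\<^sub>R \<phi> (x k))" for a by (simp add: sum scaleR)
  have "(\<Sum>k<N. (Re (\<phi> (x k)))\<^sup>2) \<le> 1"
  proof (rule key)
    have "(\<Sum>k<N. (Re (\<phi> (x k)))\<^sup>2) = Re (\<phi> (\<Sum>k<N. Re (\<phi> (x k)) *\<^sub>R x k))"
      unfolding e by (simp add: power2_eq_square)
    then show "(\<Sum>k<N. (Re (\<phi> (x k)))\<^sup>2) \<le> cmod (\<phi> (\<Sum>k<N. Re (\<phi> (x k)) *\<^sub>R x k))"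
      using complex_Re_le_cmod by simp
  qed
  moreover have "(\<Sum>k<N. (Im (\<phi> (x k)))\<^sup>2) \<le> 1"
  proof (rule key)
    have "(\<Sum>k<N. (Im (\<phi> (x k)))\<^sup>2) = Im (\<phi> (\<Sum>k<N. Im (\<phi> (x k)) *\<^sub>R x k))"
      unfolding e by (simp add: power2_eq_square)
    then show "(\<Sum>k<N. (Im (\<phi> (x k)))\<^sup>2) \<le> cmod (\<phi> (\<Sum>k<N. Im (\<phi> (x k)) *\<^sub>R x k))"
      using abs_Im_le_cmod[of "\<phi> (\<Sum>k<N. Im (\<phi> (x k)) *\<^sub>R x k)"] by linarith
  qed
  ultimately show ?thesis by (simp add: cmod_power2 sum.distrib)
qed

text \<open>For every functional \<open>\<phi>\<close> the scalar series \<open>\<phi> \<circ> f\<close> is the Bohr transform of a linear polynomial, to which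
Khinchin's inequality applies.\<close>

lemma hardy_weak_prime_polynomial:
  fixes x :: "nat \<Rightarrow> 'a::complex_banach"
  assumes Q: "finite Q" "\<And>q. q \<in> Q \<Longrightarrow> prime q" and p: "1 \<le> p"
    and x: "\<And>\<phi>. \<phi> \<in> dual_unit_ball \<Longrightarrow> (\<Sum>q\<in>Q. (cmod (\<phi> (x q)))\<^sup>2) \<le> 2"
  shows "(\<lambda>m. if m \<in> Q then x m else 0) \<in> hardy_weak p"
    and "hardy_weak_norm p (\<lambda>m. if m \<in> Q then x m else 0) \<le> (p powr p * (4 * exp 4)) powr (1 / p)"
    and "0 \<le> hardy_weak_norm p (\<lambda>m. if m \<in> Q then x m else 0)"
proof -
  let ?f = "\<lambda>m. if m \<in> Q then x m else 0" and ?L = "(p powr p * (4 * exp 4)) powr (1 / p)"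
  define J where "J = nth_prime -` Q"
  have J: "finite J" unfolding J_def by (rule finite_vimageI[OF Q(1) inj_nth_prime])
  have "Q \<subseteq> range nth_prime" using nth_prime_surj Q(2) by blast
  then have QJ: "Q = nth_prime ` J" unfolding J_def by (simp add: image_vimage_eq Int_absorb2)
  define a where "a \<phi> j = \<phi> (x (nth_prime j))" for \<phi> :: "'a \<Rightarrow> complex" and j
  have comp: "\<phi> \<circ> ?f = bohr (linear_poly J (a \<phi>))" if \<phi>: "\<phi> \<in> complex_dual" for \<phi>
  proof
    fix m
    have z: "\<phi> 0 = 0" using \<phi> by (simp add: complex_dual_def linear_0 bounded_linear.linear)
    show "(\<phi> \<circ> ?f) m = bohr (linear_poly J (a \<phi>)) m"
    proof (cases "m \<in> Q")
      case True
      then obtain i where i: "i \<in> J" "m = nth_prime i" using QJ by blast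
      have "(\<Sum>j\<in>J. if m = nth_prime j then a \<phi> j else 0) = (\<Sum>j\<in>J. if j = i then a \<phi> j else 0)"
        by (rule sum.cong) (simp_all add: i(2) inj_eq[OF inj_nth_prime] eq_commute)
      then show ?thesis using True i J by (simp add: bohr_linear_poly[OF J] a_def)
    next
      case False
      then have "(\<Sum>j\<in>J. if m = nth_prime j then a \<phi> j else 0) = 0"
        using QJ by (intro sum.neutral) auto
      then show ?thesis using False z by (simp add: bohr_linear_poly[OF J])
    qed
  qed
  have bound: "hardy_norm p (\<phi> \<circ> ?f) \<le> ?L" if \<phi>: "\<phi> \<in> dual_unit_ball" for \<phi>
  proof -
    have d: "\<phi> \<in> complex_dual" using \<phi> by (simp add: dual_unit_ball_def)
    have "(\<Sum>j\<in>J. (cmod (a \<phi> j))\<^sup>2) = (\<Sum>q\<in>Q. (cmod (\<phi> (x q)))\<^sup>2)"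
      unfolding QJ by (subst sum.reindex[OF inj_on_subset[OF inj_nth_prime subset_UNIV]]) (simp add: a_def o_def)
    then have "(\<Sum>j\<in>J. (cmod (a \<phi> j))\<^sup>2) \<le> 2" using x[OF \<phi>] by simp
    then have "(LINT z|torus_measure. norm (linear_poly J (a \<phi>) z) powr p) \<le> p powr p * (4 * exp 4)"
      by (rule Khinchin_upper[OF J]) (use p in simp)
    then have "Lp_norm p torus_measure (linear_poly J (a \<phi>)) \<le> ?L"
      unfolding Lp_norm_def by (intro powr_mono2) (use p in \<open>auto intro: integral_nonneg_AE\<close>)
    then show ?thesis unfolding comp[OF d] hardy_norm_linear_poly(2)[OF J p] .
  qed
  \<comment> \<open>a witness that the supremum is taken over a nonempty set\<close>
  have zero: "(\<lambda>v. 0) \<in> (dual_unit_ball :: ('a \<Rightarrow> complex) set)"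
    by (simp add: dual_unit_ball_def complex_dual_def onorm_zero)
  have bdd: "bdd_above ((\<lambda>\<phi>. hardy_norm p (\<phi> \<circ> ?f)) ` dual_unit_ball)"
    using bound by (intro bdd_aboveI2[of _ _ ?L]) auto
  have 0: "0 \<notin> Q" using Q(2)[of 0] by auto
  have "summable (dterm ?f 0)"
    by (rule summable_finite[OF Q(1)]) (simp add: dterm_def linear_0[OF linear_scaleC_right])
  then have "?f \<in> Dirichlet" using 0 by (auto simp: Dirichlet_def conv_set_def)
  then show "?f \<in> hardy_weak p"
    unfolding hardy_weak_def using bdd comp hardy_norm_linear_poly(1)[OF J p] by auto
  show "hardy_weak_norm p ?f \<le> ?L"
    unfolding hardy_weak_norm_def by (rule cSUP_least) (use zero bound in auto)
  have "0 \<le> hardy_norm p ((\<lambda>v. 0 :: complex) \<circ> ?f)" by (simp add: hardy_norm_def Lp_norm_def)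
  also have "\<dots> \<le> hardy_weak_norm p ?f" unfolding hardy_weak_norm_def by (rule cSUP_upper[OF zero bdd])
  finally show "0 \<le> hardy_weak_norm p ?f" .
qed

text \<open>The lower bound on the torus, translated by Bohr's correspondence: multiplication by the prime \<open>q\<close> adds a
unit vector to the exponents, and the exponents of \<open>n\<close> vanish at all primes larger than \<open>n\<close>.\<close>

lemma hardy_lower_bound:
  fixes h :: "nat \<Rightarrow> 'a::complex_banach"
  assumes PL: "\<And>x y::'a. (LINT \<xi>|circle_measure. norm (x + \<xi> *\<^sub>C y) powr p) \<ge> norm x powr p + C * norm y powr p"
    and p: "1 \<le> p" and C: "0 \<le> C" and h: "h \<in> hardy p"
    and Q: "finite Q" "\<And>q. q \<in> Q \<Longrightarrow> prime q \<and> q > n" and n: "n > 0"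
  shows "C * (1 / 2) powr p * (\<Sum>q\<in>Q. norm (h (n * q)) powr p) \<le> hardy_norm p h powr p"
proof -
  define G where "G = inv_into (Hp_torus p) bohr h"
  have im: "h \<in> bohr ` (Hp_torus p :: ((nat \<Rightarrow> complex) \<Rightarrow> 'a) set)" using h by (simp add: hardy_def)
  have G: "G \<in> Hp_torus p" "bohr G = h" unfolding G_def by (rule inv_into_into[OF im], rule f_inv_into_f[OF im])
  define J where "J = nth_prime -` Q"
  have J: "finite J" unfolding J_def by (rule finite_vimageI[OF Q(1) inj_nth_prime])
  have "Q \<subseteq> range nth_prime" using nth_prime_surj Q(2) by blast
  then have QJ: "Q = nth_prime ` J" unfolding J_def by (simp add: image_vimage_eq Int_absorb2)
  have zero: "prime_exponents n j = 0" if "j \<in> J" for j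
  proof -
    have "nth_prime j > n" using that Q(2) by (auto simp: J_def)
    then have "\<not> nth_prime j dvd n" using n by (auto dest: dvd_imp_le)
    then show ?thesis by (simp add: prime_exponents_def not_dvd_imp_multiplicity_0)
  qed
  have coeff: "fourier_coeff G (\<lambda>i. prime_exponents n i + unit_index j i) = h (n * nth_prime j)" for j
  proof -
    have pos: "nth_prime j > 0" by (rule prime_gt_0_nat[OF prime_nth_prime])
    have "h (n * nth_prime j) = bohr G (n * nth_prime j)" by (simp add: G)
    also have "\<dots> = fourier_coeff G (prime_exponents (n * nth_prime j))" using n pos by (simp add: bohr_def)
    finally show ?thesis unfolding prime_exponents_mult[OF n pos] prime_exponents_nth_prime by simp
  qed
  have "(\<Sum>q\<in>Q. norm (h (n * q)) powr p) = (\<Sum>j\<in>J. norm (h (n * nth_prime j)) powr p)"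
    unfolding QJ by (subst sum.reindex[OF inj_on_subset[OF inj_nth_prime subset_UNIV]]) (simp add: o_def)
  also have "C * (1 / 2) powr p * \<dots> \<le> (LINT z|torus_measure. norm (G z) powr p)"
    using Hp_torus_lower_bound[OF PL p C G(1) J prime_exponents_ev_null[OF n] zero] unfolding coeff .
  also have "\<dots> = hardy_norm p h powr p"
    using p by (simp add: hardy_norm_def Lp_norm_def G_def[symmetric] powr_powr integral_nonneg_AE)
  finally show ?thesis by simp
qed

theorem theorem1p1:
  fixes p :: real and g :: "nat \<Rightarrow> complex"
  assumes "2 \<le> p"
    and "g \<in> Dirichlet"
    and "infinite_dimensional TYPE('a::complex_banach)"
    and "uniformly_PL_convex p TYPE('a)"
    and "\<forall>f \<in> hardy_weak p. volterra g f \<in> (hardy_plus p :: (nat \<Rightarrow> 'a) set)"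
    and "\<exists>C. \<forall>f \<in> (hardy_weak p :: (nat \<Rightarrow> 'a) set).
           hardy_plus_norm p (volterra g f) \<le> C * hardy_weak_norm p f"
  shows "dirichlet_sum g constant_on conv_set g"
proof -
  have p1: "1 \<le> p" and p0: "0 < p" using assms(1) by auto
  obtain C where C: "C > 0" and PL: "\<And>x y::'a. (LINT \<xi>|circle_measure. norm (x + \<xi> *\<^sub>C y) powr p) \<ge> norm x powr p + C * norm y powr p"
    using assms(4) unfolding uniformly_PL_convex_def by blast
  obtain K where K: "\<And>f :: nat \<Rightarrow> 'a. f \<in> hardy_weak p \<Longrightarrow> hardy_plus_norm p (volterra g f) \<le> K * hardy_weak_norm p f"
    using assms(6) by blast
  define M where "M = \<bar>K\<bar> * (p powr p * (4 * exp 4)) powr (1 / p)"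
  have M: "M \<ge> 0" by (simp add: M_def)
  have zero: "g n = 0" if n: "n \<ge> 2" for n
  proof (rule ccontr)
    assume gn: "g n \<noteq> 0"
    have n0: "n > 0" and n1: "n \<ge> 1" using n by auto
    \<comment> \<open>the factor \<open>1/4\<close> is the lower bound for the norms of the vectors \<open>x q\<close>\<close>
    define b where "b = cmod (g n) * ln (real n) / 4"
    have b: "b > 0" using gn n by (simp add: b_def)
    \<comment> \<open>the constants of the lower bound; \<open>Q\<close> is chosen so that this bound exceeds \<open>M powr p\<close>\<close>
    define \<kappa> where "\<kappa> = C * (1 / 2) powr p * b powr p"
    have \<kappa>: "\<kappa> > 0" using C b by (simp add: \<kappa>_def)
    obtain Q where Q: "finite Q" "\<And>q. q \<in> Q \<Longrightarrow> prime q \<and> q > n"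
      and big: "(\<Sum>q\<in>Q. 1 / (ln (real (n * q))) powr p) > M powr p / \<kappa>"
      using prime_log_sums_unbounded[OF p0 n1, of "M powr p / \<kappa>"] by blast
    have Qp: "\<And>q. q \<in> Q \<Longrightarrow> prime q" using Q(2) by blast
    obtain y :: "nat \<Rightarrow> 'a" where y: "\<And>k. k < card Q \<Longrightarrow> norm (y k) \<ge> 1 / 4" "ell2_contraction (card Q) y"
      using Dvoretzky_Rogers[OF span_finite_neq_UNIV[OF assms(3)], of "card Q"] by blast
    obtain h where h: "bij_betw h Q {0..<card Q}" using ex_bij_betw_finite_nat[OF Q(1)] by blast
    define x where "x q = y (h q)" for q
    have hlt: "h q < card Q" if "q \<in> Q" for q using bij_betwE[OF h] that by auto
    have xnorm: "norm (x q) \<ge> 1 / 4" if "q \<in> Q" for q using y(1)[OF hlt[OF that]] by (simp add: x_def)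
    have xweak: "(\<Sum>q\<in>Q. (cmod (\<phi> (x q)))\<^sup>2) \<le> 2" if \<phi>: "\<phi> \<in> dual_unit_ball" for \<phi>
    proof -
      have "(\<Sum>q\<in>Q. (cmod (\<phi> (x q)))\<^sup>2) = (\<Sum>k\<in>{0..<card Q}. (cmod (\<phi> (y k)))\<^sup>2)"
        unfolding x_def by (rule sum.reindex_bij_betw[OF h])
      then show ?thesis using dual_weakly_square_summable[OF \<phi> y(2)] by (simp add: atLeast0LessThan)
    qed
    define f where "f m = (if m \<in> Q then x m else 0)" for m
    have f_eq: "f = (\<lambda>m. if m \<in> Q then x m else 0)" by (simp add: f_def fun_eq_iff)
    note weak = hardy_weak_prime_polynomial[of Q p x, OF Q(1) Qp p1 xweak, folded f_eq]
    define H where "H = volterra g f"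
    have H: "H = (\<lambda>m. \<Sum>q\<in>Q. volterra_coeff g q m *\<^sub>C x q)"
      unfolding H_def f_eq by (rule volterra_polynomial[OF assms(2) Q(1)]) (use Qp prime_ge_2_nat in blast)
    have plus: "H \<in> hardy_plus p" unfolding H_def using assms(5) weak(1) by blast
    have "hardy_plus_norm p H \<le> K * hardy_weak_norm p f" unfolding H_def by (rule K[OF weak(1)])
    also have "\<dots> \<le> \<bar>K\<bar> * hardy_weak_norm p f" using weak(3) by (intro mult_right_mono abs_ge_self)
    also have "\<dots> \<le> M" unfolding M_def by (rule mult_left_mono[OF weak(2) abs_ge_zero])
    finally have normH: "hardy_plus_norm p H \<le> M" .
    have Hval: "H (n * q) = (g n * of_real (ln (real n) / ln (real (n * q)))) *\<^sub>C x q" if q: "q \<in> Q" for q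
    proof -
      have "volterra_coeff g r (n * q) *\<^sub>C x r = (if r = q then volterra_coeff g q (n * q) *\<^sub>C x q else 0)" if r: "r \<in> Q" for r
      proof (cases "r = q")
        case False
        have "\<not> r dvd n" using Q(2)[OF r] n0 by (auto dest: dvd_imp_le)
        moreover have "\<not> r dvd q" using False Qp[OF r] Qp[OF q] primes_dvd_imp_eq by blast
        ultimately have "\<not> r dvd n * q" using Qp[OF r] by (simp add: prime_dvd_mult_iff)
        then show ?thesis using False by (simp add: volterra_coeff_def linear_0[OF linear_scaleC_left])
      qed simp
      then have "H (n * q) = (\<Sum>r\<in>Q. if r = q then volterra_coeff g q (n * q) *\<^sub>C x q else 0)"
        unfolding H by (intro sum.cong) auto
      also have "\<dots> = volterra_coeff g q (n * q) *\<^sub>C x q" using Q(1) q by simp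
      also have "volterra_coeff g q (n * q) = g n * of_real (ln (real n) / ln (real (n * q)))"
        by (rule volterra_coeff_mult) (use Qp[OF q] prime_gt_0_nat in blast)
      finally show ?thesis .
    qed
    have lnpos: "ln (real (n * q)) > 0" if "q \<in> Q" for q
    proof -
      have "1 < n * q" using n prime_gt_0_nat[OF Qp[OF that]] by (cases q) auto
      then show ?thesis by (intro ln_gt_zero) linarith
    qed
    have main: "\<kappa> * (\<Sum>q\<in>Q. (real (n * q) powr (- \<sigma>)) powr p * (1 / (ln (real (n * q))) powr p)) \<le> M powr p" if \<sigma>: "\<sigma> > 0" for \<sigma>
    proof -
      let ?h = "translate (complex_of_real \<sigma>) H"
      have mem: "?h \<in> hardy p" and bdd: "bdd_above ((\<lambda>\<sigma>. hardy_norm p (translate (complex_of_real \<sigma>) H)) ` {0<..})"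
        using plus \<sigma> by (auto simp: hardy_plus_def)
      have "hardy_norm p ?h \<le> hardy_plus_norm p H"
        unfolding hardy_plus_norm_def by (rule cSUP_upper[OF _ bdd]) (use \<sigma> in simp)
      then have hM: "hardy_norm p ?h \<le> M" using normH by linarith
      have low: "(real (n * q) powr (- \<sigma>)) powr p * (1 / (ln (real (n * q))) powr p) * b powr p \<le> norm (?h (n * q)) powr p" if q: "q \<in> Q" for q
      proof -
        have l: "ln (real (n * q)) > 0" by (rule lnpos[OF q])
        have ln0: "ln (real n) \<ge> 0" using n1 by simp
        have "norm (?h (n * q)) = real (n * q) powr (- \<sigma>) * (cmod (g n) * (ln (real n) / ln (real (n * q))) * norm (x q))"
          unfolding translate_def norm_dterm Hval[OF q] norm_scaleC norm_mult norm_of_real using l ln0 by (simp del: of_nat_mult)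
        also have "\<dots> \<ge> real (n * q) powr (- \<sigma>) * (cmod (g n) * (ln (real n) / ln (real (n * q))) * (1 / 4))"
          by (intro mult_left_mono xnorm[OF q]) (use l ln0 in auto)
        finally have "real (n * q) powr (- \<sigma>) * (b / ln (real (n * q))) \<le> norm (?h (n * q))"
          by (simp add: b_def del: of_nat_mult)
        then have "(real (n * q) powr (- \<sigma>) * (b / ln (real (n * q)))) powr p \<le> norm (?h (n * q)) powr p"
          by (rule powr_mono2[rotated 2]) (use b l p0 in auto)
        then show ?thesis using b l by (simp add: powr_mult powr_divide del: of_nat_mult)
      qed
      have "\<kappa> * (\<Sum>q\<in>Q. (real (n * q) powr (- \<sigma>)) powr p * (1 / (ln (real (n * q))) powr p))
          = C * (1 / 2) powr p * (\<Sum>q\<in>Q. (real (n * q) powr (- \<sigma>)) powr p * (1 / (ln (real (n * q))) powr p) * b powr p)"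
        unfolding \<kappa>_def sum_distrib_right[symmetric] by (simp only: mult_ac)
      also have "\<dots> \<le> C * (1 / 2) powr p * (\<Sum>q\<in>Q. norm (?h (n * q)) powr p)"
        by (intro mult_left_mono sum_mono low) (use C in auto)
      also have "\<dots> \<le> hardy_norm p ?h powr p"
        by (rule hardy_lower_bound[OF PL p1 _ mem Q n0]) (use C in simp)
      also have "\<dots> \<le> M powr p"
        by (rule powr_mono2) (use p0 hM in \<open>auto simp: hardy_norm_def Lp_norm_def\<close>)
      finally show ?thesis .
    qed
    \<comment> \<open>finitely many terms are involved, so the translation by \<open>\<sigma>\<close> disappears in the limit \<open>\<sigma> \<rightarrow> 0\<close>\<close>
    have lim: "((\<lambda>\<sigma>. \<kappa> * (\<Sum>q\<in>Q. (real (n * q) powr (- \<sigma>)) powr p * (1 / (ln (real (n * q))) powr p)))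
      \<longlongrightarrow> \<kappa> * (\<Sum>q\<in>Q. (real (n * q) powr (- 0)) powr p * (1 / (ln (real (n * q))) powr p))) (at_right 0)"
      by (intro tendsto_intros) (use n prime_gt_0_nat[OF Qp] in auto)
    have "\<kappa> * (\<Sum>q\<in>Q. (real (n * q) powr (- 0)) powr p * (1 / (ln (real (n * q))) powr p)) \<le> M powr p"
      by (rule tendsto_upperbound[OF lim]) (use main in \<open>auto simp: eventually_at_right_less intro: eventually_at_rightI[of 0 1]\<close>)
    moreover have "real (n * q) powr (- 0) = 1" if "q \<in> Q" for q
      using n0 prime_gt_0_nat[OF Qp[OF that]] by simp
    then have "(\<Sum>q\<in>Q. (real (n * q) powr (- 0)) powr p * (1 / (ln (real (n * q))) powr p)) = (\<Sum>q\<in>Q. 1 / (ln (real (n * q))) powr p)"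
      by (intro sum.cong) (auto simp del: of_nat_mult)
    ultimately have "\<kappa> * (\<Sum>q\<in>Q. 1 / (ln (real (n * q))) powr p) \<le> M powr p" by (simp only:)
    then show False using big \<kappa> by (simp add: divide_less_eq mult.commute del: of_nat_mult)
  qed
  have "dirichlet_sum g s = g 1" for s
  proof -
    have d: "dterm g s m = (if m = 1 then g 1 else 0)" for m
      using zero[of m] assms(2) by (cases "m = 0"; cases "m = 1") (auto simp: dterm_def scaleC_complex_def Dirichlet_def)
    have "dterm g s sums (\<Sum>m\<in>{1}. dterm g s m)" by (rule sums_finite) (simp_all add: d)
    then have "dterm g s sums g 1" by (simp add: d)
    then show ?thesis unfolding dirichlet_sum_def by (rule sums_unique[symmetric])
  qed
  then show ?thesis by (auto simp: constant_on_def)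
qed

end
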